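(* Let $X$ be an $n\times n$ random matrix from the general inhomogeneous model (defined in the context) with variance profile $(b_{ij})$, entry law $\xi$ and bandwidth $b_n$. Assume that $b_n\ge n^{\epsilon}$ for some sufficiently small fixed $\epsilon>0$, and that $\xi$ has a (real or complex) Gaussian distribution. Then for any (sufficiently small) fixed $\mathbf{c}>0$ the following holds for all sufficiently large $n$: with probability at least $1-n^{-10}$, all eigenvectors $\psi$ of $X$ with unit $L^2$ norm satisfy $$\|\psi\|_\infty\le (b_n)^{-1/10}\,n^{\mathbf{c}}.$$
   Context: A real or complex random variable $\xi$ of mean zero and variance one ($\mathbb{E}|\xi|^2=1$) is $K$-subgaussian if $\mathbb{E}\exp(|\xi|^2/K^2)\le2$. General inhomogeneous model: $X=(x_{ij})$ is an $n\times n$ random matrix with independent entries; for each $(i,j)\in[n]^2$, $x_{ij}$ is distributed as $b_{ij}\xi$, where $b_{ij}\ge0$ are deterministic and $\xi$ has mean zero, variance one, and is $K$-subgaussian for some fixed $K>0$. The bandwidth $b_n$ is defined by $b_n^{-1}=\sup_{(i,j)\in[n]^2}b_{ij}^2$. The variance profile is doubly stochastic: $\sum_{j\in[n]}b_{ij}^2=1$ for all $i\in[n]$ and $\sum_{i\in[n]}b_{ij}^2=1$ for all $j\in[n]$ (equivalently $\mathbb{E}[XX^*]=\mathbb{E}[X^*X]=I_n$). Eigenvectors are right eigenvectors $\psi\in\mathbb{C}^n$, $X\psi=\lambda\psi$; $\|\psi\|_\infty=\max_j|\psi_j|$. *)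

theory Defs
  imports "HOL-Probability.Probability" "Jordan_Normal_Form.Char_Poly"
begin

(* Random variables are complex-valued throughout; a real random variable is one whose law
   is carried by the real axis. *)

definition standardized_law :: "complex measure \<Rightarrow> bool" where
  "standardized_law \<xi> \<longleftrightarrow>
     prob_space \<xi> \<and> sets \<xi> = sets borel \<and>
     integrable \<xi> (\<lambda>z. z) \<and> (LINT z|\<xi>. z) = 0 \<and>
     integrable \<xi> (\<lambda>z. (cmod z)\<^sup>2) \<and> (LINT z|\<xi>. (cmod z)\<^sup>2) = 1"

(* The expectation is a nonnegative Lebesgue integral, so that a divergent one counts as infinite;
   the Bochner integral would be 0 there. *)
definition subgaussian_law :: "real \<Rightarrow> complex measure \<Rightarrow> bool" where
  "subgaussian_law K \<xi> \<longleftrightarrow> (\<integral>\<^sup>+z. ennreal (exp ((cmod z)\<^sup>2 / K\<^sup>2)) \<partial>\<xi>) \<le> 2"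

definition real_gaussian_law :: "real measure \<Rightarrow> bool" where
  "real_gaussian_law \<mu> \<longleftrightarrow>
     (\<exists>m \<sigma>. 0 < \<sigma> \<and> \<mu> = density lborel (\<lambda>x. ennreal (normal_density m \<sigma> x))) \<or>
     (\<exists>m. \<mu> = return borel m)"

(* Gaussian law on the plane: every real-linear functional is Gaussian. Point masses are allowed
   in real_gaussian_law so that this includes the degenerate Gaussians, in particular the real ones,
   whose imaginary part is constant. No circular symmetry is imposed. *)
definition gaussian_law :: "complex measure \<Rightarrow> bool" where
  "gaussian_law \<xi> \<longleftrightarrow>
     (\<forall>s t :: real. real_gaussian_law (distr \<xi> borel (\<lambda>z. s * Re z + t * Im z)))"

definition doubly_stochastic_profile :: "nat \<Rightarrow> (nat \<Rightarrow> nat \<Rightarrow> real) \<Rightarrow> bool" where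
  "doubly_stochastic_profile n b \<longleftrightarrow>
     (\<forall>i<n. (\<Sum>j<n. (b i j)\<^sup>2) = 1) \<and> (\<forall>j<n. (\<Sum>i<n. (b i j)\<^sup>2) = 1)"

definition bandwidth :: "nat \<Rightarrow> (nat \<Rightarrow> nat \<Rightarrow> real) \<Rightarrow> real" where
  "bandwidth n b = inverse (SUP (i, j)\<in>{..<n} \<times> {..<n}. (b i j)\<^sup>2)"

(* Measurability of the entries of X is part of indep_vars. *)
definition inhomogeneous_model ::
  "real \<Rightarrow> nat \<Rightarrow> (nat \<Rightarrow> nat \<Rightarrow> real) \<Rightarrow> complex measure \<Rightarrow> 'w measure \<Rightarrow> ('w \<Rightarrow> complex mat) \<Rightarrow> bool"
  where
  "inhomogeneous_model K n b \<xi> M X \<longleftrightarrow>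
     standardized_law \<xi> \<and> subgaussian_law K \<xi> \<and>
     (\<forall>i<n. \<forall>j<n. 0 \<le> b i j) \<and> doubly_stochastic_profile n b \<and>
     prob_space M \<and> (\<forall>\<omega>\<in>space M. X \<omega> \<in> carrier_mat n n) \<and>
     prob_space.indep_vars M (\<lambda>_. borel) (\<lambda>p \<omega>. X \<omega> $$ p) ({..<n} \<times> {..<n}) \<and>
     (\<forall>i<n. \<forall>j<n. distr M borel (\<lambda>\<omega>. X \<omega> $$ (i, j)) =
                     distr \<xi> borel (\<lambda>z. complex_of_real (b i j) * z))"

definition l2_norm_vec :: "complex vec \<Rightarrow> real" where
  "l2_norm_vec v = sqrt (\<Sum>j<dim_vec v. (cmod (vec_index v j))\<^sup>2)"

definition max_norm_vec :: "complex vec \<Rightarrow> real" where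
  "max_norm_vec v = Max ((\<lambda>j. cmod (vec_index v j)) ` {..<dim_vec v})"

end

theory Submission
  imports Defs "HOL-Real_Asymp.Real_Asymp"
begin

text \<open>
  Write $Y = X - z$ and $\eta = b_n^{-1/5} n^{c}$. If $X \psi = w \psi$ with $|\psi| = 1$ and
  $|w - z| \le \eta$, then $|\psi_j|^2 \le 2 \eta^2 U_j$, where $U_j$ and $V_j$ are the diagonal entries of
  $(Y^* Y + \eta^2)^{-1}$ and $(Y Y^* + \eta^2)^{-1}$; so it suffices to show $U_j \le 3 / (2 \eta)$ for all
  $z$ in a polynomially fine net (eigenvalues with $|w| \ge b_n^{1/10}$ are handled by the Euclidean norms of
  the rows of $X$).

  Removing column $j$ and then row $j$ of $Y$ expresses $U_j$ by Schur complements through quadratic forms in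
  that column and row, evaluated on independent resolvents. Exponential martingales with truncated
  increments show that these forms are within a constant of their conditional means, with overwhelming
  probability, and rank-one perturbation compares the minors with $Y$ itself. Hence, with $A = 11/8 + \max U$ and
  $B = 5/8 + \min V$, for all $j$,
  \[ U_j (\eta^2 A B + |z|^2) \le A, \qquad V_j (\eta^2 A B + |z|^2) \ge B, \]
  because the profile is doubly stochastic. So $(\max U) B \le (\min V) A$, that is
  $5 \max U \le 11 \min V$, while $\eta^2 (\max U) (\min V) \le 1$. Comparing a maximum with a
  minimum in this way replaces the usual stability analysis of the Dyson equation.
\<close>

section \<open>Resolvents of Gram matrices\<close>

text \<open>The exponents come from a balance. With B = b_n^(1/10), an eigenvalue of modulus at
  least B gives coordinates of order 1/B, while the resolvent gives the square root of \<eta>; up to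
  powers of n^c this forces \<eta> = B^(-2). Concentration uses only the trivial bound 1/\<eta>^2 on
  the norms of resolvent rows and columns, so the forms fluctuate by about b_n^(-1/2) / \<eta>^2 =
  1/B. The critical term is the cross term created by the shift z: it carries a further factor |z|,
  which may be as large as 3 B, and so is just of order one; the powers of n^c make it small.
  Because the comparison of maximum and minimum tolerates errors of constant size, the argument runs
  at a single \<eta>: no descent from large \<eta> and no a priori control of the resolvent. A
  separate obstacle is measurability. The event quantifies over uncountably many eigenvectors, and
  \<open>measure\<close> is 0 on nonmeasurable sets, so a lower bound on its probability needs a
  proof that it is an event.\<close>

definition adj :: "(nat \<Rightarrow> nat \<Rightarrow> complex) \<Rightarrow> nat \<Rightarrow> nat \<Rightarrow> complex" where
  "adj Y = (\<lambda>i k. cnj (Y k i))"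

definition zero_col :: "nat \<Rightarrow> (nat \<Rightarrow> nat \<Rightarrow> complex) \<Rightarrow> nat \<Rightarrow> nat \<Rightarrow> complex" where
  "zero_col j Y = (\<lambda>i k. if k = j then 0 else Y i k)"

definition zero_row :: "nat \<Rightarrow> (nat \<Rightarrow> nat \<Rightarrow> complex) \<Rightarrow> nat \<Rightarrow> nat \<Rightarrow> complex" where
  "zero_row j Y = (\<lambda>i k. if i = j then 0 else Y i k)"

text \<open>The matrix Y Y^* + \<eta>^2. Its companion Y^* Y + \<eta>^2 is
  \<open>gram n \<eta> (adj Y)\<close>, so that U_j is \<open>resd n \<eta> (adj Y) j\<close> and
  V_j is \<open>resd n \<eta> Y j\<close>.\<close>

definition gram :: "nat \<Rightarrow> real \<Rightarrow> (nat \<Rightarrow> nat \<Rightarrow> complex) \<Rightarrow> nat \<Rightarrow> nat \<Rightarrow> complex" where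
  "gram n \<eta> Y i k = (\<Sum>l<n. Y i l * cnj (Y k l)) + (if i = k then complex_of_real (\<eta>\<^sup>2) else 0)"

text \<open>The inverse is written by Cramer's rule: this is an explicit rational function of the
  entries and their conjugates, from which measurability can be read off.\<close>

definition res :: "nat \<Rightarrow> real \<Rightarrow> (nat \<Rightarrow> nat \<Rightarrow> complex) \<Rightarrow> nat \<Rightarrow> nat \<Rightarrow> complex" where
  "res n \<eta> Y i k = adj_mat (mat n n (\<lambda>(i, k). gram n \<eta> Y i k)) $$ (i, k) /
                   det (mat n n (\<lambda>(i, k). gram n \<eta> Y i k))"

definition resd :: "nat \<Rightarrow> real \<Rightarrow> (nat \<Rightarrow> nat \<Rightarrow> complex) \<Rightarrow> nat \<Rightarrow> real" where
  "resd n \<eta> Y i = Re (res n \<eta> Y i i)"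

definition sesq :: "nat \<Rightarrow> (nat \<Rightarrow> nat \<Rightarrow> complex) \<Rightarrow> (nat \<Rightarrow> complex) \<Rightarrow> complex" where
  "sesq n R x = (\<Sum>i<n. \<Sum>k<n. cnj (x i) * R i k * x k)"

lemma adj_adj [simp]: "adj (adj Y) = Y"
  by (simp add: adj_def)

lemma adj_zero_row: "adj (zero_row j Y) = zero_col j (adj Y)"
  by (auto simp: adj_def zero_row_def zero_col_def intro!: ext)

lemma adj_zero_col: "adj (zero_col j Y) = zero_row j (adj Y)"
  by (auto simp: adj_def zero_row_def zero_col_def intro!: ext)

lemma gram_cnj: "cnj (gram n \<eta> Y i k) = gram n \<eta> Y k i"
  by (simp add: gram_def mult.commute)

lemma gram_apply:
  assumes "i < n"
  shows "(\<Sum>k<n. gram n \<eta> Y i k * x k) =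
    (\<Sum>l<n. Y i l * (\<Sum>k<n. cnj (Y k l) * x k)) + complex_of_real (\<eta>\<^sup>2) * x i"
proof -
  have "(\<Sum>k<n. gram n \<eta> Y i k * x k) =
      (\<Sum>k<n. \<Sum>l<n. Y i l * cnj (Y k l) * x k) + (\<Sum>k<n. if i = k then complex_of_real (\<eta>\<^sup>2) * x k else 0)"
    unfolding gram_def distrib_right sum.distrib sum_distrib_right
    by (intro arg_cong2[where f = "(+)"] sum.cong) auto
  also have "(\<Sum>k<n. \<Sum>l<n. Y i l * cnj (Y k l) * x k) = (\<Sum>l<n. Y i l * (\<Sum>k<n. cnj (Y k l) * x k))"
    by (subst sum.swap) (simp add: sum_distrib_left mult.assoc)
  finally show ?thesis using assms by simp
qed

text \<open>The energy identity <x, G x> = |Y^* x|^2 + \<eta>^2 |x|^2 for G = Y Y^* + \<eta>^2. The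
  image G x has its own name \<open>a\<close>, so that the identity applies directly to solutions of
  linear systems. Positivity of the resolvent is derived from it.\<close>

lemma gram_energy:
  assumes "\<And>i. i < n \<Longrightarrow> (\<Sum>k<n. gram n \<eta> Y i k * x k) = a i"
  shows "(\<Sum>i<n. cnj (x i) * a i) =
    complex_of_real ((\<Sum>l<n. (cmod (\<Sum>k<n. cnj (Y k l) * x k))\<^sup>2) + \<eta>\<^sup>2 * (\<Sum>i<n. (cmod (x i))\<^sup>2))"
proof -
  let ?t = "\<lambda>l. \<Sum>k<n. cnj (Y k l) * x k"
  have "(\<Sum>i<n. cnj (x i) * a i) = (\<Sum>i<n. cnj (x i) * ((\<Sum>l<n. Y i l * ?t l) + complex_of_real (\<eta>\<^sup>2) * x i))"
    by (intro sum.cong refl) (simp add: assms[symmetric] gram_apply)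
  also have "\<dots> = (\<Sum>i<n. \<Sum>l<n. cnj (x i) * Y i l * ?t l) + complex_of_real (\<eta>\<^sup>2) * (\<Sum>i<n. x i * cnj (x i))"
    by (simp add: distrib_left sum.distrib sum_distrib_left mult_ac)
  also have "(\<Sum>i<n. \<Sum>l<n. cnj (x i) * Y i l * ?t l) = (\<Sum>l<n. ?t l * cnj (?t l))"
    by (subst sum.swap) (simp add: sum_distrib_left sum_distrib_right mult_ac)
  finally show ?thesis
    by (simp add: complex_norm_square[symmetric] del: of_real_power cnj_sum)
qed

section \<open>Existence of the resolvent and its trivial bounds\<close>

context
  fixes n :: nat and \<eta> :: real
  assumes eta: "\<eta> > 0"
begin

lemma det_gram_nonzero: "det (mat n n (\<lambda>(i, k). gram n \<eta> Y i k)) \<noteq> 0"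
proof
  let ?A = "mat n n (\<lambda>(i, k). gram n \<eta> Y i k)"
  assume "det ?A = 0"
  moreover have cA: "?A \<in> carrier_mat n n" by simp
  ultimately obtain v where v: "v \<in> carrier_vec n" "v \<noteq> 0\<^sub>v n" "?A *\<^sub>v v = 0\<^sub>v n"
    using det_0_iff_vec_prod_zero[OF cA] by auto
  let ?x = "\<lambda>i. v $ i"
  have "(\<Sum>k<n. gram n \<eta> Y i k * ?x k) = 0" if "i < n" for i
  proof -
    have "(?A *\<^sub>v v) $ i = 0" using v that by simp
    then show ?thesis using v(1) that by (simp add: scalar_prod_def lessThan_atLeast0)
  qed
  from gram_energy[of n \<eta> Y ?x "\<lambda>_. 0", OF this, symmetric]
  have "(\<Sum>l<n. (cmod (\<Sum>k<n. cnj (Y k l) * ?x k))\<^sup>2) + \<eta>\<^sup>2 * (\<Sum>i<n. (cmod (?x i))\<^sup>2) = 0"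
    by (simp only: mult_zero_right sum.neutral_const of_real_eq_0_iff)
  moreover have "0 \<le> (\<Sum>l<n. (cmod (\<Sum>k<n. cnj (Y k l) * ?x k))\<^sup>2)" by (simp add: sum_nonneg)
  moreover have "0 \<le> (\<Sum>i<n. (cmod (?x i))\<^sup>2)" by (simp add: sum_nonneg)
  ultimately have "(\<Sum>i<n. (cmod (?x i))\<^sup>2) = 0" using eta
    by (smt (verit) mult_pos_pos zero_less_power)
  then have "\<forall>i<n. v $ i = 0" by (subst (asm) sum_nonneg_eq_0_iff) auto
  then have "v = 0\<^sub>v n" using v(1) by auto
  with v(2) show False by simp
qed

lemma gram_res:
  assumes "i < n" "k < n"
  shows "(\<Sum>l<n. gram n \<eta> Y i l * res n \<eta> Y l k) = (if i = k then 1 else 0)"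
proof -
  let ?A = "mat n n (\<lambda>(i, k). gram n \<eta> Y i k)"
  have cA: "?A \<in> carrier_mat n n" by simp
  have "(?A * adj_mat ?A) $$ (i, k) = (det ?A \<cdot>\<^sub>m 1\<^sub>m n) $$ (i, k)" using adj_mat(2)[OF cA] by simp
  then have "(\<Sum>l<n. gram n \<eta> Y i l * adj_mat ?A $$ (l, k)) = (if i = k then det ?A else 0)"
    using assms adj_mat(1)[OF cA] by (simp add: scalar_prod_def lessThan_atLeast0)
  then show ?thesis using det_gram_nonzero[of Y]
    by (simp add: res_def sum_divide_distrib[symmetric])
qed

lemma res_gram:
  assumes "i < n" "k < n"
  shows "(\<Sum>l<n. res n \<eta> Y i l * gram n \<eta> Y l k) = (if i = k then 1 else 0)"
proof -
  let ?A = "mat n n (\<lambda>(i, k). gram n \<eta> Y i k)"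
  have cA: "?A \<in> carrier_mat n n" by simp
  have "(adj_mat ?A * ?A) $$ (i, k) = (det ?A \<cdot>\<^sub>m 1\<^sub>m n) $$ (i, k)" using adj_mat(3)[OF cA] by simp
  then have "(\<Sum>l<n. adj_mat ?A $$ (i, l) * gram n \<eta> Y l k) = (if i = k then det ?A else 0)"
    using assms adj_mat(1)[OF cA] by (simp add: scalar_prod_def lessThan_atLeast0)
  then show ?thesis using det_gram_nonzero[of Y]
    by (simp add: res_def sum_divide_distrib[symmetric])
qed

lemma res_solve:
  assumes "\<And>i. i < n \<Longrightarrow> (\<Sum>k<n. gram n \<eta> Y i k * x k) = a i" and "i < n"
  shows "x i = (\<Sum>k<n. res n \<eta> Y i k * a k)"
proof -
  have "(\<Sum>k<n. res n \<eta> Y i k * a k) = (\<Sum>k<n. \<Sum>l<n. res n \<eta> Y i k * gram n \<eta> Y k l * x l)"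
    by (intro sum.cong refl) (simp add: assms(1)[symmetric] sum_distrib_left mult.assoc)
  also have "\<dots> = (\<Sum>l<n. (\<Sum>k<n. res n \<eta> Y i k * gram n \<eta> Y k l) * x l)"
    by (subst sum.swap) (simp add: sum_distrib_right)
  also have "\<dots> = (\<Sum>l<n. if i = l then x l else 0)"
    using assms(2) by (intro sum.cong refl) (simp add: res_gram)
  finally show ?thesis using assms(2) by simp
qed

text \<open>Uniqueness for a right-hand side supported at \<open>j\<close>. The explicit resolvent
  formulas below are all obtained by writing down a candidate column and checking the system that it
  solves.\<close>

lemma res_solve_unit:
  assumes "\<And>i. i < n \<Longrightarrow> (\<Sum>k<n. gram n \<eta> Y i k * x k) = (if i = j then c else 0)" and "i < n" "j < n"
  shows "x i = c * res n \<eta> Y i j"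
proof -
  have "x i = (\<Sum>k<n. res n \<eta> Y i k * (if k = j then c else 0))"
    using res_solve[of Y x, OF assms(1,2)] by simp
  also have "\<dots> = (\<Sum>k<n. if k = j then c * res n \<eta> Y i k else 0)"
    by (intro sum.cong) auto
  finally show ?thesis using assms(3) by simp
qed

lemma gram_res_apply:
  assumes "i < n"
  shows "(\<Sum>l<n. gram n \<eta> Y i l * (\<Sum>k<n. res n \<eta> Y l k * a k)) = a i"
proof -
  have "(\<Sum>l<n. gram n \<eta> Y i l * (\<Sum>k<n. res n \<eta> Y l k * a k))
      = (\<Sum>k<n. (\<Sum>l<n. gram n \<eta> Y i l * res n \<eta> Y l k) * a k)"
    unfolding sum_distrib_left sum_distrib_right by (subst sum.swap) (simp add: mult.assoc)
  also have "\<dots> = (\<Sum>k<n. if i = k then a k else 0)"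
    using assms by (intro sum.cong refl) (simp add: gram_res)
  finally show ?thesis using assms by simp
qed

lemma res_cnj:
  assumes "i < n" "k < n"
  shows "cnj (res n \<eta> Y i k) = res n \<eta> Y k i"
proof -
  have "(\<Sum>l<n. gram n \<eta> Y m l * cnj (res n \<eta> Y i l)) = (if m = i then 1 else 0)" if "m < n" for m
  proof -
    have "(\<Sum>l<n. gram n \<eta> Y m l * cnj (res n \<eta> Y i l)) = cnj (\<Sum>l<n. res n \<eta> Y i l * gram n \<eta> Y l m)"
      by (simp add: gram_cnj mult.commute)
    then show ?thesis using res_gram[OF assms(1) that] by auto
  qed
  from res_solve_unit[of Y "\<lambda>l. cnj (res n \<eta> Y i l)" i 1, OF this assms(2,1)] show ?thesis by simp
qed

lemma res_diag:
  assumes "i < n"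
  shows "res n \<eta> Y i i = complex_of_real (resd n \<eta> Y i)"
  using res_cnj[OF assms assms, of Y] by (simp add: complex_eq_iff resd_def)

text \<open>With g = R a one has a = G g, so the form of R at \<open>a\<close> is the energy of g,
  which is real; dropping the term |Y^* g|^2 leaves \<eta>^2 |g|^2.\<close>

lemma sesq_res:
  "sesq n (res n \<eta> Y) a = complex_of_real (Re (sesq n (res n \<eta> Y) a))"
  "\<eta>\<^sup>2 * (\<Sum>i<n. (cmod (\<Sum>k<n. res n \<eta> Y i k * a k))\<^sup>2) \<le> Re (sesq n (res n \<eta> Y) a)"
proof -
  let ?g = "\<lambda>i. \<Sum>k<n. res n \<eta> Y i k * a k"
  have "sesq n (res n \<eta> Y) a = (\<Sum>i<n. cnj (a i) * ?g i)"
    by (simp add: sesq_def sum_distrib_left mult.assoc)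
  also have "\<dots> = cnj (\<Sum>i<n. cnj (?g i) * a i)" by (simp add: mult.commute)
  also have "(\<Sum>i<n. cnj (?g i) * a i) = complex_of_real ((\<Sum>l<n. (cmod (\<Sum>k<n. cnj (Y k l) * ?g k))\<^sup>2)
       + \<eta>\<^sup>2 * (\<Sum>i<n. (cmod (?g i))\<^sup>2))"
    by (rule gram_energy) (simp add: gram_res_apply)
  finally have *: "sesq n (res n \<eta> Y) a = complex_of_real ((\<Sum>l<n. (cmod (\<Sum>k<n. cnj (Y k l) * ?g k))\<^sup>2)
       + \<eta>\<^sup>2 * (\<Sum>i<n. (cmod (?g i))\<^sup>2))" by simp
  then show "sesq n (res n \<eta> Y) a = complex_of_real (Re (sesq n (res n \<eta> Y) a))" by simp
  show "\<eta>\<^sup>2 * (\<Sum>i<n. (cmod (?g i))\<^sup>2) \<le> Re (sesq n (res n \<eta> Y) a)"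
    unfolding * by (simp add: sum_nonneg)
qed

lemma sesq_res_nonneg: "0 \<le> Re (sesq n (res n \<eta> Y) a)"
  by (rule order_trans[OF _ sesq_res(2)]) (simp add: sum_nonneg)

text \<open>The case a = e_j of the preceding inequality, a one-sided Ward identity. It yields the
  trivial bounds 1 / \<eta>^2 below and later pays for the removal of a row.\<close>

lemma resd_ge:
  assumes "j < n"
  shows "\<eta>\<^sup>2 * (\<Sum>i<n. (cmod (res n \<eta> Y i j))\<^sup>2) \<le> resd n \<eta> Y j"
proof -
  let ?a = "\<lambda>k. if k = j then 1 else 0 :: complex"
  have g: "(\<Sum>k<n. res n \<eta> Y i k * ?a k) = res n \<eta> Y i j" for i
  proof -
    have "(\<Sum>k<n. res n \<eta> Y i k * ?a k) = (\<Sum>k<n. if k = j then res n \<eta> Y i k else 0)"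
      by (intro sum.cong) auto
    then show ?thesis using assms by simp
  qed
  have "sesq n (res n \<eta> Y) ?a = (\<Sum>i<n. cnj (?a i) * (\<Sum>k<n. res n \<eta> Y i k * ?a k))"
    by (simp only: sesq_def sum_distrib_left mult.assoc)
  also have "\<dots> = (\<Sum>i<n. if i = j then res n \<eta> Y i j else 0)"
    unfolding g by (intro sum.cong) auto
  finally have "Re (sesq n (res n \<eta> Y) ?a) = resd n \<eta> Y j" using assms by (simp add: resd_def)
  then show ?thesis using sesq_res(2)[of Y ?a] unfolding g by simp
qed

lemma resd_pos:
  assumes "j < n"
  shows "0 < resd n \<eta> Y j"
proof (rule ccontr)
  assume "\<not> 0 < resd n \<eta> Y j"
  moreover have "0 \<le> (\<Sum>i<n. (cmod (res n \<eta> Y i j))\<^sup>2)" by (simp add: sum_nonneg)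
  ultimately have "(\<Sum>i<n. (cmod (res n \<eta> Y i j))\<^sup>2) = 0"
    using resd_ge[OF assms, of Y] eta by (smt (verit) mult_pos_pos zero_less_power)
  then have z: "\<forall>i<n. res n \<eta> Y i j = 0" by (subst (asm) sum_nonneg_eq_0_iff) auto
  have "(\<Sum>l<n. gram n \<eta> Y j l * res n \<eta> Y l j) = 0" using z by (intro sum.neutral) auto
  then show False using gram_res[OF assms assms, of Y] by simp
qed

lemma resd_le:
  assumes "j < n"
  shows "resd n \<eta> Y j \<le> 1 / \<eta>\<^sup>2"
proof -
  have "(resd n \<eta> Y j)\<^sup>2 = (cmod (res n \<eta> Y j j))\<^sup>2" by (simp add: res_diag[OF assms])
  also have "\<dots> \<le> (\<Sum>i<n. (cmod (res n \<eta> Y i j))\<^sup>2)" using assms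
    by (intro member_le_sum) auto
  finally have "\<eta>\<^sup>2 * (resd n \<eta> Y j)\<^sup>2 \<le> resd n \<eta> Y j"
    using resd_ge[OF assms, of Y] eta by (smt (verit) mult_left_mono zero_le_power2)
  then have "\<eta>\<^sup>2 * resd n \<eta> Y j \<le> 1" using resd_pos[OF assms, of Y]
    by (simp add: power2_eq_square[of "resd n \<eta> Y j"])
  then show ?thesis using eta by (simp add: field_simps)
qed

lemma res_col_norm:
  assumes "j < n"
  shows "(\<Sum>i<n. (cmod (res n \<eta> Y i j))\<^sup>2) \<le> (1 / \<eta>\<^sup>2)\<^sup>2"
proof -
  have "\<eta>\<^sup>2 * (\<Sum>i<n. (cmod (res n \<eta> Y i j))\<^sup>2) \<le> 1 / \<eta>\<^sup>2"
    using resd_ge[OF assms, of Y] resd_le[OF assms, of Y] by linarith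
  then show ?thesis using eta by (simp add: field_simps power2_eq_square)
qed

lemma res_row_norm:
  assumes "j < n"
  shows "(\<Sum>i<n. (cmod (res n \<eta> Y j i))\<^sup>2) \<le> (1 / \<eta>\<^sup>2)\<^sup>2"
proof -
  have "cmod (res n \<eta> Y j i) = cmod (res n \<eta> Y i j)" if "i < n" for i
    using res_cnj[OF that assms, of Y] by (metis complex_mod_cnj)
  then show ?thesis using res_col_norm[OF assms, of Y] by simp
qed

text \<open>Cauchy-Schwarz in the inner product of G = Y^* Y + \<eta>^2: the coordinate x_j is the
  G-product of x with R e_j, and the squared G-norm of R e_j is R_jj. The proof removes from x its
  component along R e_j and uses that the remainder has nonnegative energy.\<close>

lemma coord_le_resd:
  assumes "j < n"
  shows "(cmod (x j))\<^sup>2 \<le> resd n \<eta> (adj Y) j *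
    ((\<Sum>l<n. (cmod (\<Sum>k<n. Y l k * x k))\<^sup>2) + \<eta>\<^sup>2 * (\<Sum>i<n. (cmod (x i))\<^sup>2))"
proof -
  let ?Z = "adj Y"
  define d where "d = resd n \<eta> ?Z j"
  have d: "d > 0" using resd_pos[OF assms] by (simp add: d_def)
  \<comment> \<open>This choice makes the remainder \<open>w\<close> vanish at \<open>j\<close>,
    which is exactly G-orthogonality to R e_j.\<close>
  define t where "t = x j / complex_of_real d"
  define w where "w = (\<lambda>i. x i - t * res n \<eta> ?Z i j)"
  define a where "a = (\<lambda>i. \<Sum>k<n. gram n \<eta> ?Z i k * x k)"
  let ?Q = "\<lambda>x. (\<Sum>l<n. (cmod (\<Sum>k<n. Y l k * x k))\<^sup>2) + \<eta>\<^sup>2 * (\<Sum>i<n. (cmod (x i))\<^sup>2)"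
  have Qx: "(\<Sum>i<n. cnj (x i) * a i) = complex_of_real (?Q x)"
    using gram_energy[of n \<eta> ?Z x a] by (simp add: a_def adj_def)
  have gw: "(\<Sum>k<n. gram n \<eta> ?Z i k * w k) = a i - t * (if i = j then 1 else 0)" if "i < n" for i
  proof -
    have "(\<Sum>k<n. gram n \<eta> ?Z i k * w k) = a i - t * (\<Sum>k<n. gram n \<eta> ?Z i k * res n \<eta> ?Z k j)"
      by (simp add: w_def a_def right_diff_distrib sum_subtractf sum_distrib_left mult_ac)
    then show ?thesis using gram_res[OF that assms] by simp
  qed
  have Qw: "(\<Sum>i<n. cnj (w i) * (a i - t * (if i = j then 1 else 0))) = complex_of_real (?Q w)"
    using gram_energy[of n \<eta> ?Z w, OF gw] by (simp add: adj_def)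
  have "(\<Sum>i<n. cnj (w i) * (a i - t * (if i = j then 1 else 0)))
      = (\<Sum>i<n. cnj (w i) * a i) - (\<Sum>i<n. if i = j then t * cnj (w i) else 0)"
    unfolding sum_subtractf[symmetric] by (intro sum.cong) (auto simp: algebra_simps)
  also have "(\<Sum>i<n. if i = j then t * cnj (w i) else 0) = t * cnj (w j)" using assms by simp
  also have "w j = 0" using d by (simp add: w_def t_def res_diag[OF assms] d_def[symmetric])
  also have "(\<Sum>i<n. cnj (w i) * a i) = (\<Sum>i<n. cnj (x i) * a i) - cnj t * (\<Sum>i<n. res n \<eta> ?Z j i * a i)"
    unfolding sum_distrib_left sum_subtractf[symmetric]
    by (intro sum.cong) (auto simp: w_def algebra_simps res_cnj assms)
  also have "(\<Sum>i<n. res n \<eta> ?Z j i * a i) = x j"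
    by (rule res_solve[of ?Z x a j, symmetric]) (auto simp: a_def assms)
  finally have "complex_of_real (?Q w) = complex_of_real (?Q x) - cnj t * x j"
    using Qw Qx by simp
  also have "cnj t * x j = complex_of_real ((cmod (x j))\<^sup>2 / d)"
    by (simp add: t_def complex_norm_square mult.commute del: of_real_power)
  finally have "?Q w = ?Q x - (cmod (x j))\<^sup>2 / d"
    by (simp only: of_real_diff[symmetric] of_real_eq_iff)
  moreover have "0 \<le> ?Q w" by (simp add: sum_nonneg)
  ultimately have "(cmod (x j))\<^sup>2 / d \<le> ?Q x" by linarith
  then show ?thesis using d by (simp add: d_def[symmetric] field_simps)
qed

section \<open>Removing a column or a row\<close>

lemma gram_zero_col:
  assumes "j < n"
  shows "gram n \<eta> Y i k = gram n \<eta> (zero_col j Y) i k + Y i j * cnj (Y k j)"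
proof -
  have "(\<Sum>l<n. Y i l * cnj (Y k l)) = (\<Sum>l<n. (if l = j then 0 else Y i l) * cnj (if l = j then 0 else Y k l)) + Y i j * cnj (Y k j)"
    using assms by (subst (1 2) sum.remove[of _ j]) (auto intro!: sum.cong)
  then show ?thesis by (simp add: gram_def zero_col_def)
qed

text \<open>The Sherman-Morrison formula on the diagonal: zeroing the column a of Y subtracts the
  rank-one matrix a a^* from the Gram matrix.\<close>

lemma res_zero_col:
  fixes Y :: "nat \<Rightarrow> nat \<Rightarrow> complex"
  assumes "j < n" "i < n"
  defines "g \<equiv> \<Sum>k<n. res n \<eta> (zero_col j Y) i k * Y k j"
    and "s \<equiv> Re (sesq n (res n \<eta> (zero_col j Y)) (\<lambda>k. Y k j))"
  shows "resd n \<eta> Y i = resd n \<eta> (zero_col j Y) i - (cmod g)\<^sup>2 / (1 + s)"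
proof -
  let ?Z = "zero_col j Y" and ?a = "\<lambda>k. Y k j"
  define G where "G = (\<lambda>l. \<Sum>k<n. res n \<eta> ?Z l k * ?a k)"
  have s0: "s \<ge> 0" unfolding s_def by (rule sesq_res_nonneg)
  have sG: "(\<Sum>k<n. cnj (?a k) * G k) = complex_of_real s"
    unfolding s_def sesq_res(1)[symmetric] by (simp add: sesq_def G_def sum_distrib_left mult.assoc)
  have aR: "(\<Sum>k<n. cnj (?a k) * res n \<eta> ?Z k i) = cnj g"
    unfolding g_def cnj_sum using assms(2)
    by (intro sum.cong refl) (simp add: res_cnj mult.commute del: complex_cnj_cnj)
  \<comment> \<open>The self-consistent value of the product of a^* with the candidate column
    \<open>x\<close>, as \<open>ax\<close> verifies.\<close>
  define t where "t = cnj g / complex_of_real (1 + s)"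
  define x where "x = (\<lambda>l. res n \<eta> ?Z l i - t * G l)"
  have ax: "(\<Sum>k<n. cnj (?a k) * x k) = t"
  proof -
    have "(\<Sum>k<n. cnj (?a k) * x k) = (\<Sum>k<n. cnj (?a k) * res n \<eta> ?Z k i) - t * (\<Sum>k<n. cnj (?a k) * G k)"
      by (simp add: x_def right_diff_distrib sum_subtractf sum_distrib_left mult_ac)
    also have "\<dots> = cnj g - t * s" unfolding sG aR ..
    also have "\<dots> = t"
    proof -
      have "cnj g = t * complex_of_real (1 + s)" unfolding t_def using s0
        by (simp del: of_real_add)
      then show ?thesis by (simp add: algebra_simps)
    qed
    finally show ?thesis .
  qed
  have "(\<Sum>l<n. gram n \<eta> Y m l * x l) = (if m = i then 1 else 0)" if "m < n" for m
  proof -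
    have "(\<Sum>l<n. gram n \<eta> Y m l * x l) = (\<Sum>l<n. gram n \<eta> ?Z m l * x l) + ?a m * (\<Sum>l<n. cnj (?a l) * x l)"
      by (simp add: gram_zero_col[OF assms(1), of Y] distrib_right sum.distrib sum_distrib_left mult.assoc)
    also have "(\<Sum>l<n. gram n \<eta> ?Z m l * x l) = (\<Sum>l<n. gram n \<eta> ?Z m l * res n \<eta> ?Z l i) - t * (\<Sum>l<n. gram n \<eta> ?Z m l * G l)"
      by (simp add: x_def right_diff_distrib sum_subtractf sum_distrib_left mult_ac)
    also have "\<dots> = (if m = i then 1 else 0) - t * ?a m"
      using that assms(2) by (simp add: G_def gram_res_apply gram_res)
    finally show ?thesis by (simp add: ax)
  qed
  from res_solve_unit[of Y x i 1, OF this assms(2,2)] have "res n \<eta> Y i i = x i" by simp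
  also have "x i = res n \<eta> ?Z i i - complex_of_real ((cmod g)\<^sup>2 / (1 + s))"
    by (simp add: x_def t_def G_def g_def complex_norm_square mult.commute del: of_real_power)
  finally show ?thesis by (simp add: resd_def)
qed

lemma resd_zero_col_ge:
  assumes "j < n" "i < n"
  shows "resd n \<eta> Y i \<le> resd n \<eta> (zero_col j Y) i"
  using res_zero_col[OF assms, of Y] sesq_res_nonneg[of "zero_col j Y" "\<lambda>k. Y k j"] by simp

text \<open>The diagonal grows in total by |R a|^2 / (1 + s), which \<open>sesq_res\<close> bounds
  by 1 / \<eta>^2 whatever the size of the removed column. The absolute value appears because an
  empty \<open>A\<close> says nothing about the sign of \<beta>.\<close>

lemma resd_zero_col_sum:
  assumes "j < n" "A \<subseteq> {..<n}" and w: "\<And>i. i \<in> A \<Longrightarrow> 0 \<le> w i \<and> w i \<le> \<beta>"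
  shows "(\<Sum>i\<in>A. w i * resd n \<eta> (zero_col j Y) i) \<le> (\<Sum>i\<in>A. w i * resd n \<eta> Y i) + \<bar>\<beta>\<bar> / \<eta>\<^sup>2"
proof -
  define s where "s = Re (sesq n (res n \<eta> (zero_col j Y)) (\<lambda>k. Y k j))"
  let ?g = "\<lambda>i. \<Sum>k<n. res n \<eta> (zero_col j Y) i k * Y k j"
  have s0: "s \<ge> 0" unfolding s_def by (rule sesq_res_nonneg)
  have 1: "(\<Sum>i\<in>A. w i * resd n \<eta> (zero_col j Y) i) = (\<Sum>i\<in>A. w i * resd n \<eta> Y i) + (\<Sum>i\<in>A. w i * ((cmod (?g i))\<^sup>2 / (1 + s)))"
    unfolding sum.distrib[symmetric] using assms
    by (intro sum.cong refl) (subst (2) res_zero_col[of j], auto simp: s_def algebra_simps)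
  have "(\<Sum>i\<in>A. w i * ((cmod (?g i))\<^sup>2 / (1 + s))) \<le> (\<Sum>i\<in>A. \<bar>\<beta>\<bar> * ((cmod (?g i))\<^sup>2 / (1 + s)))"
    using w s0 by (intro sum_mono mult_right_mono order_trans[OF _ abs_ge_self]) auto
  also have "\<dots> \<le> (\<Sum>i<n. \<bar>\<beta>\<bar> * ((cmod (?g i))\<^sup>2 / (1 + s)))"
    using assms s0 by (intro sum_mono2) auto
  also have "\<dots> = \<bar>\<beta>\<bar> * ((\<Sum>i<n. (cmod (?g i))\<^sup>2) / (1 + s))"
    by (simp add: sum_distrib_left sum_divide_distrib)
  also have "\<dots> \<le> \<bar>\<beta>\<bar> * (1 / \<eta>\<^sup>2)"
  proof (intro mult_left_mono)
    have "\<eta>\<^sup>2 * (\<Sum>i<n. (cmod (?g i))\<^sup>2) \<le> 1 + s" using sesq_res(2)[of "zero_col j Y" "\<lambda>k. Y k j"]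
      by (simp add: s_def)
    then show "(\<Sum>i<n. (cmod (?g i))\<^sup>2) / (1 + s) \<le> 1 / \<eta>\<^sup>2" using s0 eta by (simp add: field_simps)
  qed simp
  finally show ?thesis using 1 by simp
qed

text \<open>Zeroing row \<open>j\<close> decouples coordinate \<open>j\<close> in the Gram matrix,
  so this is the formula for the inverse of a principal submatrix. At \<open>j\<close> itself the
  decoupled resolvent equals 1 / \<eta>^2, hence the exclusion.\<close>

lemma resd_zero_row:
  assumes "j < n" "i < n" "i \<noteq> j"
  shows "resd n \<eta> (zero_row j Y) i = resd n \<eta> Y i - (cmod (res n \<eta> Y i j))\<^sup>2 / resd n \<eta> Y j"
proof -
  let ?Z = "zero_row j Y"
  have d: "resd n \<eta> Y j > 0" by (rule resd_pos[OF assms(1)])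
  define c where "c = res n \<eta> Y j i / res n \<eta> Y j j"
  define x where "x = (\<lambda>k. res n \<eta> Y k i - c * res n \<eta> Y k j)"
  have xj: "x j = 0" using d by (simp add: x_def c_def res_diag[OF assms(1)])
  have gx: "(\<Sum>k<n. gram n \<eta> Y m k * x k) = (if m = i then 1 else 0) - c * (if m = j then 1 else 0)" if "m < n" for m
    using gram_res[OF that assms(1), of Y] gram_res[OF that assms(2), of Y]
    by (simp add: x_def right_diff_distrib sum_subtractf sum_distrib_left[symmetric] mult.left_commute)
  have "(\<Sum>k<n. gram n \<eta> ?Z m k * x k) = (if m = i then 1 else 0)" if "m < n" for m
  proof (cases "m = j")
    case True
    have "(\<Sum>k<n. gram n \<eta> ?Z m k * x k) = (\<Sum>k<n. 0)"
      using True xj by (intro sum.cong) (auto simp: gram_def zero_row_def)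
    then show ?thesis using True assms by simp
  next
    case False
    have "gram n \<eta> ?Z m k * x k = gram n \<eta> Y m k * x k" for k
      using False xj by (cases "k = j") (auto simp: gram_def zero_row_def)
    then have "(\<Sum>k<n. gram n \<eta> ?Z m k * x k) = (\<Sum>k<n. gram n \<eta> Y m k * x k)"
      by (intro sum.cong refl)
    then show ?thesis using gx[OF that] False by simp
  qed
  from res_solve_unit[of ?Z x i 1, OF this assms(2,2)] have "res n \<eta> ?Z i i = x i" by simp
  also have "x i = res n \<eta> Y i i - complex_of_real ((cmod (res n \<eta> Y i j))\<^sup>2 / resd n \<eta> Y j)"
    using res_cnj[OF assms(2,1), of Y]
    by (simp add: x_def c_def complex_norm_square res_diag[OF assms(1)] mult.commute del: of_real_power)
  finally show ?thesis by (simp add: resd_def)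
qed

lemma resd_zero_row_le:
  assumes "j < n" "i < n" "i \<noteq> j"
  shows "resd n \<eta> (zero_row j Y) i \<le> resd n \<eta> Y i"
  using resd_zero_row[OF assms, of Y] resd_pos[OF assms(1), of Y] by simp

text \<open>The total loss is at most the squared norm of column \<open>j\<close> of the resolvent
  divided by its diagonal entry, and \<open>resd_ge\<close> bounds that quotient by 1 /
  \<eta>^2.\<close>

lemma resd_zero_row_sum:
  assumes "j < n" "A \<subseteq> {..<n} - {j}" and w: "\<And>i. i \<in> A \<Longrightarrow> 0 \<le> w i \<and> w i \<le> \<beta>"
  shows "(\<Sum>i\<in>A. w i * resd n \<eta> Y i) \<le> (\<Sum>i\<in>A. w i * resd n \<eta> (zero_row j Y) i) + \<bar>\<beta>\<bar> / \<eta>\<^sup>2"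
proof -
  have d: "resd n \<eta> Y j > 0" by (rule resd_pos[OF assms(1)])
  have 1: "(\<Sum>i\<in>A. w i * resd n \<eta> Y i) = (\<Sum>i\<in>A. w i * resd n \<eta> (zero_row j Y) i)
      + (\<Sum>i\<in>A. w i * ((cmod (res n \<eta> Y i j))\<^sup>2 / resd n \<eta> Y j))"
    unfolding sum.distrib[symmetric]
  proof (intro sum.cong refl)
    fix i assume "i \<in> A"
    then have "i < n" "i \<noteq> j" using assms by auto
    then show "w i * resd n \<eta> Y i = w i * resd n \<eta> (zero_row j Y) i + w i * ((cmod (res n \<eta> Y i j))\<^sup>2 / resd n \<eta> Y j)"
      unfolding distrib_left[symmetric] using resd_zero_row[OF assms(1), of i Y] by simp
  qed
  have "(\<Sum>i\<in>A. w i * ((cmod (res n \<eta> Y i j))\<^sup>2 / resd n \<eta> Y j)) \<le>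
      (\<Sum>i\<in>A. \<bar>\<beta>\<bar> * ((cmod (res n \<eta> Y i j))\<^sup>2 / resd n \<eta> Y j))"
    using w d by (intro sum_mono mult_right_mono order_trans[OF _ abs_ge_self]) auto
  also have "\<dots> \<le> (\<Sum>i<n. \<bar>\<beta>\<bar> * ((cmod (res n \<eta> Y i j))\<^sup>2 / resd n \<eta> Y j))"
    using assms d by (intro sum_mono2) auto
  also have "\<dots> = \<bar>\<beta>\<bar> * ((\<Sum>i<n. (cmod (res n \<eta> Y i j))\<^sup>2) / resd n \<eta> Y j)"
    by (simp add: sum_distrib_left sum_divide_distrib)
  also have "\<dots> \<le> \<bar>\<beta>\<bar> * (1 / \<eta>\<^sup>2)"
  proof (intro mult_left_mono)
    show "(\<Sum>i<n. (cmod (res n \<eta> Y i j))\<^sup>2) / resd n \<eta> Y j \<le> 1 / \<eta>\<^sup>2"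
      using resd_ge[OF assms(1), of Y] d eta by (simp add: field_simps)
  qed simp
  finally show ?thesis using 1 by simp
qed

text \<open>The Schur complement of the entry (j, j) in Y^* Y + \<eta>^2, with the push-through
  identity applied so that the form involves the resolvent of Z Z^* instead of Z^* Z. This change of
  side is what couples U with V.\<close>

lemma resd_schur:
  assumes "j < n"
  shows "resd n \<eta> (adj Y) j * (\<eta>\<^sup>2 * (1 + Re (sesq n (res n \<eta> (zero_col j Y)) (\<lambda>k. Y k j)))) = 1"
proof -
  let ?Z = "zero_col j Y" and ?a = "\<lambda>k. Y k j" and ?h = "complex_of_real (\<eta>\<^sup>2)"
  define g where "g = (\<lambda>l. \<Sum>k<n. res n \<eta> ?Z l k * ?a k)"
  define s where "s = Re (sesq n (res n \<eta> ?Z) ?a)"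
  have sg: "(\<Sum>k<n. cnj (?a k) * g k) = complex_of_real s"
    unfolding s_def sesq_res(1)[symmetric] by (simp add: sesq_def g_def sum_distrib_left mult.assoc)
  \<comment> \<open>Column \<open>j\<close> of the resolvent up to a factor: the vector e_j - Z^* g,
    for which Y w = a - Z Z^* g = \<eta>^2 g.\<close>
  define w where "w = (\<lambda>k. if k = j then 1 else - (\<Sum>i<n. cnj (Y i k) * g i))"
  have Yw: "(\<Sum>k<n. Y l k * w k) = ?h * g l" if "l < n" for l
  proof -
    have "a l = (\<Sum>m<n. ?Z l m * (\<Sum>k<n. cnj (?Z k m) * g k)) + ?h * g l" if "a = ?a" for a
      using gram_res_apply[OF \<open>l < n\<close>, of ?Z ?a] gram_apply[OF \<open>l < n\<close>, of \<eta> ?Z g] that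
      by (simp add: g_def)
    then have "?h * g l = Y l j - (\<Sum>m<n. ?Z l m * (\<Sum>k<n. cnj (?Z k m) * g k))" by simp
    also have "(\<Sum>m<n. ?Z l m * (\<Sum>k<n. cnj (?Z k m) * g k)) = (\<Sum>m\<in>{..<n} - {j}. Y l m * (\<Sum>k<n. cnj (Y k m) * g k))"
      using assms by (subst sum.remove[of _ j]) (auto simp: zero_col_def intro!: sum.cong)
    also have "Y l j - \<dots> = Y l j * w j + (\<Sum>k\<in>{..<n} - {j}. Y l k * w k)"
      by (simp add: w_def sum_negf)
    also have "\<dots> = (\<Sum>k<n. Y l k * w k)"
      using assms by (subst (2) sum.remove[of _ j]) auto
    finally show ?thesis by simp
  qed
  have "(\<Sum>k<n. gram n \<eta> (adj Y) i k * w k) = (if i = j then ?h * (1 + s) else 0)" if "i < n" for i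
  proof -
    have "(\<Sum>k<n. gram n \<eta> (adj Y) i k * w k) = (\<Sum>l<n. cnj (Y l i) * (\<Sum>k<n. Y l k * w k)) + ?h * w i"
      using gram_apply[OF that, of \<eta> "adj Y" w] by (simp add: adj_def)
    also have "(\<Sum>l<n. cnj (Y l i) * (\<Sum>k<n. Y l k * w k)) = (\<Sum>l<n. ?h * (cnj (Y l i) * g l))"
      by (intro sum.cong refl) (simp add: Yw del: of_real_power)
    also have "(\<Sum>l<n. ?h * (cnj (Y l i) * g l)) + ?h * w i = ?h * ((\<Sum>l<n. cnj (Y l i) * g l) + w i)"
      by (simp only: distrib_left sum_distrib_left)
    also have "\<dots> = (if i = j then ?h * (1 + s) else 0)"
      using sg by (auto simp: w_def)
    finally show ?thesis .
  qed
  from res_solve_unit[of "adj Y" w j "?h * (1 + s)", OF this assms assms]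
  have "1 = ?h * (1 + s) * res n \<eta> (adj Y) j j" by (simp add: w_def)
  also have "\<dots> = complex_of_real (\<eta>\<^sup>2 * (1 + s) * resd n \<eta> (adj Y) j)"
    by (simp add: res_diag[OF assms])
  finally have "\<eta>\<^sup>2 * (1 + s) * resd n \<eta> (adj Y) j = 1"
    by (metis of_real_eq_1_iff)
  then show ?thesis by (simp add: s_def mult_ac)
qed

end

section \<open>The perturbed Dyson equation\<close>

definition sub_scalar :: "complex \<Rightarrow> (nat \<Rightarrow> nat \<Rightarrow> complex) \<Rightarrow> nat \<Rightarrow> nat \<Rightarrow> complex" where
  "sub_scalar z X = (\<lambda>i k. X i k - (if i = k then z else 0))"

definition col_minor :: "complex \<Rightarrow> nat \<Rightarrow> (nat \<Rightarrow> nat \<Rightarrow> complex) \<Rightarrow> nat \<Rightarrow> nat \<Rightarrow> complex" where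
  "col_minor z j X = zero_col j (sub_scalar z X)"

text \<open>The adjoint is taken because row \<open>j\<close> enters the second Schur complement as
  a column of the adjoint.\<close>

definition row_col_minor :: "complex \<Rightarrow> nat \<Rightarrow> (nat \<Rightarrow> nat \<Rightarrow> complex) \<Rightarrow> nat \<Rightarrow> nat \<Rightarrow> complex" where
  "row_col_minor z j X = adj (zero_row j (zero_col j (sub_scalar z X)))"

text \<open>The deviations of the two quadratic forms from two successive Schur complements, and the
  cross term that the shift z e_j of column \<open>j\<close> adds to the first.
  \<open>col_minor\<close> does not see column \<open>j\<close> of X, and
  \<open>row_col_minor\<close> sees neither row \<open>j\<close> nor column \<open>j\<close>, so
  each form has coefficients independent of its argument. The cross term enters as twice a real
  part, so the error in the first form is 1/8 + 2/16 = 1/4.\<close>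

definition good :: "nat \<Rightarrow> real \<Rightarrow> (nat \<Rightarrow> nat \<Rightarrow> real) \<Rightarrow> (nat \<Rightarrow> nat \<Rightarrow> complex) \<Rightarrow> complex \<Rightarrow> nat \<Rightarrow> bool" where
  "good n \<eta> b X z j \<longleftrightarrow>
     cmod (sesq n (res n \<eta> (col_minor z j X)) (\<lambda>i. X i j)
       - (\<Sum>i<n. complex_of_real ((b i j)\<^sup>2) * res n \<eta> (col_minor z j X) i i)) \<le> 1 / 8 \<and>
     cmod z * cmod (\<Sum>k<n. res n \<eta> (col_minor z j X) j k * X k j) \<le> 1 / 16 \<and>
     cmod (sesq n (res n \<eta> (row_col_minor z j X)) (\<lambda>k. if k = j then 0 else cnj (X j k))
       - (\<Sum>k<n. complex_of_real ((if k = j then 0 else b j k)\<^sup>2) * res n \<eta> (row_col_minor z j X) k k)) \<le> 1 / 8"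

lemma adj_sub_scalar: "adj (sub_scalar z X) = sub_scalar (cnj z) (adj X)"
  by (auto simp: adj_def sub_scalar_def intro!: ext)

lemma zero_row_zero_col: "zero_row j (zero_col j Y) = zero_col j (zero_row j Y)"
  by (auto simp: zero_row_def zero_col_def intro!: ext)

lemma Re_approx:
  assumes "cmod (a - complex_of_real r) \<le> e"
  shows "Re a \<le> r + e" "r - e \<le> Re a"
  using abs_Re_le_cmod[of "a - complex_of_real r"] assms by auto

context
  fixes n :: nat and \<eta> :: real
  assumes eta: "\<eta> > 0"
begin

text \<open>Expansion of the form at X_j - z e_j, where X_j is column \<open>j\<close> of X. The
  last term is not small and not an average: it is a single diagonal entry of the minor.\<close>

lemma sesq_sub_scalar:
  assumes "j < n"
  shows "sesq n (res n \<eta> Z) (\<lambda>k. sub_scalar z X k j) = sesq n (res n \<eta> Z) (\<lambda>k. X k j)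
     - complex_of_real (2 * Re (cnj z * (\<Sum>k<n. res n \<eta> Z j k * X k j)))
     + complex_of_real ((cmod z)\<^sup>2 * resd n \<eta> Z j)"
proof -
  let ?R = "res n \<eta> Z" and ?x = "\<lambda>k. X k j"
  define r where "r = (\<Sum>k<n. ?R j k * ?x k)"
  have Ry: "(\<Sum>k<n. ?R i k * sub_scalar z X k j) = (\<Sum>k<n. ?R i k * ?x k) - z * ?R i j" for i
  proof -
    have "(\<Sum>k<n. ?R i k * sub_scalar z X k j) = (\<Sum>k<n. ?R i k * ?x k) - (\<Sum>k<n. if k = j then z * ?R i k else 0)"
      unfolding sum_subtractf[symmetric] by (intro sum.cong refl) (auto simp: sub_scalar_def algebra_simps)
    then show ?thesis using assms by simp
  qed
  have split: "(\<Sum>i<n. cnj (sub_scalar z X i j) * f i) = (\<Sum>i<n. cnj (?x i) * f i) - cnj z * f j" for f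
  proof -
    have "(\<Sum>i<n. cnj (sub_scalar z X i j) * f i) = (\<Sum>i<n. cnj (?x i) * f i) - (\<Sum>i<n. if i = j then cnj z * f i else 0)"
      unfolding sum_subtractf[symmetric] by (intro sum.cong refl) (auto simp: sub_scalar_def algebra_simps)
    then show ?thesis using assms by simp
  qed
  have rc: "(\<Sum>i<n. cnj (?x i) * ?R i j) = cnj r"
    unfolding r_def cnj_sum by (intro sum.cong refl) (simp add: res_cnj[OF eta] assms mult.commute)
  have "sesq n ?R (\<lambda>k. sub_scalar z X k j) = (\<Sum>i<n. cnj (sub_scalar z X i j) * (\<Sum>k<n. ?R i k * sub_scalar z X k j))"
    by (simp only: sesq_def sum_distrib_left mult.assoc)
  also have "\<dots> = (\<Sum>i<n. cnj (?x i) * ((\<Sum>k<n. ?R i k * ?x k) - z * ?R i j)) - cnj z * (r - z * ?R j j)"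
    unfolding split Ry r_def ..
  also have "(\<Sum>i<n. cnj (?x i) * ((\<Sum>k<n. ?R i k * ?x k) - z * ?R i j)) = sesq n ?R ?x - z * cnj r"
    unfolding rc[symmetric] sesq_def sum_distrib_left right_diff_distrib sum_subtractf
    by (simp add: mult_ac)
  also have "sesq n ?R ?x - z * cnj r - cnj z * (r - z * ?R j j)
      = sesq n ?R ?x - (cnj z * r + cnj (cnj z * r)) + (z * cnj z) * ?R j j"
    by (simp add: algebra_simps)
  also have "cnj z * r + cnj (cnj z * r) = complex_of_real (2 * Re (cnj z * r))"
    by (rule complex_add_cnj)
  also have "z * cnj z = complex_of_real ((cmod z)\<^sup>2)" by (simp add: complex_norm_square del: of_real_power)
  finally show ?thesis by (simp add: r_def res_diag[OF eta assms])
qed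

text \<open>Removing column \<open>j\<close> leaves the term |z|^2 R_jj, in which R_jj still depends
  on row \<open>j\<close>. A second Schur complement, removing that row, turns R_jj into 1 /
  (\<eta>^2 (1 + t)) with t again close to a weighted average.\<close>

lemma good_schur:
  fixes X :: "nat \<Rightarrow> nat \<Rightarrow> complex"
  assumes j: "j < n" and g: "good n \<eta> b X z j"
  defines "Z \<equiv> col_minor z j X" and "W \<equiv> row_col_minor z j X"
  defines "p \<equiv> (\<Sum>i<n. (b i j)\<^sup>2 * resd n \<eta> Z i)"
    and "q \<equiv> (\<Sum>k\<in>{..<n} - {j}. (b j k)\<^sup>2 * resd n \<eta> W k)"
  obtains s t where
    "resd n \<eta> (adj (sub_scalar z X)) j * (\<eta>\<^sup>2 * (1 + s)) = 1"
    "resd n \<eta> Z j * (\<eta>\<^sup>2 * (1 + t)) = 1"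
    "\<bar>s - (p + (cmod z)\<^sup>2 * resd n \<eta> Z j)\<bar> \<le> 1 / 4" "\<bar>t - q\<bar> \<le> 1 / 8" "0 \<le> t"
proof -
  define s where "s = Re (sesq n (res n \<eta> Z) (\<lambda>k. sub_scalar z X k j))"
  define t where "t = Re (sesq n (res n \<eta> W) (\<lambda>k. adj Z k j))"
  define r where "r = (\<Sum>k<n. res n \<eta> Z j k * X k j)"
  have P: "(\<Sum>i<n. complex_of_real ((b i j)\<^sup>2) * res n \<eta> Z i i) = complex_of_real p"
    by (simp add: p_def res_diag[OF eta])
  have "(\<Sum>k<n. complex_of_real ((if k = j then 0 else b j k)\<^sup>2) * res n \<eta> W k k)
      = (\<Sum>k\<in>{..<n} - {j}. complex_of_real ((b j k)\<^sup>2) * res n \<eta> W k k)"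
    using j by (subst sum.remove[of _ j]) auto
  then have Q: "(\<Sum>k<n. complex_of_real ((if k = j then 0 else b j k)\<^sup>2) * res n \<eta> W k k) = complex_of_real q"
    by (simp add: q_def res_diag[OF eta])
  have g1: "cmod (sesq n (res n \<eta> Z) (\<lambda>i. X i j) - complex_of_real p) \<le> 1 / 8"
    and g2: "cmod z * cmod r \<le> 1 / 16"
    and g3: "cmod (sesq n (res n \<eta> W) (\<lambda>k. if k = j then 0 else cnj (X j k)) - complex_of_real q) \<le> 1 / 8"
    using g unfolding good_def Z_def[symmetric] W_def[symmetric] P Q r_def by blast+
  have 1: "resd n \<eta> (adj (sub_scalar z X)) j * (\<eta>\<^sup>2 * (1 + s)) = 1"
    unfolding s_def Z_def col_minor_def by (rule resd_schur[OF eta j])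
  have W: "W = zero_col j (adj Z)"
    by (simp add: W_def Z_def row_col_minor_def col_minor_def adj_zero_row)
  have 2: "resd n \<eta> Z j * (\<eta>\<^sup>2 * (1 + t)) = 1"
    using resd_schur[OF eta j, of "adj Z"] unfolding t_def W by simp
  have "\<bar>Re (cnj z * r)\<bar> \<le> 1 / 16" using g2 abs_Re_le_cmod[of "cnj z * r"] by (simp add: norm_mult)
  moreover have "s = Re (sesq n (res n \<eta> Z) (\<lambda>k. X k j)) - 2 * Re (cnj z * r) + (cmod z)\<^sup>2 * resd n \<eta> Z j"
    unfolding s_def r_def sesq_sub_scalar[OF j] by simp
  ultimately have 3: "\<bar>s - (p + (cmod z)\<^sup>2 * resd n \<eta> Z j)\<bar> \<le> 1 / 4"
    using Re_approx[OF g1] by linarith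
  \<comment> \<open>Zeroing column \<open>j\<close> has also deleted the diagonal entry X_jj - z, so
    the row carries no shift and the second form has no cross term.\<close>
  have "(\<lambda>k. adj Z k j) = (\<lambda>k. if k = j then 0 else cnj (X j k))"
    by (auto simp: Z_def col_minor_def adj_def zero_col_def sub_scalar_def)
  then have "t = Re (sesq n (res n \<eta> W) (\<lambda>k. if k = j then 0 else cnj (X j k)))"
    by (simp only: t_def)
  then have 4: "\<bar>t - q\<bar> \<le> 1 / 8" using Re_approx[OF g3] by linarith
  have "0 \<le> t" unfolding t_def by (rule sesq_res_nonneg[OF eta])
  from that[OF 1 2 3 4 this] show ?thesis .
qed

section \<open>Comparison of the largest U with the smallest V\<close>

lemma weighted_sum_bounds:
  assumes "(\<Sum>i<n. w i) = 1" "\<And>i. i < n \<Longrightarrow> 0 \<le> w i" "\<And>i. i < n \<Longrightarrow> lo \<le> f i \<and> f i \<le> (hi::real)"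
  shows "lo \<le> (\<Sum>i<n. w i * f i)" "(\<Sum>i<n. w i * f i) \<le> hi"
proof -
  have "(\<Sum>i<n. w i * lo) \<le> (\<Sum>i<n. w i * f i)" using assms by (intro sum_mono mult_left_mono) auto
  then show "lo \<le> (\<Sum>i<n. w i * f i)" using assms(1) by (simp add: sum_distrib_right[symmetric])
  have "(\<Sum>i<n. w i * f i) \<le> (\<Sum>i<n. w i * hi)" using assms by (intro sum_mono mult_left_mono) auto
  then show "(\<Sum>i<n. w i * f i) \<le> hi" using assms(1) by (simp add: sum_distrib_right[symmetric])
qed

text \<open>Multiplying the two inequalities crosswise eliminates the common factor; the products M
  m cancel and 5 M \<le> 11 m remains. Dropping \<open>a\<close> from the first gives \<eta>^2 M m
  \<le> 1. Together (M \<eta>)^2 \<le> 11/5 < 9/4, which is the origin of 3/2.\<close>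

lemma dyson_bound:
  fixes M m :: real
  assumes "M > 0" "m > 0" "a \<ge> 0"
    and "M * (\<eta>\<^sup>2 * (11 / 8 + M) * (5 / 8 + m) + a) \<le> 11 / 8 + M"
    and "5 / 8 + m \<le> m * (\<eta>\<^sup>2 * (11 / 8 + M) * (5 / 8 + m) + a)"
  shows "M \<le> 3 / (2 * \<eta>)"
proof -
  define A B D where "A = 11 / 8 + M" and "B = 5 / 8 + m" and "D = \<eta>\<^sup>2 * A * B + a"
  have pos: "A > 0" "B > 0" using assms by (auto simp: A_def B_def)
  then have D: "D > 0" using eta assms by (simp add: D_def add_pos_nonneg)
  have M: "M * D \<le> A" and m: "B \<le> m * D" using assms(4,5) by (auto simp: A_def B_def D_def)
  have "(M * B) * D \<le> A * B" using mult_right_mono[OF M, of B] pos by (simp add: mult_ac)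
  also have "\<dots> \<le> (A * m) * D" using mult_left_mono[OF m, of A] pos by (simp add: mult_ac)
  finally have "M * B \<le> A * m" using D by simp
  then have Mm: "5 * M \<le> 11 * m" by (simp add: A_def B_def algebra_simps)
  have "(M * \<eta>\<^sup>2 * B) * A \<le> M * D" using assms(1,3) by (simp add: D_def algebra_simps)
  then have "(M * \<eta>\<^sup>2 * B) * A \<le> 1 * A" using M by simp
  then have "M * \<eta>\<^sup>2 * B \<le> 1" using pos by simp
  moreover have "M * \<eta>\<^sup>2 * m \<le> M * \<eta>\<^sup>2 * B" using assms by (intro mult_left_mono) (auto simp: B_def)
  ultimately have "M * \<eta>\<^sup>2 * m \<le> 1" by linarith
  moreover have "(M * \<eta>\<^sup>2) * (5 * M) \<le> (M * \<eta>\<^sup>2) * (11 * m)" using Mm assms by (intro mult_left_mono) auto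
  ultimately have "(M * \<eta>)\<^sup>2 \<le> (3 / 2)\<^sup>2" by (simp add: power2_eq_square mult_ac)
  then have "M * \<eta> \<le> 3 / 2" by (rule power2_le_imp_le) simp
  then show ?thesis using eta by (simp add: field_simps)
qed

text \<open>The hypothesis \<open>good2\<close> is the same event for the adjoint matrix, with
  transposed profile and conjugate parameter. Passing to the adjoint exchanges U and V.\<close>

lemma resd_bound:
  assumes j0: "j0 < n" and ds: "doubly_stochastic_profile n b"
    and beta: "\<And>i k. i < n \<Longrightarrow> k < n \<Longrightarrow> (b i k)\<^sup>2 \<le> \<beta>" "\<beta> / \<eta>\<^sup>2 \<le> 1 / 8"
    and good1: "\<And>j. j < n \<Longrightarrow> good n \<eta> b X z j"
    and good2: "\<And>j. j < n \<Longrightarrow> good n \<eta> (\<lambda>i k. b k i) (adj X) (cnj z) j"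
  shows "resd n \<eta> (adj (sub_scalar z X)) j0 \<le> 3 / (2 * \<eta>)"
proof -
  let ?Y = "sub_scalar z X"
  define U where "U = resd n \<eta> (adj ?Y)"
  define V where "V = resd n \<eta> ?Y"
  define M where "M = Max (U ` {..<n})"
  define m where "m = Min (V ` {..<n})"
  have ne: "{..<n} \<noteq> {}" using j0 by auto
  have UM: "U j \<le> M" if "j < n" for j using that by (auto simp: M_def)
  have mV: "m \<le> V j" if "j < n" for j using that by (auto simp: m_def)
  have "M \<in> U ` {..<n}" unfolding M_def using ne by (intro Max_in) auto
  then obtain J where J: "J < n" "M = U J" by auto
  have "m \<in> V ` {..<n}" unfolding m_def using ne by (intro Min_in) auto
  then obtain I where I: "I < n" "m = V I" by auto
  have U0: "0 < U j" and V0: "0 < V j" if "j < n" for j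
    using resd_pos[OF eta that] by (auto simp: U_def V_def)
  have M0: "M > 0" and m0: "m > 0" using J I U0 V0 by auto
  have b0: "\<beta> \<ge> 0" using beta(1)[OF j0 j0] zero_le_power2[of "b j0 j0"] by linarith
  have ab: "\<bar>\<beta>\<bar> / \<eta>\<^sup>2 \<le> 1 / 8" "\<beta> * (1 / \<eta>\<^sup>2) \<le> 1 / 8" using beta(2) b0 by simp_all
  have rows: "(\<Sum>k<n. (b j k)\<^sup>2) = 1" and cols: "(\<Sum>i<n. (b i j)\<^sup>2) = 1" if "j < n" for j
    using ds that by (auto simp: doubly_stochastic_profile_def)
  define a where "a = (cmod z)\<^sup>2"
  have a0: "a \<ge> 0" by (simp add: a_def)
  \<comment> \<open>11/8 = 1 + 1/4 + 1/8: the error of the first form and one column removal. 5/8 =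
    1 - 1/8 - 1/8 - 1/8: the error of the second form, one row removal, and the diagonal term
    missing from the average.\<close>
  define A B where "A = 11 / 8 + M" and "B = 5 / 8 + m"
  have AB: "A > 0" "B > 0" using M0 m0 by (auto simp: A_def B_def)
  have e2: "\<eta>\<^sup>2 > 0" using eta by simp

  \<comment> \<open>An upper bound on U_j needs a lower bound on \<open>s\<close>. Since
    \<open>s\<close> contains the term \<open>a\<close> / (\<eta>^2 (1 + t)), this means bounding
    V-averages from below by \<open>m\<close> and U-averages from above by \<open>M\<close>.\<close>
  have Mle: "U j * (\<eta>\<^sup>2 * A * B + a) \<le> A" if j: "j < n" for j
  proof -
    define Z where "Z = col_minor z j X"
    define W where "W = row_col_minor z j X"
    obtain s t where st:
      "resd n \<eta> (adj ?Y) j * (\<eta>\<^sup>2 * (1 + s)) = 1"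
      "resd n \<eta> Z j * (\<eta>\<^sup>2 * (1 + t)) = 1"
      "\<bar>s - ((\<Sum>i<n. (b i j)\<^sup>2 * resd n \<eta> Z i) + (cmod z)\<^sup>2 * resd n \<eta> Z j)\<bar> \<le> 1 / 4"
      "\<bar>t - (\<Sum>k\<in>{..<n} - {j}. (b j k)\<^sup>2 * resd n \<eta> W k)\<bar> \<le> 1 / 8" "0 \<le> t"
      by (rule good_schur[OF j good1[OF j], folded Z_def W_def])
    have "(\<Sum>i<n. (b i j)\<^sup>2 * V i) \<le> (\<Sum>i<n. (b i j)\<^sup>2 * resd n \<eta> Z i)"
      unfolding V_def Z_def col_minor_def
      using resd_zero_col_ge[OF eta j] by (intro sum_mono mult_left_mono) auto
    moreover have "m \<le> (\<Sum>i<n. (b i j)\<^sup>2 * V i)"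
      by (rule weighted_sum_bounds(1)[where hi = "Max (V ` {..<n})"]) (use cols[OF j] mV in auto)
    ultimately have s: "s \<ge> m + a * resd n \<eta> Z j - 1 / 4" using st(3) unfolding a_def by linarith
    have W: "W = zero_row j (zero_col j (adj ?Y))"
      by (simp add: W_def row_col_minor_def adj_zero_row adj_zero_col zero_row_zero_col)
    have "(\<Sum>k\<in>{..<n} - {j}. (b j k)\<^sup>2 * resd n \<eta> W k)
        \<le> (\<Sum>k\<in>{..<n} - {j}. (b j k)\<^sup>2 * resd n \<eta> (zero_col j (adj ?Y)) k)"
      unfolding W using resd_zero_row_le[OF eta j] by (intro sum_mono mult_left_mono) auto
    moreover have "(\<Sum>k\<in>{..<n} - {j}. (b j k)\<^sup>2 * resd n \<eta> (zero_col j (adj ?Y)) k)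
        \<le> (\<Sum>k\<in>{..<n} - {j}. (b j k)\<^sup>2 * U k) + \<bar>\<beta>\<bar> / \<eta>\<^sup>2"
      unfolding U_def using beta(1)[OF j] by (intro resd_zero_col_sum[OF eta j]) auto
    moreover have "(\<Sum>k\<in>{..<n} - {j}. (b j k)\<^sup>2 * U k) \<le> (\<Sum>k<n. (b j k)\<^sup>2 * U k)"
      using U0 by (intro sum_mono2) (auto simp: less_imp_le)
    moreover have "(\<Sum>k<n. (b j k)\<^sup>2 * U k) \<le> M"
      by (rule weighted_sum_bounds(2)[where lo = 0]) (use rows[OF j] UM U0 in \<open>auto simp: less_imp_le\<close>)
    ultimately have t: "1 + t \<le> A" using st(4) ab unfolding A_def by linarith
    have "resd n \<eta> Z j * (\<eta>\<^sup>2 * (1 + t)) \<le> resd n \<eta> Z j * (\<eta>\<^sup>2 * A)"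
      using t e2 resd_pos[OF eta j, of Z] by (intro mult_left_mono) auto
    then have "1 \<le> resd n \<eta> Z j * (\<eta>\<^sup>2 * A)" unfolding st(2) .
    then have "B * (\<eta>\<^sup>2 * A) + a * 1 \<le> B * (\<eta>\<^sup>2 * A) + a * (resd n \<eta> Z j * (\<eta>\<^sup>2 * A))"
      using a0 by (intro add_left_mono mult_left_mono) auto
    also have "\<dots> = (B + a * resd n \<eta> Z j) * (\<eta>\<^sup>2 * A)" by (simp add: algebra_simps)
    also have "\<dots> \<le> (1 + s) * (\<eta>\<^sup>2 * A)"
      using s e2 AB by (intro mult_right_mono) (auto simp: B_def)
    finally have "U j * (\<eta>\<^sup>2 * A * B + a) \<le> U j * ((1 + s) * (\<eta>\<^sup>2 * A))"
      using U0[OF j] by (intro mult_left_mono) (auto simp: mult_ac)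
    also have "\<dots> = (U j * (\<eta>\<^sup>2 * (1 + s))) * A" by (simp add: mult_ac)
    also have "\<dots> = A" using st(1) by (simp add: U_def)
    finally show ?thesis .
  qed

  \<comment> \<open>The mirror image for the adjoint: now \<open>s\<close> is bounded above through
    \<open>M\<close> and \<open>t\<close> below through \<open>m\<close>.\<close>
  have mge: "B \<le> V j * (\<eta>\<^sup>2 * A * B + a)" if j: "j < n" for j
  proof -
    define Z where "Z = col_minor (cnj z) j (adj X)"
    define W where "W = row_col_minor (cnj z) j (adj X)"
    have Y': "sub_scalar (cnj z) (adj X) = adj ?Y" by (simp add: adj_sub_scalar)
    obtain s t where st:
      "resd n \<eta> ?Y j * (\<eta>\<^sup>2 * (1 + s)) = 1"
      "resd n \<eta> Z j * (\<eta>\<^sup>2 * (1 + t)) = 1"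
      "\<bar>s - ((\<Sum>i<n. (b j i)\<^sup>2 * resd n \<eta> Z i) + (cmod z)\<^sup>2 * resd n \<eta> Z j)\<bar> \<le> 1 / 4"
      "\<bar>t - (\<Sum>k\<in>{..<n} - {j}. (b k j)\<^sup>2 * resd n \<eta> W k)\<bar> \<le> 1 / 8" "0 \<le> t"
      by (rule good_schur[OF j good2[OF j], folded Z_def W_def, unfolded Y' adj_adj complex_mod_cnj])
    have Z: "Z = zero_col j (adj ?Y)" by (simp add: Z_def col_minor_def Y')
    have "(\<Sum>i<n. (b j i)\<^sup>2 * resd n \<eta> Z i) \<le> (\<Sum>i<n. (b j i)\<^sup>2 * U i) + \<bar>\<beta>\<bar> / \<eta>\<^sup>2"
      unfolding Z U_def using beta(1)[OF j] by (intro resd_zero_col_sum[OF eta j]) auto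
    moreover have "(\<Sum>i<n. (b j i)\<^sup>2 * U i) \<le> M"
      by (rule weighted_sum_bounds(2)[where lo = 0]) (use rows[OF j] UM U0 in \<open>auto simp: less_imp_le\<close>)
    ultimately have s: "1 + s \<le> A + a * resd n \<eta> Z j"
      using st(3) ab unfolding a_def A_def by linarith
    have W: "W = zero_row j (zero_col j ?Y)"
      by (simp add: W_def row_col_minor_def Y' adj_zero_row adj_zero_col zero_row_zero_col)
    have "m \<le> (\<Sum>k<n. (b k j)\<^sup>2 * V k)"
      by (rule weighted_sum_bounds(1)[where hi = "Max (V ` {..<n})"]) (use cols[OF j] mV in auto)
    moreover have "(\<Sum>k<n. (b k j)\<^sup>2 * V k) = (b j j)\<^sup>2 * V j + (\<Sum>k\<in>{..<n} - {j}. (b k j)\<^sup>2 * V k)"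
      using j by (subst sum.remove[of _ j]) auto
    \<comment> \<open>The average left by the second Schur complement omits the index
      \<open>j\<close>; a lower bound must pay for that term, which the trivial resolvent bound
      makes small.\<close>
    moreover have "(b j j)\<^sup>2 * V j \<le> \<beta> * (1 / \<eta>\<^sup>2)"
      using beta(1)[OF j j] resd_le[OF eta j, of ?Y] V0[OF j] b0 by (intro mult_mono) (auto simp: V_def)
    moreover have "(\<Sum>k\<in>{..<n} - {j}. (b k j)\<^sup>2 * V k) \<le> (\<Sum>k\<in>{..<n} - {j}. (b k j)\<^sup>2 * resd n \<eta> (zero_col j ?Y) k)"
      unfolding V_def using resd_zero_col_ge[OF eta j] by (intro sum_mono mult_left_mono) auto
    moreover have "(\<Sum>k\<in>{..<n} - {j}. (b k j)\<^sup>2 * resd n \<eta> (zero_col j ?Y) k) \<le> (\<Sum>k\<in>{..<n} - {j}. (b k j)\<^sup>2 * resd n \<eta> W k) + \<bar>\<beta>\<bar> / \<eta>\<^sup>2"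
      unfolding W using beta(1)[OF _ j] by (intro resd_zero_row_sum[OF eta j]) auto
    ultimately have t: "B \<le> 1 + t" using st(4) ab unfolding B_def by linarith
    have "resd n \<eta> Z j * (\<eta>\<^sup>2 * B) \<le> resd n \<eta> Z j * (\<eta>\<^sup>2 * (1 + t))"
      using t e2 resd_pos[OF eta j, of Z] by (intro mult_left_mono) auto
    then have "resd n \<eta> Z j * (\<eta>\<^sup>2 * B) \<le> 1" unfolding st(2) .
    then have "A * (\<eta>\<^sup>2 * B) + a * (resd n \<eta> Z j * (\<eta>\<^sup>2 * B)) \<le> A * (\<eta>\<^sup>2 * B) + a * 1"
      using a0 by (intro add_left_mono mult_left_mono) auto
    moreover have "(1 + s) * (\<eta>\<^sup>2 * B) \<le> (A + a * resd n \<eta> Z j) * (\<eta>\<^sup>2 * B)"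
      using s e2 AB by (intro mult_right_mono) auto
    ultimately have "(1 + s) * (\<eta>\<^sup>2 * B) \<le> \<eta>\<^sup>2 * A * B + a" by (simp add: algebra_simps)
    then have "V j * ((1 + s) * (\<eta>\<^sup>2 * B)) \<le> V j * (\<eta>\<^sup>2 * A * B + a)"
      using V0[OF j] by (intro mult_left_mono) auto
    moreover have "V j * ((1 + s) * (\<eta>\<^sup>2 * B)) = (V j * (\<eta>\<^sup>2 * (1 + s))) * B" by (simp only: mult_ac)
    moreover have "V j * (\<eta>\<^sup>2 * (1 + s)) = 1" using st(1) by (simp only: V_def)
    ultimately show ?thesis by simp
  qed
  have "M \<le> 3 / (2 * \<eta>)"
    by (rule dyson_bound[of M m a])
      (use M0 m0 a0 Mle[OF J(1)] mge[OF I(1)] J(2) I(2) in \<open>auto simp: A_def B_def\<close>)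
  then show ?thesis using UM[OF j0] by (simp add: U_def)
qed

end

section \<open>Concentration of linear and quadratic forms\<close>

text \<open>The factor 2 is the bound on the subgaussian moment; the rest is the constant that lets
  exp(w / K^2) dominate (1 + w)^2 exp((1 + w) / (2 K^2)), with w = |z|^2.\<close>

definition mgf_const :: "real \<Rightarrow> real" where
  "mgf_const K = 2 * ((1 + 4 * K\<^sup>2)\<^sup>2 * exp (1 / (2 * K\<^sup>2)))"

lemma exp_le_quadratic:
  fixes x :: real
  shows "exp x \<le> 1 + x + x\<^sup>2 * exp \<bar>x\<bar>"
proof -
  obtain t where t: "\<bar>t\<bar> \<le> \<bar>x\<bar>" "exp x = (\<Sum>m<2. x ^ m / fact m) + exp t / fact 2 * x ^ 2"
    using Maclaurin_exp_le[of x 2] by auto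
  have "exp t / 2 * x\<^sup>2 \<le> exp \<bar>x\<bar> * x\<^sup>2"
  proof (intro mult_right_mono)
    have "exp t \<le> exp \<bar>x\<bar>" using t(1) by simp
    then show "exp t / 2 \<le> exp \<bar>x\<bar>" using exp_gt_zero[of t] by linarith
  qed simp
  then show ?thesis using t(2) by (simp add: numeral_2_eq_2 mult.commute)
qed

text \<open>Grouping the terms by their larger index turns a quadratic form into a sum whose i-th
  term involves coordinate i and earlier coordinates only.\<close>

lemma double_sum_triangle:
  fixes a :: "nat \<Rightarrow> nat \<Rightarrow> 'a::comm_monoid_add"
  shows "(\<Sum>i<m. \<Sum>k<m. a i k) = (\<Sum>i<m. a i i + (\<Sum>k<i. a i k + a k i))"
proof (induction m)
  case (Suc m)
  have "(\<Sum>i<Suc m. \<Sum>k<Suc m. a i k) = (\<Sum>i<m. \<Sum>k<m. a i k) + (a m m + (\<Sum>k<m. a m k + a k m))"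
    by (simp add: sum.distrib ac_simps)
  then show ?case by (simp add: Suc.IH)
qed simp

text \<open>Chernoff's bound in the four directions 1, -1, i, -i. If |F| exceeds x, then the real or
  the imaginary part is at least x/2 in modulus, which accounts for both the factor 4 and the halved
  exponent.\<close>

lemma emeasure_complex_tail:
  assumes F[measurable]: "F \<in> borel_measurable M"
    and mgf: "\<And>\<theta>. cmod \<theta> = s \<Longrightarrow> (\<integral>\<^sup>+\<omega>. ennreal (exp (Re (\<theta> * F \<omega>))) \<partial>M) \<le> ennreal B"
    and s: "s \<ge> 0" and B: "B \<ge> 0"
  shows "emeasure M {\<omega> \<in> space M. x < cmod (F \<omega>)} \<le> ennreal (4 * (B * exp (- (s * x / 2))))"
proof -
  define \<Theta> where "\<Theta> = [complex_of_real s, - complex_of_real s, \<i> * complex_of_real s, - (\<i> * complex_of_real s)]"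
  have \<Theta>: "cmod \<theta> = s" if "\<theta> \<in> set \<Theta>" for \<theta> using that s by (auto simp: \<Theta>_def norm_mult)
  let ?e = "\<lambda>\<theta> \<omega>. ennreal (exp (Re (\<theta> * F \<omega>)))"
  have ind: "indicator {\<omega> \<in> space M. x < cmod (F \<omega>)} \<omega> \<le>
      ennreal (exp (- (s * x / 2))) * (\<Sum>\<theta>\<leftarrow>\<Theta>. ?e \<theta> \<omega>)" for \<omega>
  proof (cases "x < cmod (F \<omega>)")
    case True
    then have "x / 2 \<le> \<bar>Re (F \<omega>)\<bar> \<or> x / 2 \<le> \<bar>Im (F \<omega>)\<bar>"
      using cmod_le[of "F \<omega>"] by linarith
    then obtain u where u: "u = Re (F \<omega>) \<or> u = Im (F \<omega>)" "x / 2 \<le> \<bar>u\<bar>" by blast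
    define v where "v = \<bar>u\<bar>"
    have v: "v \<in> {Re (F \<omega>), - Re (F \<omega>), Im (F \<omega>), - Im (F \<omega>)}" "x / 2 \<le> v"
      using u by (cases "0 \<le> u"; auto simp: v_def)+
    have "s * (x / 2) \<le> s * v" using v(2) s by (intro mult_left_mono)
    then have "1 \<le> exp (- (s * x / 2)) * exp (s * v)" by (simp add: exp_add[symmetric])
    also have "\<dots> \<le> exp (- (s * x / 2)) *
       (exp (s * Re (F \<omega>)) + exp (- (s * Re (F \<omega>))) + exp (- (s * Im (F \<omega>))) + exp (s * Im (F \<omega>)))"
      using v(1) by (intro mult_left_mono) (auto intro!: add_nonneg_nonneg)
    finally have "ennreal 1 \<le> ennreal (exp (- (s * x / 2)) *
       (exp (s * Re (F \<omega>)) + exp (- (s * Re (F \<omega>))) + exp (- (s * Im (F \<omega>))) + exp (s * Im (F \<omega>))))"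
      by (intro ennreal_leI)
    also have "\<dots> = ennreal (exp (- (s * x / 2))) * (\<Sum>\<theta>\<leftarrow>\<Theta>. ?e \<theta> \<omega>)"
      by (simp add: \<Theta>_def ennreal_mult add_ac)
    finally show ?thesis by (auto simp: indicator_def)
  qed (auto simp: indicator_def)
  have "emeasure M {\<omega> \<in> space M. x < cmod (F \<omega>)} = (\<integral>\<^sup>+\<omega>. indicator {\<omega> \<in> space M. x < cmod (F \<omega>)} \<omega> \<partial>M)"
    by simp
  also have "\<dots> \<le> (\<integral>\<^sup>+\<omega>. ennreal (exp (- (s * x / 2))) * (\<Sum>\<theta>\<leftarrow>\<Theta>. ?e \<theta> \<omega>) \<partial>M)"
    by (intro nn_integral_mono ind)
  also have "\<dots> = ennreal (exp (- (s * x / 2))) * (\<Sum>\<theta>\<leftarrow>\<Theta>. \<integral>\<^sup>+\<omega>. ?e \<theta> \<omega> \<partial>M)"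
    unfolding \<Theta>_def by (simp add: nn_integral_cmult nn_integral_add)
  also have "\<dots> \<le> ennreal (exp (- (s * x / 2))) * (\<Sum>\<theta>\<leftarrow>\<Theta>. ennreal B)"
    by (intro mult_left_mono sum_list_mono mgf \<Theta>) auto
  also have "(\<Sum>\<theta>\<leftarrow>\<Theta>. ennreal B) = ennreal (4 * B)"
    using B by (simp add: \<Theta>_def ennreal_plus[symmetric] del: ennreal_plus)
  finally show ?thesis using B by (simp add: ennreal_mult[symmetric] mult_ac)
qed

locale subgaussian_entries =
  fixes \<xi> :: "complex measure" and K :: real
  assumes std: "standardized_law \<xi>" and sub: "subgaussian_law K \<xi>" and K: "K > 0"
begin

sublocale prob_space \<xi> using std by (simp add: standardized_law_def)

lemma sets_xi [measurable_cong, simp]: "sets \<xi> = sets borel"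
  using std by (simp add: standardized_law_def)

lemma space_xi [simp]: "space \<xi> = UNIV"
  using sets_eq_imp_space_eq[OF sets_xi] by simp

lemma integrable_id: "integrable \<xi> (\<lambda>z. z)" and integral_id: "(LINT z|\<xi>. z) = 0"
  and integrable_square: "integrable \<xi> (\<lambda>z. (cmod z)\<^sup>2)" and integral_square: "(LINT z|\<xi>. (cmod z)\<^sup>2) = 1"
  using std by (simp_all add: standardized_law_def)

lemma integrable_exp_square: "integrable \<xi> (\<lambda>z. exp ((cmod z)\<^sup>2 / K\<^sup>2))"
  and integral_exp_square: "(LINT z|\<xi>. exp ((cmod z)\<^sup>2 / K\<^sup>2)) \<le> 2"
proof -
  have le: "(\<integral>\<^sup>+z. ennreal (exp ((cmod z)\<^sup>2 / K\<^sup>2)) \<partial>\<xi>) \<le> ennreal 2"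
    using sub by (simp add: subgaussian_law_def)
  have "(\<integral>\<^sup>+z. ennreal (exp ((cmod z)\<^sup>2 / K\<^sup>2)) \<partial>\<xi>) < \<infinity>"
    by (rule order_le_less_trans[OF le]) simp
  then show i: "integrable \<xi> (\<lambda>z. exp ((cmod z)\<^sup>2 / K\<^sup>2))"
    by (intro integrableI_nonneg) auto
  have "ennreal (LINT z|\<xi>. exp ((cmod z)\<^sup>2 / K\<^sup>2)) \<le> ennreal 2"
    using le nn_integral_eq_integral[OF i] by simp
  then show "(LINT z|\<xi>. exp ((cmod z)\<^sup>2 / K\<^sup>2)) \<le> 2"
    by (subst (asm) ennreal_le_iff) simp_all
qed

text \<open>Expansion of the exponential to second order; the mean kills the linear term. The
  restriction on \<open>a\<close> spends half of the available exponential moment on exp |f|, and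
  the other half absorbs the polynomial (1 + |z|^2)^2.\<close>

lemma mgf_bound:
  fixes f :: "complex \<Rightarrow> real"
  assumes f[measurable]: "f \<in> borel_measurable borel" and mean: "(LINT z|\<xi>. f z) = 0"
    and bound: "\<And>z. \<bar>f z\<bar> \<le> a * (1 + (cmod z)\<^sup>2)" and a: "0 \<le> a" "a \<le> 1 / (2 * K\<^sup>2)"
  shows "(\<integral>\<^sup>+z. ennreal (exp (f z)) \<partial>\<xi>) \<le> ennreal (exp (mgf_const K * a\<^sup>2))"
proof -
  define D where "D = (1 + 4 * K\<^sup>2)\<^sup>2 * exp (1 / (2 * K\<^sup>2))"
  have K2: "K\<^sup>2 > 0" using K by simp
  have intf: "integrable \<xi> f"
    by (rule Bochner_Integration.integrable_bound[of \<xi> "\<lambda>z. a * (1 + (cmod z)\<^sup>2)"])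
      (use integrable_square bound a in \<open>auto intro!: AE_I2\<close>)
  have pt: "exp (f z) \<le> 1 + f z + a\<^sup>2 * (D * exp ((cmod z)\<^sup>2 / K\<^sup>2))" for z
  proof -
    define w where "w = (cmod z)\<^sup>2"
    have w: "w \<ge> 0" by (simp add: w_def)
    have b: "\<bar>f z\<bar> \<le> a * (1 + w)" using bound[of z] by (simp add: w_def)
    have "1 + w \<le> (1 + 4 * K\<^sup>2) * (1 + w / (4 * K\<^sup>2))"
      using K2 w by (simp add: field_simps)
    also have "\<dots> \<le> (1 + 4 * K\<^sup>2) * exp (w / (4 * K\<^sup>2))"
      using exp_ge_add_one_self[of "w / (4 * K\<^sup>2)"] by (intro mult_left_mono) auto
    finally have "(1 + w)\<^sup>2 \<le> ((1 + 4 * K\<^sup>2) * exp (w / (4 * K\<^sup>2)))\<^sup>2"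
      using w by (intro power_mono) auto
    also have "\<dots> = (1 + 4 * K\<^sup>2)\<^sup>2 * exp (w / (2 * K\<^sup>2))"
      by (simp add: power_mult_distrib exp_double[symmetric])
    finally have w2: "(1 + w)\<^sup>2 \<le> (1 + 4 * K\<^sup>2)\<^sup>2 * exp (w / (2 * K\<^sup>2))" .
    have "\<bar>f z\<bar> \<le> 1 / (2 * K\<^sup>2) * (1 + w)"
      using b mult_right_mono[OF a(2), of "1 + w"] w by linarith
    also have "\<dots> = 1 / (2 * K\<^sup>2) + w / (2 * K\<^sup>2)" by (simp add: add_divide_distrib)
    finally have e: "exp \<bar>f z\<bar> \<le> exp (1 / (2 * K\<^sup>2)) * exp (w / (2 * K\<^sup>2))"
      by (simp add: exp_add[symmetric])
    have "(f z)\<^sup>2 \<le> (a * (1 + w))\<^sup>2" using b by (metis abs_ge_zero power2_abs power_mono)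
    also have "\<dots> \<le> a\<^sup>2 * ((1 + 4 * K\<^sup>2)\<^sup>2 * exp (w / (2 * K\<^sup>2)))"
      unfolding power_mult_distrib using w2 by (intro mult_left_mono) auto
    finally have "(f z)\<^sup>2 * exp \<bar>f z\<bar> \<le> (a\<^sup>2 * ((1 + 4 * K\<^sup>2)\<^sup>2 * exp (w / (2 * K\<^sup>2)))) * (exp (1 / (2 * K\<^sup>2)) * exp (w / (2 * K\<^sup>2)))"
      using e by (intro mult_mono) auto
    also have "\<dots> = a\<^sup>2 * (D * (exp (w / (2 * K\<^sup>2)) * exp (w / (2 * K\<^sup>2))))"
      by (simp add: D_def mult_ac)
    also have "exp (w / (2 * K\<^sup>2)) * exp (w / (2 * K\<^sup>2)) = exp (w / K\<^sup>2)"
      using K2 by (simp add: exp_add[symmetric])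
    finally show ?thesis using exp_le_quadratic[of "f z"] by (simp add: w_def)
  qed
  have int: "integrable \<xi> (\<lambda>z. 1 + f z + a\<^sup>2 * (D * exp ((cmod z)\<^sup>2 / K\<^sup>2)))"
    using intf integrable_exp_square by simp
  have "(\<integral>\<^sup>+z. ennreal (exp (f z)) \<partial>\<xi>) \<le> (\<integral>\<^sup>+z. ennreal (1 + f z + a\<^sup>2 * (D * exp ((cmod z)\<^sup>2 / K\<^sup>2))) \<partial>\<xi>)"
    by (intro nn_integral_mono ennreal_leI pt)
  also have "\<dots> = ennreal (LINT z|\<xi>. 1 + f z + a\<^sup>2 * (D * exp ((cmod z)\<^sup>2 / K\<^sup>2)))"
    by (rule nn_integral_eq_integral[OF int]) (auto intro!: AE_I2 order_trans[OF _ pt])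
  also have "(LINT z|\<xi>. 1 + f z + a\<^sup>2 * (D * exp ((cmod z)\<^sup>2 / K\<^sup>2)))
      = 1 + a\<^sup>2 * (D * (LINT z|\<xi>. exp ((cmod z)\<^sup>2 / K\<^sup>2)))"
    using intf integrable_exp_square mean prob_space by simp
  also have "\<dots> \<le> 1 + a\<^sup>2 * (D * 2)"
    using integral_exp_square by (intro add_left_mono mult_left_mono) (auto simp: D_def)
  also have "\<dots> \<le> exp (mgf_const K * a\<^sup>2)"
    using exp_ge_add_one_self[of "mgf_const K * a\<^sup>2"] by (simp add: mgf_const_def D_def mult_ac)
  finally show ?thesis by (simp add: ennreal_leI)
qed

abbreviation PX :: "'i set \<Rightarrow> ('i \<Rightarrow> complex) measure" where
  "PX I \<equiv> PiM I (\<lambda>_. \<xi>)"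

text \<open>An exponential supermartingale, integrated from the last coordinate down. In place of a
  filtration, the coefficient function \<open>f i \<omega>\<close> depends only on coordinates of
  \<omega> below i. Measurability is required on every shorter product because the induction passes
  through all of them.\<close>

lemma mgf_adapted_sum:
  fixes f :: "nat \<Rightarrow> (nat \<Rightarrow> complex) \<Rightarrow> complex \<Rightarrow> real"
  assumes "\<And>i m'. i < m' \<Longrightarrow> m' \<le> m \<Longrightarrow> (\<lambda>\<omega>. f i \<omega> (\<omega> i)) \<in> borel_measurable (PX {..<m'})"
    and "\<And>i \<omega>. i < m \<Longrightarrow> f i \<omega> \<in> borel_measurable borel"
    and "\<And>i \<omega> \<omega>'. i < m \<Longrightarrow> (\<And>k. k < i \<Longrightarrow> \<omega> k = \<omega>' k) \<Longrightarrow> f i \<omega> = f i \<omega>'"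
    and "\<And>i \<omega>. i < m \<Longrightarrow> (LINT z|\<xi>. f i \<omega> z) = 0"
    and "\<And>i \<omega> z. i < m \<Longrightarrow> \<bar>f i \<omega> z\<bar> \<le> a i * (1 + (cmod z)\<^sup>2)"
    and "\<And>i. i < m \<Longrightarrow> 0 \<le> a i \<and> a i \<le> 1 / (2 * K\<^sup>2)"
  shows "(\<integral>\<^sup>+\<omega>. ennreal (exp (\<Sum>i<m. f i \<omega> (\<omega> i))) \<partial>PX {..<m}) \<le> ennreal (exp (mgf_const K * (\<Sum>i<m. (a i)\<^sup>2)))"
  using assms
proof (induction m)
  case 0
  interpret P: prob_space "PX ({} :: nat set)" by (intro prob_space_PiM prob_space_axioms)
  show ?case using P.emeasure_space_1 by simp
next
  case (Suc m)
  interpret product_sigma_finite "\<lambda>_::nat. \<xi>"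
    by (simp add: product_sigma_finite_def sigma_finite_measure_axioms)
  have IH: "(\<integral>\<^sup>+\<omega>. ennreal (exp (\<Sum>i<m. f i \<omega> (\<omega> i))) \<partial>PX {..<m}) \<le> ennreal (exp (mgf_const K * (\<Sum>i<m. (a i)\<^sup>2)))"
  proof (rule Suc.IH, goal_cases)
    case (1 i m')
    then show ?case by (intro Suc.prems(1)) auto
  next
    case (2 i \<omega>)
    then show ?case by (intro Suc.prems(2)) auto
  next
    case (3 i \<omega> \<omega>')
    then show ?case by (intro Suc.prems(3)) auto
  next
    case (4 i \<omega>)
    then show ?case by (intro Suc.prems(4)) auto
  next
    case (5 i \<omega> z)
    then show ?case by (intro Suc.prems(5)) auto
  next
    case (6 i)
    then show ?case by (intro Suc.prems(6)) auto
  qed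
  have meas: "(\<lambda>\<omega>. ennreal (exp (\<Sum>i<Suc m. f i \<omega> (\<omega> i)))) \<in> borel_measurable (PX (insert m {..<m}))"
  proof -
    have "(\<lambda>\<omega>. \<Sum>i<Suc m. f i \<omega> (\<omega> i)) \<in> borel_measurable (PX {..<Suc m})"
      by (intro borel_measurable_sum Suc.prems(1)) auto
    from measurable_compose[OF this, of "\<lambda>x. ennreal (exp x)" borel]
    show ?thesis unfolding lessThan_Suc[symmetric] by simp
  qed
  have [measurable]: "(\<lambda>\<omega>. \<Sum>i<m. f i \<omega> (\<omega> i)) \<in> borel_measurable (PX {..<m})"
    by (intro borel_measurable_sum Suc.prems(1)) auto
  have "(\<integral>\<^sup>+\<omega>. ennreal (exp (\<Sum>i<Suc m. f i \<omega> (\<omega> i))) \<partial>PX {..<Suc m})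
     = (\<integral>\<^sup>+x. (\<integral>\<^sup>+y. ennreal (exp (\<Sum>i<Suc m. f i (x(m := y)) ((x(m := y)) i))) \<partial>\<xi>) \<partial>PX {..<m})"
    using product_nn_integral_insert[OF _ _ meas] unfolding lessThan_Suc[symmetric] by simp
  also have "\<dots> \<le> (\<integral>\<^sup>+x. ennreal (exp (\<Sum>i<m. f i x (x i))) * ennreal (exp (mgf_const K * (a m)\<^sup>2)) \<partial>PX {..<m})"
  proof (intro nn_integral_mono)
    fix x :: "nat \<Rightarrow> complex"
    have eq: "(\<Sum>i<Suc m. f i (x(m := y)) ((x(m := y)) i)) = (\<Sum>i<m. f i x (x i)) + f m x y" for y
    proof -
      have "f i (x(m := y)) = f i x" if "i \<le> m" for i
        using that by (intro Suc.prems(3)) auto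
      then show ?thesis by simp
    qed
    have "(\<integral>\<^sup>+y. ennreal (exp (\<Sum>i<Suc m. f i (x(m := y)) ((x(m := y)) i))) \<partial>\<xi>)
      = (\<integral>\<^sup>+y. ennreal (exp (\<Sum>i<m. f i x (x i))) * ennreal (exp (f m x y)) \<partial>\<xi>)"
      unfolding eq by (simp add: exp_add ennreal_mult)
    also have "\<dots> = ennreal (exp (\<Sum>i<m. f i x (x i))) * (\<integral>\<^sup>+y. ennreal (exp (f m x y)) \<partial>\<xi>)"
      using Suc.prems(2)[of m x] by (intro nn_integral_cmult) simp
    also have "\<dots> \<le> ennreal (exp (\<Sum>i<m. f i x (x i))) * ennreal (exp (mgf_const K * (a m)\<^sup>2))"
    proof (intro mult_left_mono)
      show "(\<integral>\<^sup>+y. ennreal (exp (f m x y)) \<partial>\<xi>) \<le> ennreal (exp (mgf_const K * (a m)\<^sup>2))"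
      proof (rule mgf_bound)
        show "f m x \<in> borel_measurable borel" by (intro Suc.prems(2)) simp
        show "(LINT z|\<xi>. f m x z) = 0" by (intro Suc.prems(4)) simp
        show "\<bar>f m x z\<bar> \<le> a m * (1 + (cmod z)\<^sup>2)" for z by (intro Suc.prems(5)) simp
        show "0 \<le> a m" "a m \<le> 1 / (2 * K\<^sup>2)" using Suc.prems(6)[of m] by simp_all
      qed
    qed simp
    finally show "(\<integral>\<^sup>+y. ennreal (exp (\<Sum>i<Suc m. f i (x(m := y)) ((x(m := y)) i))) \<partial>\<xi>) \<le> \<dots>" .
  qed
  also have "\<dots> = (\<integral>\<^sup>+x. ennreal (exp (\<Sum>i<m. f i x (x i))) \<partial>PX {..<m}) * ennreal (exp (mgf_const K * (a m)\<^sup>2))"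
    by (intro nn_integral_multc) measurable
  also have "\<dots> \<le> ennreal (exp (mgf_const K * (\<Sum>i<m. (a i)\<^sup>2))) * ennreal (exp (mgf_const K * (a m)\<^sup>2))"
    by (intro mult_right_mono IH) auto
  also have "\<dots> = ennreal (exp (mgf_const K * (\<Sum>i<Suc m. (a i)\<^sup>2)))"
    by (simp add: ennreal_mult[symmetric] exp_add[symmetric] distrib_left)
  finally show ?case .
qed

text \<open>The outcome of \<open>emeasure_complex_tail\<close> at the largest scale 1 / (2 K^2)
  that \<open>mgf_bound\<close> allows. The forms below are normalised so that each ends in this
  same expression.\<close>

definition tail :: "real \<Rightarrow> real" where
  "tail \<tau> = 4 * (exp (mgf_const K * (1 / (2 * K\<^sup>2))\<^sup>2) * exp (- (\<tau> / (4 * K\<^sup>2))))"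

lemma tail_nonneg: "0 \<le> tail \<tau>"
  by (simp add: tail_def)

lemma le_one_plus_square: "cmod z \<le> 1 + (cmod z)\<^sup>2"
proof -
  have "0 \<le> (cmod z - 1)\<^sup>2" by simp
  then have "2 * cmod z \<le> 1 + (cmod z)\<^sup>2" by (simp add: power2_eq_square algebra_simps)
  then show ?thesis using norm_ge_zero[of z] by linarith
qed

lemma measurable_PX_component [measurable]:
  assumes "k \<in> I"
  shows "(\<lambda>\<omega>. \<omega> k) \<in> borel_measurable (PX I)"
  using measurable_component_singleton[OF assms, of "\<lambda>_. \<xi>"] measurable_cong_sets[OF refl sets_xi] by blast

lemma linear_tail:
  fixes \<alpha> :: "nat \<Rightarrow> complex"
  assumes V: "(\<Sum>i<m. (cmod (\<alpha> i))\<^sup>2) \<le> v\<^sup>2" "0 < v"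
  shows "emeasure (PX {..<m}) {\<omega> \<in> space (PX {..<m}). \<tau> * v < cmod (\<Sum>i<m. \<alpha> i * \<omega> i)} \<le> ennreal (tail \<tau>)"
proof -
  define s0 where "s0 = 1 / (2 * K\<^sup>2)"
  have s0: "s0 > 0" using K by (simp add: s0_def)
  \<comment> \<open>The largest scale that keeps every coefficient s |\<alpha>_i| within the range
    of \<open>mgf_bound\<close>, since |\<alpha>_i| \<le> v.\<close>
  define s where "s = s0 / v"
  have s: "s > 0" using s0 V by (simp add: s_def)
  have "emeasure (PX {..<m}) {\<omega> \<in> space (PX {..<m}). \<tau> * v < cmod (\<Sum>i<m. \<alpha> i * \<omega> i)}
    \<le> ennreal (4 * (exp (mgf_const K * s0\<^sup>2) * exp (- (s * (\<tau> * v) / 2))))"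
  proof (rule emeasure_complex_tail)
    fix \<theta> assume \<theta>: "cmod \<theta> = s"
    define f where "f = (\<lambda>i (\<omega> :: nat \<Rightarrow> complex) z. Re (\<theta> * \<alpha> i * z))"
    define a where "a = (\<lambda>i. s * cmod (\<alpha> i))"
    have \<alpha>: "cmod (\<alpha> i) \<le> v" if "i < m" for i
    proof -
      have "(cmod (\<alpha> i))\<^sup>2 \<le> (\<Sum>i<m. (cmod (\<alpha> i))\<^sup>2)" using that by (intro member_le_sum) auto
      then have "(cmod (\<alpha> i))\<^sup>2 \<le> v\<^sup>2" using V by linarith
      then show ?thesis using V(2) by (simp add: power2_le_iff_abs_le)
    qed
    have "(\<integral>\<^sup>+\<omega>. ennreal (exp (\<Sum>i<m. f i \<omega> (\<omega> i))) \<partial>PX {..<m}) \<le> ennreal (exp (mgf_const K * (\<Sum>i<m. (a i)\<^sup>2)))"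
    proof (rule mgf_adapted_sum)
      fix i \<omega> z
      have "\<bar>f i \<omega> z\<bar> \<le> s * cmod (\<alpha> i) * cmod z"
        unfolding f_def using abs_Re_le_cmod[of "\<theta> * \<alpha> i * z"] \<theta> by (simp add: norm_mult)
      also have "\<dots> \<le> a i * (1 + (cmod z)\<^sup>2)"
        unfolding a_def using s by (intro mult_left_mono le_one_plus_square) auto
      finally show "\<bar>f i \<omega> z\<bar> \<le> a i * (1 + (cmod z)\<^sup>2)" .
    next
      fix i assume "i < m"
      then have "s * cmod (\<alpha> i) \<le> s * v" using s \<alpha> by (intro mult_left_mono) auto
      then show "0 \<le> a i \<and> a i \<le> 1 / (2 * K\<^sup>2)" using s V by (simp add: a_def s_def s0_def)
    next
      fix i \<omega>
      show "(LINT z|\<xi>. f i \<omega> z) = 0" unfolding f_def using integrable_id integral_id by simp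
    qed (auto simp: f_def)
    also have "\<dots> \<le> ennreal (exp (mgf_const K * s0\<^sup>2))"
    proof -
      have "(\<Sum>i<m. (a i)\<^sup>2) = s\<^sup>2 * (\<Sum>i<m. (cmod (\<alpha> i))\<^sup>2)"
        by (simp add: a_def power_mult_distrib sum_distrib_left)
      also have "\<dots> \<le> s\<^sup>2 * v\<^sup>2" using V by (intro mult_left_mono) auto
      also have "\<dots> = s0\<^sup>2" using V by (simp add: s_def power_divide)
      finally have "mgf_const K * (\<Sum>i<m. (a i)\<^sup>2) \<le> mgf_const K * s0\<^sup>2"
        by (intro mult_left_mono) (auto simp: mgf_const_def)
      then show ?thesis by (intro ennreal_leI) simp
    qed
    finally show "(\<integral>\<^sup>+\<omega>. ennreal (exp (Re (\<theta> * (\<Sum>i<m. \<alpha> i * \<omega> i)))) \<partial>PX {..<m}) \<le> ennreal (exp (mgf_const K * s0\<^sup>2))"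
      by (simp add: f_def sum_distrib_left mult.assoc)
  qed (use s in auto)
  also have "s * (\<tau> * v) / 2 = \<tau> / (4 * K\<^sup>2)" using V by (simp add: s_def s0_def)
  finally show ?thesis by (simp add: tail_def s0_def)
qed

text \<open>The increment at coordinate i consists of a diagonal fluctuation and of \<omega>_i and
  its conjugate times two linear forms in earlier coordinates. These forms are unbounded, so the
  increment is truncated where they exceed T. The truncation looks only at earlier coordinates, so
  adaptedness and mean zero survive, and \<open>linear_tail\<close> shows that it is rarely active.
  One factor \<tau> comes from T and the other from the Chernoff bound.\<close>

lemma quadratic_tail:
  fixes R :: "nat \<Rightarrow> nat \<Rightarrow> complex" and b :: "nat \<Rightarrow> real"
  assumes rows: "\<And>i. i < m \<Longrightarrow> (\<Sum>k<m. (cmod (R i k))\<^sup>2) \<le> \<rho>\<^sup>2"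
    and cols: "\<And>i. i < m \<Longrightarrow> (\<Sum>k<m. (cmod (R k i))\<^sup>2) \<le> \<rho>\<^sup>2"
    and b: "\<And>i. i < m \<Longrightarrow> 0 \<le> b i \<and> b i \<le> \<beta>" "(\<Sum>i<m. (b i)\<^sup>2) \<le> 1"
    and pos: "0 < \<rho>" "0 < \<beta>" "1 \<le> \<tau>"
  shows "emeasure (PX {..<m}) {\<omega> \<in> space (PX {..<m}). 3 * \<tau>\<^sup>2 * (\<beta> * \<rho>) <
      cmod ((\<Sum>i<m. \<Sum>k<m. cnj (complex_of_real (b i) * \<omega> i) * R i k * (complex_of_real (b k) * \<omega> k)) - (\<Sum>i<m. complex_of_real ((b i)\<^sup>2) * R i i))}
    \<le> ennreal ((2 * real m + 1) * tail \<tau>)"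
proof -
  let ?P = "PX {..<m}"
  define v where "v = \<beta> * \<rho>"
  have v: "v > 0" using pos by (simp add: v_def)
  define T where "T = \<tau> * v"
  have T: "T > 0" "v \<le> T" using v pos by (auto simp: T_def)
  define S where "S = (\<lambda>i (\<omega> :: nat \<Rightarrow> complex). \<Sum>k<i. R i k * b k * \<omega> k)"
  define S' where "S' = (\<lambda>i (\<omega> :: nat \<Rightarrow> complex). \<Sum>k<i. R k i * b k * cnj (\<omega> k))"
  define F where "F = (\<lambda>\<omega> :: nat \<Rightarrow> complex. (\<Sum>i<m. \<Sum>k<m. cnj (complex_of_real (b i) * \<omega> i) * R i k * (complex_of_real (b k) * \<omega> k)) - (\<Sum>i<m. complex_of_real ((b i)\<^sup>2) * R i i))"
  define g where "g = (\<lambda>i \<omega> z. complex_of_real ((b i)\<^sup>2) * R i i * (complex_of_real ((cmod z)\<^sup>2) - 1)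
     + (if cmod (S i \<omega>) \<le> T \<and> cmod (S' i \<omega>) \<le> T then b i * (cnj z * S i \<omega> + z * S' i \<omega>) else 0))"
  have cnjm [measurable]: "cnj \<in> borel_measurable borel"
    by (intro borel_measurable_continuous_onI continuous_intros)
  have SM: "S i \<in> borel_measurable (PX {..<m'})" "S' i \<in> borel_measurable (PX {..<m'})" if "i < m'" for i m'
  proof -
    have c: "(\<lambda>\<omega>. \<omega> k) \<in> borel_measurable (PX {..<m'})" if "k < i" for k
      using that \<open>i < m'\<close> by (intro measurable_PX_component) auto
    have c': "(\<lambda>\<omega>. cnj (\<omega> k)) \<in> borel_measurable (PX {..<m'})" if "k < i" for k
      by (rule measurable_compose[OF c[OF that] cnjm])
    show "S i \<in> borel_measurable (PX {..<m'})"
      unfolding S_def by (intro borel_measurable_sum borel_measurable_times borel_measurable_const c) auto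
    show "S' i \<in> borel_measurable (PX {..<m'})"
      unfolding S'_def by (intro borel_measurable_sum borel_measurable_times borel_measurable_const c') auto
  qed
  have gm: "(\<lambda>\<omega>. g i \<omega> (\<omega> i)) \<in> borel_measurable (PX {..<m'})" if "i < m'" for i m'
  proof -
    have c: "(\<lambda>\<omega>. \<omega> i) \<in> borel_measurable (PX {..<m'})"
      using that by (intro measurable_PX_component) auto
    show ?thesis unfolding g_def
      by (intro borel_measurable_add borel_measurable_times borel_measurable_diff borel_measurable_const
            measurable_compose[OF _ borel_measurable_of_real] borel_measurable_power measurable_compose[OF _ borel_measurable_norm] measurable_If c
            measurable_compose[OF c cnjm] SM[OF that] sets.sets_Collect_conj borel_measurable_le)
  qed
  have Fg: "F \<omega> = (\<Sum>i<m. g i \<omega> (\<omega> i))" if "\<And>i. i < m \<Longrightarrow> cmod (S i \<omega>) \<le> T \<and> cmod (S' i \<omega>) \<le> T" for \<omega>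
  proof -
    have "F \<omega> = (\<Sum>i<m. (cnj (complex_of_real (b i) * \<omega> i) * R i i * (complex_of_real (b i) * \<omega> i) - complex_of_real ((b i)\<^sup>2) * R i i)
       + (\<Sum>k<i. cnj (complex_of_real (b i) * \<omega> i) * R i k * (complex_of_real (b k) * \<omega> k) + cnj (complex_of_real (b k) * \<omega> k) * R k i * (complex_of_real (b i) * \<omega> i)))"
      unfolding F_def double_sum_triangle by (simp add: sum.distrib sum_subtractf)
    also have "\<dots> = (\<Sum>i<m. g i \<omega> (\<omega> i))"
    proof (intro sum.cong refl arg_cong2[where f = "(+)"])
      fix i assume "i \<in> {..<m}"
      then have "(if cmod (S i \<omega>) \<le> T \<and> cmod (S' i \<omega>) \<le> T then b i * (cnj (\<omega> i) * S i \<omega> + \<omega> i * S' i \<omega>) else 0)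
         = b i * (cnj (\<omega> i) * S i \<omega> + \<omega> i * S' i \<omega>)" using that[of i] by simp
      moreover have "(\<Sum>k<i. cnj (complex_of_real (b i) * \<omega> i) * R i k * (complex_of_real (b k) * \<omega> k) + cnj (complex_of_real (b k) * \<omega> k) * R k i * (complex_of_real (b i) * \<omega> i))
         = b i * (cnj (\<omega> i) * S i \<omega> + \<omega> i * S' i \<omega>)"
        by (simp add: S_def S'_def sum.distrib sum_distrib_left distrib_left mult_ac)
      moreover have "cnj (complex_of_real (b i) * \<omega> i) * R i i * (complex_of_real (b i) * \<omega> i) - complex_of_real ((b i)\<^sup>2) * R i i
         = complex_of_real ((b i)\<^sup>2) * R i i * (complex_of_real ((cmod (\<omega> i))\<^sup>2) - 1)"
        unfolding complex_norm_square by (simp add: power2_eq_square algebra_simps)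
      ultimately show "cnj (complex_of_real (b i) * \<omega> i) * R i i * (complex_of_real (b i) * \<omega> i) - complex_of_real ((b i)\<^sup>2) * R i i
        + (\<Sum>k<i. cnj (complex_of_real (b i) * \<omega> i) * R i k * (complex_of_real (b k) * \<omega> k) + cnj (complex_of_real (b k) * \<omega> k) * R k i * (complex_of_real (b i) * \<omega> i))
        = g i \<omega> (\<omega> i)" unfolding g_def by simp
    qed
    finally show ?thesis .
  qed
  define s0 where "s0 = 1 / (2 * K\<^sup>2)"
  have s0: "s0 > 0" using K by (simp add: s0_def)
  \<comment> \<open>An increment is at most (T + 2 T) b_i (1 + |z|^2), from the diagonal and the two
    linear parts. This scale gives coefficients s0 b_i, whose squares sum to at most s0^2.\<close>
  define s where "s = s0 / (3 * T)"
  have s: "s > 0" using s0 T by (simp add: s_def)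
  have main: "emeasure ?P {\<omega> \<in> space ?P. 3 * \<tau> * T < cmod (\<Sum>i<m. g i \<omega> (\<omega> i))} \<le> ennreal (tail \<tau>)"
  proof -
    have "emeasure ?P {\<omega> \<in> space ?P. 3 * \<tau> * T < cmod (\<Sum>i<m. g i \<omega> (\<omega> i))}
      \<le> ennreal (4 * (exp (mgf_const K * s0\<^sup>2) * exp (- (s * (3 * \<tau> * T) / 2))))"
    proof (rule emeasure_complex_tail)
      show "(\<lambda>\<omega>. \<Sum>i<m. g i \<omega> (\<omega> i)) \<in> borel_measurable ?P"
        by (intro borel_measurable_sum gm) auto
      show "0 \<le> s" using s by simp
      show "0 \<le> exp (mgf_const K * s0\<^sup>2)" by simp
    next
      fix \<theta> assume \<theta>: "cmod \<theta> = s"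
      define a where "a = (\<lambda>i. s0 * b i)"
      have "(\<integral>\<^sup>+\<omega>. ennreal (exp (\<Sum>i<m. Re (\<theta> * g i \<omega> (\<omega> i)))) \<partial>?P) \<le> ennreal (exp (mgf_const K * (\<Sum>i<m. (a i)\<^sup>2)))"
      proof (rule mgf_adapted_sum)
        fix i m' assume "i < m'" "m' \<le> m"
        then show "(\<lambda>\<omega>. Re (\<theta> * g i \<omega> (\<omega> i))) \<in> borel_measurable (PX {..<m'})"
          by (intro measurable_compose[OF _ borel_measurable_Re] borel_measurable_times borel_measurable_const gm)
      next
        fix i \<omega> assume "i < m"
        show "(\<lambda>z. Re (\<theta> * g i \<omega> z)) \<in> borel_measurable borel"
          unfolding g_def
          by (intro measurable_compose[OF _ borel_measurable_Re] borel_measurable_add borel_measurable_times borel_measurable_diff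
            borel_measurable_const measurable_compose[OF _ borel_measurable_of_real] borel_measurable_power measurable_compose[OF _ borel_measurable_norm]
            measurable_If cnjm measurable_ident_sets[OF refl] sets.sets_Collect_conj borel_measurable_le)
      next
        fix i and \<omega> \<omega>' :: "nat \<Rightarrow> complex" assume "\<And>k. k < i \<Longrightarrow> \<omega> k = \<omega>' k"
        then have "S i \<omega> = S i \<omega>'" "S' i \<omega> = S' i \<omega>'" by (simp_all add: S_def S'_def)
        then show "(\<lambda>z. Re (\<theta> * g i \<omega> z)) = (\<lambda>z. Re (\<theta> * g i \<omega>' z))" by (simp only: g_def)
      next
        fix i \<omega>
        define c where "c = \<theta> * (complex_of_real ((b i)\<^sup>2) * R i i)"
        define d where "d = (if cmod (S i \<omega>) \<le> T \<and> cmod (S' i \<omega>) \<le> T then \<theta> * b i * S' i \<omega> else 0)"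
        \<comment> \<open>Conjugating the part in cnj z does not change its real part, so the first
          moment of z alone shows that the mean vanishes.\<close>
        define e where "e = (if cmod (S i \<omega>) \<le> T \<and> cmod (S' i \<omega>) \<le> T then cnj (\<theta> * b i * S i \<omega>) else 0)"
        have "Re (\<theta> * g i \<omega> z) = Re c * ((cmod z)\<^sup>2 - 1) + Re (d * z) + Re (e * z)" for z
        proof -
          have "\<theta> * g i \<omega> z = c * complex_of_real ((cmod z)\<^sup>2 - 1) + d * z + cnj (e * z)"
            by (simp add: g_def c_def d_def e_def algebra_simps)
          then show ?thesis by (simp del: complex_cnj_mult)
        qed
        then show "(LINT z|\<xi>. Re (\<theta> * g i \<omega> z)) = 0"
          using integrable_id integral_id integrable_square integral_square prob_space by simp
      next
        fix i \<omega> z assume i: "i < m"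
        let ?w = "1 + (cmod z)\<^sup>2"
        have Rii: "cmod (R i i) \<le> \<rho>"
        proof -
          have "(cmod (R i i))\<^sup>2 \<le> (\<Sum>k<m. (cmod (R i k))\<^sup>2)" using i by (intro member_le_sum) auto
          then have "(cmod (R i i))\<^sup>2 \<le> \<rho>\<^sup>2" using rows[OF i] by linarith
          then show ?thesis using pos by (simp add: power2_le_iff_abs_le)
        qed
        have bi: "0 \<le> b i" "b i \<le> \<beta>" using b(1)[OF i] by auto
        have "cmod (complex_of_real ((b i)\<^sup>2) * R i i * (complex_of_real ((cmod z)\<^sup>2) - 1)) = b i * (b i * cmod (R i i)) * \<bar>(cmod z)\<^sup>2 - 1\<bar>"
        proof -
          have "cmod (complex_of_real ((cmod z)\<^sup>2) - 1) = \<bar>(cmod z)\<^sup>2 - 1\<bar>"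
            by (metis norm_of_real of_real_1 of_real_diff)
          then show ?thesis using bi by (simp add: norm_mult norm_power power2_eq_square mult_ac)
        qed
        also have "\<dots> \<le> b i * (\<beta> * \<rho>) * ?w"
          using bi Rii pos by (intro mult_mono) (auto simp: abs_le_iff intro: add_nonneg_nonneg)
        also have "\<dots> \<le> b i * T * ?w"
          using bi T by (intro mult_right_mono mult_left_mono) (auto simp: v_def)
        finally have 1: "cmod (complex_of_real ((b i)\<^sup>2) * R i i * (complex_of_real ((cmod z)\<^sup>2) - 1)) \<le> b i * T * ?w" .
        have 2: "cmod (if cmod (S i \<omega>) \<le> T \<and> cmod (S' i \<omega>) \<le> T then b i * (cnj z * S i \<omega> + z * S' i \<omega>) else 0) \<le> b i * (2 * T) * ?w"
        proof (cases "cmod (S i \<omega>) \<le> T \<and> cmod (S' i \<omega>) \<le> T")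
          case True
          have "cmod (cnj z * S i \<omega> + z * S' i \<omega>) \<le> cmod z * cmod (S i \<omega>) + cmod z * cmod (S' i \<omega>)"
            by (rule order_trans[OF norm_triangle_ineq]) (simp add: norm_mult)
          also have "\<dots> \<le> ?w * T + ?w * T"
            using True T le_one_plus_square[of z] by (intro add_mono mult_mono) auto
          finally have "b i * cmod (cnj z * S i \<omega> + z * S' i \<omega>) \<le> b i * (?w * T + ?w * T)"
            using bi by (intro mult_left_mono) auto
          moreover have "cmod (complex_of_real (b i) * (cnj z * S i \<omega> + z * S' i \<omega>)) = b i * cmod (cnj z * S i \<omega> + z * S' i \<omega>)"
            using bi by (simp only: norm_mult norm_of_real abs_of_nonneg)
          moreover have "b i * (?w * T + ?w * T) = b i * (2 * T) * ?w" by (simp add: algebra_simps)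
          ultimately show ?thesis by (simp only: True if_True simp_thms)
        next
          case False
          then show ?thesis using bi T by (auto intro!: mult_nonneg_nonneg add_nonneg_nonneg)
        qed
        have "cmod (g i \<omega> z) \<le> b i * T * ?w + b i * (2 * T) * ?w"
          unfolding g_def by (rule order_trans[OF norm_triangle_ineq add_mono[OF 1 2]])
        then have "s * cmod (g i \<omega> z) \<le> s * (b i * T * ?w + b i * (2 * T) * ?w)"
          using s by (intro mult_left_mono) auto
        also have "\<dots> = (s * (3 * T)) * b i * ?w" by (simp add: algebra_simps)
        also have "s * (3 * T) = s0" using T by (simp add: s_def)
        finally have "s * cmod (g i \<omega> z) \<le> a i * ?w" by (simp add: a_def)
        moreover have "\<bar>Re (\<theta> * g i \<omega> z)\<bar> \<le> s * cmod (g i \<omega> z)"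
          using abs_Re_le_cmod[of "\<theta> * g i \<omega> z"] \<theta> by (simp add: norm_mult)
        ultimately show "\<bar>Re (\<theta> * g i \<omega> z)\<bar> \<le> a i * ?w" by linarith
      next
        fix i assume i: "i < m"
        have "(b i)\<^sup>2 \<le> (\<Sum>i<m. (b i)\<^sup>2)" using i by (intro member_le_sum) auto
        then have "(b i)\<^sup>2 \<le> 1\<^sup>2" using b(2) by simp
        then have "b i \<le> 1" by (rule power2_le_imp_le) simp
        then have "s0 * b i \<le> s0 * 1" using s0 by (intro mult_left_mono) auto
        then show "0 \<le> a i \<and> a i \<le> 1 / (2 * K\<^sup>2)" using s0 b(1)[OF i] by (simp add: a_def s0_def)
      qed
      also have "\<dots> \<le> ennreal (exp (mgf_const K * s0\<^sup>2))"
      proof -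
        have "(\<Sum>i<m. (a i)\<^sup>2) = s0\<^sup>2 * (\<Sum>i<m. (b i)\<^sup>2)"
          by (simp add: a_def power_mult_distrib sum_distrib_left)
        also have "\<dots> \<le> s0\<^sup>2 * 1" using b(2) by (intro mult_left_mono) auto
        finally have "mgf_const K * (\<Sum>i<m. (a i)\<^sup>2) \<le> mgf_const K * s0\<^sup>2"
          by (intro mult_left_mono) (auto simp: mgf_const_def)
        then show ?thesis by (intro ennreal_leI) simp
      qed
      finally show "(\<integral>\<^sup>+\<omega>. ennreal (exp (Re (\<theta> * (\<Sum>i<m. g i \<omega> (\<omega> i))))) \<partial>?P) \<le> ennreal (exp (mgf_const K * s0\<^sup>2))"
        by (simp add: sum_distrib_left)
    qed
    also have "s * (3 * \<tau> * T) / 2 = \<tau> / (4 * K\<^sup>2)" using T by (simp add: s_def s0_def)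
    finally show ?thesis by (simp add: tail_def s0_def)
  qed
  have lin: "emeasure ?P {\<omega> \<in> space ?P. T < cmod (S i \<omega>)} \<le> ennreal (tail \<tau>)"
            "emeasure ?P {\<omega> \<in> space ?P. T < cmod (S' i \<omega>)} \<le> ennreal (tail \<tau>)" if i: "i < m" for i
  proof -
    have bd: "(\<Sum>k<m. (cmod (if k < i then r k * b k else 0))\<^sup>2) \<le> v\<^sup>2"
      if r: "(\<Sum>k<m. (cmod (r k))\<^sup>2) \<le> \<rho>\<^sup>2" for r :: "nat \<Rightarrow> complex"
    proof -
      have "(\<Sum>k<m. (cmod (if k < i then r k * b k else 0))\<^sup>2) \<le> (\<Sum>k<m. (cmod (r k))\<^sup>2 * \<beta>\<^sup>2)"
      proof (rule sum_mono)
        fix k assume "k \<in> {..<m}"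
        then have "\<bar>b k\<bar> \<le> \<beta>" using b(1)[of k] by auto
        then have "(b k)\<^sup>2 \<le> \<beta>\<^sup>2" by (metis abs_ge_zero power2_abs power_mono)
        then show "(cmod (if k < i then r k * b k else 0))\<^sup>2 \<le> (cmod (r k))\<^sup>2 * \<beta>\<^sup>2"
          by (auto simp: norm_mult power_mult_distrib intro: mult_left_mono)
      qed
      also have "\<dots> \<le> \<rho>\<^sup>2 * \<beta>\<^sup>2" unfolding sum_distrib_right[symmetric] using r by (intro mult_right_mono) auto
      finally show ?thesis by (simp add: v_def power_mult_distrib mult.commute)
    qed
    have cut: "(\<Sum>k<m. (if k < i then r k * b k else 0) * \<omega> k) = (\<Sum>k<i. r k * b k * \<omega> k)"
      for r \<omega> :: "nat \<Rightarrow> complex"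
      using i by (intro sum.mono_neutral_cong_right) auto
    show "emeasure ?P {\<omega> \<in> space ?P. T < cmod (S i \<omega>)} \<le> ennreal (tail \<tau>)"
      using linear_tail[OF bd[OF rows[OF i]] v, of \<tau>] unfolding cut by (simp add: S_def T_def)
    have "(\<Sum>k<m. (cmod (cnj (R k i)))\<^sup>2) \<le> \<rho>\<^sup>2" using cols[OF i] by simp
    from linear_tail[OF bd[OF this] v, of \<tau>]
    have "emeasure ?P {\<omega> \<in> space ?P. T < cmod (\<Sum>k<i. cnj (R k i) * b k * \<omega> k)} \<le> ennreal (tail \<tau>)"
      unfolding cut by (simp add: T_def)
    moreover have "cmod (S' i \<omega>) = cmod (\<Sum>k<i. cnj (R k i) * b k * \<omega> k)" for \<omega>
    proof -
      have "cnj (S' i \<omega>) = (\<Sum>k<i. cnj (R k i) * b k * \<omega> k)" by (simp add: S'_def)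
      then show ?thesis by (metis complex_mod_cnj)
    qed
    ultimately show "emeasure ?P {\<omega> \<in> space ?P. T < cmod (S' i \<omega>)} \<le> ennreal (tail \<tau>)" by simp
  qed
  let ?E = "{\<omega> \<in> space ?P. 3 * \<tau> * T < cmod (\<Sum>i<m. g i \<omega> (\<omega> i))}"
  let ?A = "\<lambda>i. {\<omega> \<in> space ?P. T < cmod (S i \<omega>)} \<union> {\<omega> \<in> space ?P. T < cmod (S' i \<omega>)}"
  have mE: "?E \<in> sets ?P"
    by (intro borel_measurable_less borel_measurable_const measurable_compose[OF _ borel_measurable_norm] borel_measurable_sum gm) auto
  have mA1: "{\<omega> \<in> space ?P. T < cmod (S i \<omega>)} \<in> sets ?P" if "i < m" for i
    by (intro borel_measurable_less borel_measurable_const measurable_compose[OF _ borel_measurable_norm] SM[OF that])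
  have mA2: "{\<omega> \<in> space ?P. T < cmod (S' i \<omega>)} \<in> sets ?P" if "i < m" for i
    by (intro borel_measurable_less borel_measurable_const measurable_compose[OF _ borel_measurable_norm] SM[OF that])
  have mU: "(\<Union>i<m. ?A i) \<in> sets ?P" by (intro sets.finite_UN sets.Un mA1 mA2) auto
  have eqT: "3 * \<tau>\<^sup>2 * (\<beta> * \<rho>) = 3 * \<tau> * T" by (simp add: T_def v_def power2_eq_square)
  have "{\<omega> \<in> space ?P. 3 * \<tau>\<^sup>2 * (\<beta> * \<rho>) < cmod (F \<omega>)} \<subseteq> ?E \<union> (\<Union>i<m. ?A i)"
  proof (rule subsetI, rule ccontr)
    fix \<omega> assume \<omega>: "\<omega> \<in> {\<omega> \<in> space ?P. 3 * \<tau>\<^sup>2 * (\<beta> * \<rho>) < cmod (F \<omega>)}" "\<omega> \<notin> ?E \<union> (\<Union>i<m. ?A i)"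
    then have "F \<omega> = (\<Sum>i<m. g i \<omega> (\<omega> i))" by (intro Fg) (simp add: not_less)
    with \<omega> eqT show False by simp
  qed
  then have "emeasure ?P {\<omega> \<in> space ?P. 3 * \<tau>\<^sup>2 * (\<beta> * \<rho>) < cmod (F \<omega>)} \<le> emeasure ?P (?E \<union> (\<Union>i<m. ?A i))"
    by (rule emeasure_mono[OF _ sets.Un[OF mE mU]])
  also have "\<dots> \<le> emeasure ?P ?E + emeasure ?P (\<Union>i<m. ?A i)"
    by (rule emeasure_subadditive[OF mE mU])
  also have "emeasure ?P (\<Union>i<m. ?A i) \<le> (\<Sum>i<m. emeasure ?P (?A i))"
    by (intro emeasure_subadditive_finite image_subsetI sets.Un mA1 mA2) auto
  also have "\<dots> \<le> (\<Sum>i<m. ennreal (tail \<tau>) + ennreal (tail \<tau>))"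
    by (intro sum_mono order_trans[OF emeasure_subadditive] add_mono lin mA1 mA2) auto
  also have "\<dots> = ennreal (2 * real m * tail \<tau>)"
    using tail_nonneg by (simp add: ennreal_plus[symmetric] ennreal_of_nat_eq_real_of_nat ennreal_mult[symmetric] mult_ac del: ennreal_plus)
  also have "emeasure ?P ?E + ennreal (2 * real m * tail \<tau>) \<le> ennreal (tail \<tau>) + ennreal (2 * real m * tail \<tau>)"
    by (intro add_right_mono main)
  also have "\<dots> = ennreal ((2 * real m + 1) * tail \<tau>)"
    using tail_nonneg by (simp add: ennreal_plus[symmetric] algebra_simps del: ennreal_plus)
  finally show ?thesis by (simp add: F_def add_left_mono)
qed

end

section \<open>Minors of a random matrix\<close>

lemma gram_cong:
  assumes "\<And>i k. i < n \<Longrightarrow> k < n \<Longrightarrow> Y i k = Y' i k" "i < n" "k < n"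
  shows "gram n \<eta> Y i k = gram n \<eta> Y' i k"
  using assms by (simp add: gram_def)

lemma res_cong:
  assumes "\<And>i k. i < n \<Longrightarrow> k < n \<Longrightarrow> Y i k = Y' i k"
  shows "res n \<eta> Y = res n \<eta> Y'"
proof -
  have "mat n n (\<lambda>(i, k). gram n \<eta> Y i k) = mat n n (\<lambda>(i, k). gram n \<eta> Y' i k)"
    using gram_cong[OF assms] by (intro cong_mat) auto
  then show ?thesis by (simp add: res_def fun_eq_iff)
qed

text \<open>Allows a matrix to be replaced by its restriction to the index square, the form in which
  a product measure delivers it.\<close>

lemma good_cong:
  assumes eq: "\<And>i k. i < n \<Longrightarrow> k < n \<Longrightarrow> X i k = X' i k" and j: "j < n"
  shows "good n \<eta> b X z j \<longleftrightarrow> good n \<eta> b X' z j"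
proof -
  have "res n \<eta> (col_minor z j X) = res n \<eta> (col_minor z j X')"
    "res n \<eta> (row_col_minor z j X) = res n \<eta> (row_col_minor z j X')"
    by (intro res_cong; simp add: col_minor_def row_col_minor_def zero_col_def zero_row_def adj_def sub_scalar_def eq)+
  moreover have "sesq n R (\<lambda>i. X i j) = sesq n R (\<lambda>i. X' i j)"
    "(\<Sum>k<n. R j k * X k j) = (\<Sum>k<n. R j k * X' k j)"
    "sesq n R (\<lambda>k. if k = j then 0 else cnj (X j k)) = sesq n R (\<lambda>k. if k = j then 0 else cnj (X' j k))" for R
    unfolding sesq_def using j by (intro sum.cong refl; simp add: eq)+
  ultimately show ?thesis by (simp only: good_def)
qed

lemma borel_measurable_cnj_compose:
  assumes "f \<in> borel_measurable M"
  shows "(\<lambda>x. cnj (f x)) \<in> borel_measurable M"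
  by (rule measurable_compose[OF assms borel_measurable_continuous_onI[OF continuous_on_cnj[OF continuous_on_id]]])

lemma borel_measurable_det:
  fixes A :: "'a \<Rightarrow> nat \<Rightarrow> nat \<Rightarrow> complex"
  assumes "\<And>i k. i < n \<Longrightarrow> k < n \<Longrightarrow> (\<lambda>\<omega>. A \<omega> i k) \<in> borel_measurable M"
  shows "(\<lambda>\<omega>. det (mat n n (\<lambda>(i, k). A \<omega> i k))) \<in> borel_measurable M"
proof -
  have "det (mat n n (\<lambda>(i, k). A \<omega> i k)) =
      (\<Sum>p | p permutes {0..<n}. signof p * (\<Prod>i = 0..<n. A \<omega> i (p i)))" for \<omega>
  proof -
    have "det (mat n n (\<lambda>(i, k). A \<omega> i k)) =
      (\<Sum>p | p permutes {0..<n}. signof p * (\<Prod>i = 0..<n. mat n n (\<lambda>(i, k). A \<omega> i k) $$ (i, p i)))"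
      by (rule det_def'[where n = n]) simp
    also have "\<dots> = (\<Sum>p | p permutes {0..<n}. signof p * (\<Prod>i = 0..<n. A \<omega> i (p i)))"
      by (intro sum.cong refl arg_cong2[where f = "(*)"] prod.cong) (auto simp: permutes_in_image)
    finally show ?thesis .
  qed
  moreover have "(\<lambda>\<omega>. \<Sum>p | p permutes {0..<n}. signof p * (\<Prod>i = 0..<n. A \<omega> i (p i))) \<in> borel_measurable M"
  proof (intro borel_measurable_sum borel_measurable_times borel_measurable_const borel_measurable_prod)
    fix p i assume "p \<in> {p. p permutes {0..<n}}" "i \<in> {0..<n}"
    then have "i < n" "p i < n" using permutes_in_image[of p "{0..<n}" i] by auto
    then show "(\<lambda>\<omega>. A \<omega> i (p i)) \<in> borel_measurable M" by (rule assms)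
  qed
  ultimately show ?thesis by simp
qed

lemma borel_measurable_res:
  assumes Y: "\<And>i k. i < n \<Longrightarrow> k < n \<Longrightarrow> (\<lambda>\<omega>. Y \<omega> i k) \<in> borel_measurable M" and ik: "i < n" "k < n"
  shows "(\<lambda>\<omega>. res n \<eta> (Y \<omega>) i k) \<in> borel_measurable M"
proof -
  have g: "(\<lambda>\<omega>. gram n \<eta> (Y \<omega>) i k) \<in> borel_measurable M" if "i < n" "k < n" for i k
    unfolding gram_def using that Y
    by (intro borel_measurable_add borel_measurable_sum borel_measurable_times
        borel_measurable_cnj_compose borel_measurable_const) auto
  have "adj_mat (mat n n (\<lambda>(i, k). gram n \<eta> (Y \<omega>) i k)) $$ (i, k)
     = (-1) ^ (k + i) * det (mat (n - 1) (n - 1)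
          (\<lambda>(r, c). gram n \<eta> (Y \<omega>) (if r < k then r else Suc r) (if c < i then c else Suc c)))" for \<omega>
  proof -
    have "mat_delete (mat n n (\<lambda>(i, k). gram n \<eta> (Y \<omega>) i k)) k i = mat (n - 1) (n - 1)
          (\<lambda>(r, c). gram n \<eta> (Y \<omega>) (if r < k then r else Suc r) (if c < i then c else Suc c))"
      unfolding mat_delete_def by (intro eq_matI) auto
    then show ?thesis using ik by (simp add: adj_mat_def cofactor_def)
  qed
  moreover have "(\<lambda>\<omega>. (-1) ^ (k + i) * det (mat (n - 1) (n - 1)
          (\<lambda>(r, c). gram n \<eta> (Y \<omega>) (if r < k then r else Suc r) (if c < i then c else Suc c)))) \<in> borel_measurable M"
    by (intro borel_measurable_times borel_measurable_const borel_measurable_det g) auto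
  ultimately show ?thesis unfolding res_def
    by (intro borel_measurable_divide borel_measurable_det g) auto
qed

lemma measurable_minors:
  assumes Y: "\<And>i k. i < n \<Longrightarrow> k < n \<Longrightarrow> (\<lambda>\<omega>. X \<omega> i k) \<in> borel_measurable M" and ik: "i < n" "k < n"
  shows "(\<lambda>\<omega>. res n \<eta> (col_minor z j (X \<omega>)) i k) \<in> borel_measurable M"
    "(\<lambda>\<omega>. res n \<eta> (row_col_minor z j (X \<omega>)) i k) \<in> borel_measurable M"
proof -
  have s: "(\<lambda>\<omega>. sub_scalar z (X \<omega>) i k) \<in> borel_measurable M" if "i < n" "k < n" for i k
    unfolding sub_scalar_def using that by (intro borel_measurable_diff Y borel_measurable_const)
  have c: "(\<lambda>\<omega>. col_minor z j (X \<omega>) i k) \<in> borel_measurable M" if "i < n" "k < n" for i k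
    using s[OF that] by (cases "k = j") (simp_all add: col_minor_def zero_col_def)
  have r: "(\<lambda>\<omega>. row_col_minor z j (X \<omega>) i k) \<in> borel_measurable M" if "i < n" "k < n" for i k
  proof (cases "i = j \<or> k = j")
    case True
    then have "row_col_minor z j (X \<omega>) i k = 0" for \<omega>
      by (auto simp: row_col_minor_def zero_col_def zero_row_def adj_def)
    then show ?thesis by simp
  next
    case False
    then show ?thesis using borel_measurable_cnj_compose[OF s[OF that(2,1)]]
      by (simp add: row_col_minor_def zero_col_def zero_row_def adj_def)
  qed
  show "(\<lambda>\<omega>. res n \<eta> (col_minor z j (X \<omega>)) i k) \<in> borel_measurable M"
    using c ik by (intro borel_measurable_res) auto
  show "(\<lambda>\<omega>. res n \<eta> (row_col_minor z j (X \<omega>)) i k) \<in> borel_measurable M"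
    using r ik by (intro borel_measurable_res) auto
qed

definition col_dev :: "nat \<Rightarrow> real \<Rightarrow> (nat \<Rightarrow> nat \<Rightarrow> real) \<Rightarrow> (nat \<Rightarrow> nat \<Rightarrow> complex) \<Rightarrow> complex \<Rightarrow> nat \<Rightarrow> complex" where
  "col_dev n \<eta> b X z j = sesq n (res n \<eta> (col_minor z j X)) (\<lambda>i. X i j)
       - (\<Sum>i<n. complex_of_real ((b i j)\<^sup>2) * res n \<eta> (col_minor z j X) i i)"

definition lin_dev :: "nat \<Rightarrow> real \<Rightarrow> (nat \<Rightarrow> nat \<Rightarrow> complex) \<Rightarrow> complex \<Rightarrow> nat \<Rightarrow> complex" where
  "lin_dev n \<eta> X z j = (\<Sum>k<n. res n \<eta> (col_minor z j X) j k * X k j)"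

definition row_dev :: "nat \<Rightarrow> real \<Rightarrow> (nat \<Rightarrow> nat \<Rightarrow> real) \<Rightarrow> (nat \<Rightarrow> nat \<Rightarrow> complex) \<Rightarrow> complex \<Rightarrow> nat \<Rightarrow> complex" where
  "row_dev n \<eta> b X z j = sesq n (res n \<eta> (row_col_minor z j X)) (\<lambda>k. if k = j then 0 else cnj (X j k))
       - (\<Sum>k<n. complex_of_real ((if k = j then 0 else b j k)\<^sup>2) * res n \<eta> (row_col_minor z j X) k k)"

lemma measurable_devs:
  assumes X: "\<And>i k. i < n \<Longrightarrow> k < n \<Longrightarrow> (\<lambda>\<omega>. X \<omega> i k) \<in> borel_measurable M" and j: "j < n"
  shows "(\<lambda>\<omega>. col_dev n \<eta> b (X \<omega>) z j) \<in> borel_measurable M"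
    "(\<lambda>\<omega>. lin_dev n \<eta> (X \<omega>) z j) \<in> borel_measurable M"
    "(\<lambda>\<omega>. row_dev n \<eta> b (X \<omega>) z j) \<in> borel_measurable M"
proof -
  note m = measurable_minors[OF X]
  have x': "(\<lambda>\<omega>. if k = j then 0 else cnj (X \<omega> j k)) \<in> borel_measurable M" if "k < n" for k
    using borel_measurable_cnj_compose[OF X[OF j that]] by (cases "k = j") auto
  show "(\<lambda>\<omega>. col_dev n \<eta> b (X \<omega>) z j) \<in> borel_measurable M"
    unfolding col_dev_def sesq_def using j
    by (intro borel_measurable_diff borel_measurable_sum borel_measurable_times borel_measurable_const m X
        borel_measurable_cnj_compose) auto
  show "(\<lambda>\<omega>. lin_dev n \<eta> (X \<omega>) z j) \<in> borel_measurable M"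
    unfolding lin_dev_def using j by (intro borel_measurable_sum borel_measurable_times m X) auto
  show "(\<lambda>\<omega>. row_dev n \<eta> b (X \<omega>) z j) \<in> borel_measurable M"
    unfolding row_dev_def sesq_def using j
    by (intro borel_measurable_diff borel_measurable_sum borel_measurable_times borel_measurable_const m x'
        borel_measurable_cnj_compose) auto
qed

lemma not_good_sets:
  assumes X: "\<And>i k. i < n \<Longrightarrow> k < n \<Longrightarrow> (\<lambda>\<omega>. X \<omega> i k) \<in> borel_measurable M" and j: "j < n"
  shows "{\<omega> \<in> space M. \<not> good n \<eta> b (X \<omega>) z j} \<in> sets M"
proof -
  have "{\<omega> \<in> space M. \<not> good n \<eta> b (X \<omega>) z j} =
      {\<omega> \<in> space M. 1 / 8 < cmod (col_dev n \<eta> b (X \<omega>) z j)} \<union>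
      {\<omega> \<in> space M. 1 / 16 < cmod z * cmod (lin_dev n \<eta> (X \<omega>) z j)} \<union>
      {\<omega> \<in> space M. 1 / 8 < cmod (row_dev n \<eta> b (X \<omega>) z j)}"
    by (auto simp: good_def col_dev_def lin_dev_def row_dev_def not_le)
  also have "\<dots> \<in> sets M"
    by (intro sets.Un borel_measurable_less borel_measurable_const borel_measurable_times
        measurable_compose[OF _ borel_measurable_norm] measurable_devs X j)
  finally show ?thesis .
qed

section \<open>Conditioning on the entries off one row or column\<close>

context subgaussian_entries
begin

lemma emeasure_PX_section:
  fixes I J :: "'i set"
  assumes IJ: "I \<inter> J = {}" "finite I" "finite J" and A: "A \<in> sets (PX (I \<union> J))"
    and le: "\<And>x. x \<in> space (PX I) \<Longrightarrow> emeasure (PX J) {y \<in> space (PX J). merge I J (x, y) \<in> A} \<le> c"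
  shows "emeasure (PX (I \<union> J)) A \<le> c"
proof -
  interpret product_sigma_finite "\<lambda>_::'i. \<xi>"
    by (simp add: product_sigma_finite_def sigma_finite_measure_axioms)
  interpret PI: prob_space "PX I" by (intro prob_space_PiM prob_space_axioms)
  have "emeasure (PX (I \<union> J)) A = (\<integral>\<^sup>+w. indicator A w \<partial>PX (I \<union> J))" using A by simp
  also have "\<dots> = (\<integral>\<^sup>+x. (\<integral>\<^sup>+y. indicator A (merge I J (x, y)) \<partial>PX J) \<partial>PX I)"
    using IJ A by (intro product_nn_integral_fold) auto
  also have "\<dots> \<le> (\<integral>\<^sup>+x. c \<partial>PX I)"
  proof (intro nn_integral_mono)
    fix x assume x: "x \<in> space (PX I)"
    have "(\<lambda>y. merge I J (x, y)) \<in> PX J \<rightarrow>\<^sub>M PX (I \<union> J)"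
      by (rule measurable_compose[OF measurable_Pair1'[OF x] measurable_merge])
    from measurable_sets[OF this A] have "{y \<in> space (PX J). merge I J (x, y) \<in> A} \<in> sets (PX J)"
      by (simp add: vimage_def Int_def conj_commute)
    then have "emeasure (PX J) {y \<in> space (PX J). merge I J (x, y) \<in> A}
      = (\<integral>\<^sup>+y. indicator {y \<in> space (PX J). merge I J (x, y) \<in> A} y \<partial>PX J)" by simp
    also have "\<dots> = (\<integral>\<^sup>+y. indicator A (merge I J (x, y)) \<partial>PX J)"
      by (intro nn_integral_cong) (auto simp: indicator_def)
    finally show "(\<integral>\<^sup>+y. indicator A (merge I J (x, y)) \<partial>PX J) \<le> c" using le[OF x] by simp
  qed
  also have "\<dots> = c" using PI.emeasure_space_1 by simp
  finally show ?thesis .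
qed

lemma emeasure_PX_reindex:
  fixes J :: "'i set" and I :: "'j set"
  assumes h: "inj_on h I" "h \<in> I \<rightarrow> J" and Q: "{w \<in> space (PX I). Q w} \<in> sets (PX I)"
  shows "emeasure (PX J) {y \<in> space (PX J). Q (\<lambda>i\<in>I. y (h i))} = emeasure (PX I) {w \<in> space (PX I). Q w}"
proof -
  let ?t = "\<lambda>y. \<lambda>i\<in>I. y (h i)"
  have t: "?t \<in> PX J \<rightarrow>\<^sub>M PX I"
    using h(2) by (intro measurable_restrict measurable_component_singleton) auto
  have "emeasure (PX I) {w \<in> space (PX I). Q w} = emeasure (distr (PX J) (PX I) ?t) {w \<in> space (PX I). Q w}"
    by (subst distr_PiM_reindex[OF _ h]) (simp_all add: prob_space_axioms)
  also have "\<dots> = emeasure (PX J) (?t -` {w \<in> space (PX I). Q w} \<inter> space (PX J))"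
    by (rule emeasure_distr[OF t Q])
  also have "?t -` {w \<in> space (PX I). Q w} \<inter> space (PX J) = {y \<in> space (PX J). Q (?t y)}"
    using measurable_space[OF t] by auto
  finally show ?thesis by simp
qed

definition scaled :: "(nat \<Rightarrow> nat \<Rightarrow> real) \<Rightarrow> (nat \<times> nat \<Rightarrow> complex) \<Rightarrow> nat \<Rightarrow> nat \<Rightarrow> complex" where
  "scaled b \<omega> = (\<lambda>i k. complex_of_real (b i k) * \<omega> (i, k))"

lemma scaled_measurable:
  assumes "i < n" "k < n"
  shows "(\<lambda>\<omega>. scaled b \<omega> i k) \<in> borel_measurable (PX ({..<n} \<times> {..<n}))"
  unfolding scaled_def using assms
  by (intro borel_measurable_times borel_measurable_const measurable_PX_component) auto

text \<open>The map \<open>h\<close> parametrises a row or a column. With the entries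
  \<open>x\<close> off that line frozen, \<open>Q x\<close> is the event seen as a condition on an
  n-vector of independent entries, where the tail bounds for fixed coefficients apply.\<close>

lemma emeasure_PX_line:
  fixes h :: "nat \<Rightarrow> nat \<times> nat"
  assumes h: "inj_on h {..<n}" "h ` {..<n} \<subseteq> {..<n} \<times> {..<n}"
    and A: "A \<in> sets (PX ({..<n} \<times> {..<n}))"
    and Q: "\<And>x w. x \<in> space (PX ({..<n} \<times> {..<n} - h ` {..<n})) \<Longrightarrow> w \<in> space (PX (h ` {..<n})) \<Longrightarrow>
        merge ({..<n} \<times> {..<n} - h ` {..<n}) (h ` {..<n}) (x, w) \<in> A \<longleftrightarrow> Q x (\<lambda>i\<in>{..<n}. w (h i))"
    and Qm: "\<And>x. {w \<in> space (PX {..<n}). Q x w} \<in> sets (PX {..<n})"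
    and le: "\<And>x. emeasure (PX {..<n}) {w \<in> space (PX {..<n}). Q x w} \<le> c"
  shows "emeasure (PX ({..<n} \<times> {..<n})) A \<le> c"
proof -
  let ?J = "h ` {..<n}" and ?I = "{..<n} \<times> {..<n} - h ` {..<n}"
  have full: "?I \<union> ?J = {..<n} \<times> {..<n}" using h by auto
  have "emeasure (PX (?I \<union> ?J)) A \<le> c"
  proof (rule emeasure_PX_section)
    fix x assume x: "x \<in> space (PX ?I)"
    have "{y \<in> space (PX ?J). merge ?I ?J (x, y) \<in> A} = {y \<in> space (PX ?J). Q x (\<lambda>i\<in>{..<n}. y (h i))}"
      using Q[OF x] by auto
    also have "emeasure (PX ?J) \<dots> = emeasure (PX {..<n}) {w \<in> space (PX {..<n}). Q x w}"
      using h by (intro emeasure_PX_reindex Qm) auto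
    finally show "emeasure (PX ?J) {y \<in> space (PX ?J). merge ?I ?J (x, y) \<in> A} \<le> c" using le[of x] by simp
  qed (use A full in auto)
  then show ?thesis unfolding full .
qed

context
  fixes n j :: nat and \<eta> \<tau> \<beta> :: real and b :: "nat \<Rightarrow> nat \<Rightarrow> real" and z :: complex
  assumes j: "j < n" and eta: "\<eta> > 0" and tau: "\<tau> \<ge> 1" and beta: "\<beta> > 0"
    and ds: "doubly_stochastic_profile n b"
    and b: "\<And>i k. i < n \<Longrightarrow> k < n \<Longrightarrow> 0 \<le> b i k \<and> b i k \<le> \<beta>"
begin

abbreviation (input) "I2 \<equiv> {..<n} \<times> {..<n}"

lemma rho_pos: "0 < 1 / \<eta>\<^sup>2" using eta by simp

lemma quadratic_form_measurable:
  "(\<lambda>w. (\<Sum>i<n. \<Sum>k<n. cnj (complex_of_real (c i) * w i) * R i k * (complex_of_real (c k) * w k)) - C) \<in> borel_measurable (PX {..<n})"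
  by (intro borel_measurable_diff borel_measurable_sum borel_measurable_times borel_measurable_const
      borel_measurable_cnj_compose measurable_PX_component) auto

lemma linear_form_measurable:
  "(\<lambda>w. \<Sum>k<n. \<alpha> k * w k) \<in> borel_measurable (PX {..<n})"
  by (intro borel_measurable_sum borel_measurable_times borel_measurable_const measurable_PX_component) auto

text \<open>The independence between the column and the minor: replacing the entries on the line
  does not change the resolvent.\<close>

lemma col_minor_merge:
  assumes "h = (\<lambda>i. (i, j))"
  shows "res n \<eta> (col_minor z j (scaled b (merge (I2 - h ` {..<n}) (h ` {..<n}) (x, w)))) = res n \<eta> (col_minor z j (scaled b x))"
  by (rule res_cong) (auto simp: assms col_minor_def zero_col_def sub_scalar_def scaled_def merge_def)

lemma row_col_minor_merge:
  assumes "h = (\<lambda>i. (j, i))"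
  shows "res n \<eta> (row_col_minor z j (scaled b (merge (I2 - h ` {..<n}) (h ` {..<n}) (x, w)))) = res n \<eta> (row_col_minor z j (scaled b x))"
  by (rule res_cong) (auto simp: assms row_col_minor_def adj_def zero_row_def zero_col_def sub_scalar_def scaled_def merge_def)

lemma col_dev_tail:
  "emeasure (PX I2) {\<omega> \<in> space (PX I2). 3 * \<tau>\<^sup>2 * (\<beta> * (1 / \<eta>\<^sup>2)) < cmod (col_dev n \<eta> b (scaled b \<omega>) z j)}
    \<le> ennreal ((2 * real n + 1) * tail \<tau>)"
proof (rule emeasure_PX_line)
  let ?h = "\<lambda>i. (i, j)"
  let ?R = "\<lambda>x. res n \<eta> (col_minor z j (scaled b x))"
  let ?F = "\<lambda>x (w :: nat \<Rightarrow> complex). (\<Sum>i<n. \<Sum>k<n. cnj (complex_of_real (b i j) * w i) * ?R x i k * (complex_of_real (b k j) * w k)) - (\<Sum>i<n. complex_of_real ((b i j)\<^sup>2) * ?R x i i)"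
  let ?Q = "\<lambda>x w. 3 * \<tau>\<^sup>2 * (\<beta> * (1 / \<eta>\<^sup>2)) < cmod (?F x w)"
  show "inj_on ?h {..<n}" "?h ` {..<n} \<subseteq> I2" using j by (auto intro: inj_onI)
  show "{\<omega> \<in> space (PX I2). 3 * \<tau>\<^sup>2 * (\<beta> * (1 / \<eta>\<^sup>2)) < cmod (col_dev n \<eta> b (scaled b \<omega>) z j)} \<in> sets (PX I2)"
    by (intro borel_measurable_less borel_measurable_const measurable_compose[OF _ borel_measurable_norm] measurable_devs
       scaled_measurable j)
  show "{w \<in> space (PX {..<n}). ?Q x w} \<in> sets (PX {..<n})" for x
    by (intro borel_measurable_less borel_measurable_const measurable_compose[OF _ borel_measurable_norm] quadratic_form_measurable)
  show "emeasure (PX {..<n}) {w \<in> space (PX {..<n}). ?Q x w} \<le> ennreal ((2 * real n + 1) * tail \<tau>)" for x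
  proof (rule quadratic_tail)
    show "(\<Sum>i<n. (b i j)\<^sup>2) \<le> 1" using ds j by (simp add: doubly_stochastic_profile_def)
  qed (use b j rho_pos beta tau res_row_norm[OF eta] res_col_norm[OF eta] in auto)
  fix x w assume "x \<in> space (PX (I2 - ?h ` {..<n}))" "w \<in> space (PX (?h ` {..<n}))"
  let ?m = "merge (I2 - ?h ` {..<n}) (?h ` {..<n}) (x, w)"
  have "?m \<in> space (PX I2)" using j
    by (auto simp: space_PiM PiE_iff merge_def extensional_def)
  moreover have "col_dev n \<eta> b (scaled b ?m) z j = ?F x (\<lambda>i\<in>{..<n}. w (?h i))"
  proof -
    have e: "scaled b ?m i j = complex_of_real (b i j) * w (i, j)" if "i < n" for i
      using that j by (auto simp: scaled_def merge_def)
    show ?thesis unfolding col_dev_def sesq_def col_minor_merge[OF refl]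
      by (intro arg_cong2[where f = "(-)"] sum.cong refl) (simp_all add: e)
  qed
  ultimately show "?m \<in> {\<omega> \<in> space (PX I2). 3 * \<tau>\<^sup>2 * (\<beta> * (1 / \<eta>\<^sup>2)) < cmod (col_dev n \<eta> b (scaled b \<omega>) z j)}
      \<longleftrightarrow> ?Q x (\<lambda>i\<in>{..<n}. w (?h i))" by simp
qed

lemma lin_dev_tail:
  "emeasure (PX I2) {\<omega> \<in> space (PX I2). \<tau> * (\<beta> * (1 / \<eta>\<^sup>2)) < cmod (lin_dev n \<eta> (scaled b \<omega>) z j)}
    \<le> ennreal (tail \<tau>)"
proof (rule emeasure_PX_line)
  let ?h = "\<lambda>i. (i, j)"
  let ?R = "\<lambda>x. res n \<eta> (col_minor z j (scaled b x))"
  let ?F = "\<lambda>x (w :: nat \<Rightarrow> complex). \<Sum>k<n. (?R x j k * complex_of_real (b k j)) * w k"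
  let ?Q = "\<lambda>x w. \<tau> * (\<beta> * (1 / \<eta>\<^sup>2)) < cmod (?F x w)"
  show "inj_on ?h {..<n}" "?h ` {..<n} \<subseteq> I2" using j by (auto intro: inj_onI)
  show "{\<omega> \<in> space (PX I2). \<tau> * (\<beta> * (1 / \<eta>\<^sup>2)) < cmod (lin_dev n \<eta> (scaled b \<omega>) z j)} \<in> sets (PX I2)"
    by (intro borel_measurable_less borel_measurable_const measurable_compose[OF _ borel_measurable_norm] measurable_devs
       scaled_measurable j)
  show "{w \<in> space (PX {..<n}). ?Q x w} \<in> sets (PX {..<n})" for x
    by (intro borel_measurable_less borel_measurable_const measurable_compose[OF _ borel_measurable_norm] linear_form_measurable)
  show "emeasure (PX {..<n}) {w \<in> space (PX {..<n}). ?Q x w} \<le> ennreal (tail \<tau>)" for x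
  proof (rule linear_tail)
    \<comment> \<open>Only row \<open>j\<close> of the resolvent matters here; its squared norm is
      at most 1 / \<eta>^4, and each weight is at most \<beta>.\<close>
    have "(\<Sum>k<n. (cmod (?R x j k * complex_of_real (b k j)))\<^sup>2) \<le> (\<Sum>k<n. (cmod (?R x j k))\<^sup>2 * \<beta>\<^sup>2)"
    proof (rule sum_mono)
      fix k assume "k \<in> {..<n}"
      then have "(b k j)\<^sup>2 \<le> \<beta>\<^sup>2" using b[of k j] j by (intro power_mono) auto
      then show "(cmod (?R x j k * complex_of_real (b k j)))\<^sup>2 \<le> (cmod (?R x j k))\<^sup>2 * \<beta>\<^sup>2"
        by (auto simp: norm_mult power_mult_distrib intro: mult_left_mono)
    qed
    also have "\<dots> \<le> (1 / \<eta>\<^sup>2)\<^sup>2 * \<beta>\<^sup>2"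
      unfolding sum_distrib_right[symmetric] by (intro mult_right_mono res_row_norm[OF eta j]) auto
    finally show "(\<Sum>k<n. (cmod (?R x j k * complex_of_real (b k j)))\<^sup>2) \<le> (\<beta> * (1 / \<eta>\<^sup>2))\<^sup>2"
      by (simp only: power_mult_distrib mult.commute)
    show "0 < \<beta> * (1 / \<eta>\<^sup>2)" using beta rho_pos by (rule mult_pos_pos)
  qed
  fix x w assume "x \<in> space (PX (I2 - ?h ` {..<n}))" "w \<in> space (PX (?h ` {..<n}))"
  let ?m = "merge (I2 - ?h ` {..<n}) (?h ` {..<n}) (x, w)"
  have "?m \<in> space (PX I2)" using j
    by (auto simp: space_PiM PiE_iff merge_def extensional_def)
  moreover have "lin_dev n \<eta> (scaled b ?m) z j = ?F x (\<lambda>i\<in>{..<n}. w (?h i))"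
  proof -
    have e: "scaled b ?m i j = complex_of_real (b i j) * w (i, j)" if "i < n" for i
      using that j by (auto simp: scaled_def merge_def)
    show ?thesis unfolding lin_dev_def col_minor_merge[OF refl]
      by (intro sum.cong refl) (simp_all add: e)
  qed
  ultimately show "?m \<in> {\<omega> \<in> space (PX I2). \<tau> * (\<beta> * (1 / \<eta>\<^sup>2)) < cmod (lin_dev n \<eta> (scaled b \<omega>) z j)}
      \<longleftrightarrow> ?Q x (\<lambda>i\<in>{..<n}. w (?h i))" by simp
qed

lemma row_dev_tail:
  "emeasure (PX I2) {\<omega> \<in> space (PX I2). 3 * \<tau>\<^sup>2 * (\<beta> * (1 / \<eta>\<^sup>2)) < cmod (row_dev n \<eta> b (scaled b \<omega>) z j)}
    \<le> ennreal ((2 * real n + 1) * tail \<tau>)"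
proof (rule emeasure_PX_line)
  let ?h = "\<lambda>i. (j, i)"
  define c where "c = (\<lambda>k. if k = j then 0 else b j k)"
  let ?R = "\<lambda>x. res n \<eta> (row_col_minor z j (scaled b x))"
  \<comment> \<open>The form is evaluated at the conjugates of the row, so in terms of the row
    itself the resolvent appears transposed. \<open>quadratic_tail\<close> assumes the same bound on
    rows and columns and is unaffected.\<close>
  let ?F = "\<lambda>x (w :: nat \<Rightarrow> complex). (\<Sum>i<n. \<Sum>k<n. cnj (complex_of_real (c i) * w i) * ?R x k i * (complex_of_real (c k) * w k)) - (\<Sum>i<n. complex_of_real ((c i)\<^sup>2) * ?R x i i)"
  let ?Q = "\<lambda>x w. 3 * \<tau>\<^sup>2 * (\<beta> * (1 / \<eta>\<^sup>2)) < cmod (?F x w)"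
  show "inj_on ?h {..<n}" "?h ` {..<n} \<subseteq> I2" using j by (auto intro: inj_onI)
  show "{\<omega> \<in> space (PX I2). 3 * \<tau>\<^sup>2 * (\<beta> * (1 / \<eta>\<^sup>2)) < cmod (row_dev n \<eta> b (scaled b \<omega>) z j)} \<in> sets (PX I2)"
    by (intro borel_measurable_less borel_measurable_const measurable_compose[OF _ borel_measurable_norm] measurable_devs
       scaled_measurable j)
  show "{w \<in> space (PX {..<n}). ?Q x w} \<in> sets (PX {..<n})" for x
    by (intro borel_measurable_less borel_measurable_const measurable_compose[OF _ borel_measurable_norm] quadratic_form_measurable)
  show "emeasure (PX {..<n}) {w \<in> space (PX {..<n}). ?Q x w} \<le> ennreal ((2 * real n + 1) * tail \<tau>)" for x
  proof (rule quadratic_tail)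
    have "(\<Sum>i<n. (c i)\<^sup>2) \<le> (\<Sum>i<n. (b j i)\<^sup>2)" by (intro sum_mono) (auto simp: c_def)
    also have "\<dots> = 1" using ds j by (simp add: doubly_stochastic_profile_def)
    finally show "(\<Sum>i<n. (c i)\<^sup>2) \<le> 1" .
  qed (use b j rho_pos beta tau res_row_norm[OF eta] res_col_norm[OF eta] in \<open>auto simp: c_def\<close>)
  fix x w assume "x \<in> space (PX (I2 - ?h ` {..<n}))" "w \<in> space (PX (?h ` {..<n}))"
  let ?m = "merge (I2 - ?h ` {..<n}) (?h ` {..<n}) (x, w)"
  have "?m \<in> space (PX I2)" using j
    by (auto simp: space_PiM PiE_iff merge_def extensional_def)
  moreover have "row_dev n \<eta> b (scaled b ?m) z j = ?F x (\<lambda>i\<in>{..<n}. w (?h i))"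
  proof -
    have e: "(if i = j then 0 else cnj (scaled b ?m j i)) = cnj (complex_of_real (c i) * w (j, i))" if "i < n" for i
      using that j by (auto simp: scaled_def merge_def c_def)
    have "sesq n (?R x) (\<lambda>k. if k = j then 0 else cnj (scaled b ?m j k)) =
        (\<Sum>i<n. \<Sum>k<n. cnj (cnj (complex_of_real (c i) * w (j, i))) * ?R x i k * cnj (complex_of_real (c k) * w (j, k)))"
      unfolding sesq_def by (intro sum.cong refl) (simp add: e)
    also have "\<dots> = (\<Sum>k<n. \<Sum>i<n. cnj (cnj (complex_of_real (c i) * w (j, i))) * ?R x i k * cnj (complex_of_real (c k) * w (j, k)))"
      by (rule sum.swap)
    also have "\<dots> = (\<Sum>i<n. \<Sum>k<n. cnj (complex_of_real (c i) * (\<lambda>i\<in>{..<n}. w (?h i)) i) * ?R x k i * (complex_of_real (c k) * (\<lambda>i\<in>{..<n}. w (?h i)) k))"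
      by (intro sum.cong refl) (simp add: mult_ac)
    finally show ?thesis unfolding row_dev_def row_col_minor_merge[OF refl] by (simp add: c_def)
  qed
  ultimately show "?m \<in> {\<omega> \<in> space (PX I2). 3 * \<tau>\<^sup>2 * (\<beta> * (1 / \<eta>\<^sup>2)) < cmod (row_dev n \<eta> b (scaled b \<omega>) z j)}
      \<longleftrightarrow> ?Q x (\<lambda>i\<in>{..<n}. w (?h i))" by simp
qed

lemma emeasure_not_good:
  assumes small: "3 * \<tau>\<^sup>2 * (\<beta> * (1 / \<eta>\<^sup>2)) \<le> 1 / 8" "cmod z * (\<tau> * (\<beta> * (1 / \<eta>\<^sup>2))) \<le> 1 / 16"
  shows "emeasure (PX I2) {\<omega> \<in> space (PX I2). \<not> good n \<eta> b (scaled b \<omega>) z j} \<le> ennreal ((4 * real n + 3) * tail \<tau>)"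
proof -
  let ?A = "{\<omega> \<in> space (PX I2). 3 * \<tau>\<^sup>2 * (\<beta> * (1 / \<eta>\<^sup>2)) < cmod (col_dev n \<eta> b (scaled b \<omega>) z j)}"
  let ?B = "{\<omega> \<in> space (PX I2). \<tau> * (\<beta> * (1 / \<eta>\<^sup>2)) < cmod (lin_dev n \<eta> (scaled b \<omega>) z j)}"
  let ?C = "{\<omega> \<in> space (PX I2). 3 * \<tau>\<^sup>2 * (\<beta> * (1 / \<eta>\<^sup>2)) < cmod (row_dev n \<eta> b (scaled b \<omega>) z j)}"
  have S: "{\<omega> \<in> space (PX I2). c < cmod (F \<omega>)} \<in> sets (PX I2)"
    if "F \<in> borel_measurable (PX I2)" for c and F :: "(nat \<times> nat \<Rightarrow> complex) \<Rightarrow> complex"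
    by (intro borel_measurable_less borel_measurable_const measurable_compose[OF that borel_measurable_norm])
  have sets: "?A \<in> sets (PX I2)" by (rule S[OF measurable_devs(1)[OF scaled_measurable j]])
  have sets': "?B \<in> sets (PX I2)" by (rule S[OF measurable_devs(2)[OF scaled_measurable j]])
  have sets'': "?C \<in> sets (PX I2)" by (rule S[OF measurable_devs(3)[OF scaled_measurable j]])
  have "{\<omega> \<in> space (PX I2). \<not> good n \<eta> b (scaled b \<omega>) z j} \<subseteq> (?A \<union> ?B) \<union> ?C"
  proof (rule subsetI, rule ccontr)
    fix \<omega> assume "\<omega> \<in> {\<omega> \<in> space (PX I2). \<not> good n \<eta> b (scaled b \<omega>) z j}" "\<omega> \<notin> (?A \<union> ?B) \<union> ?C"
    then have ng: "\<not> good n \<eta> b (scaled b \<omega>) z j"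
      and le: "cmod (col_dev n \<eta> b (scaled b \<omega>) z j) \<le> 3 * \<tau>\<^sup>2 * (\<beta> * (1 / \<eta>\<^sup>2))"
        "cmod (lin_dev n \<eta> (scaled b \<omega>) z j) \<le> \<tau> * (\<beta> * (1 / \<eta>\<^sup>2))"
        "cmod (row_dev n \<eta> b (scaled b \<omega>) z j) \<le> 3 * \<tau>\<^sup>2 * (\<beta> * (1 / \<eta>\<^sup>2))"
      by auto
    have "cmod z * cmod (lin_dev n \<eta> (scaled b \<omega>) z j) \<le> 1 / 16"
      by (rule order_trans[OF mult_left_mono[OF le(2)] small(2)]) simp
    then have "good n \<eta> b (scaled b \<omega>) z j"
      using order_trans[OF le(1) small(1)] order_trans[OF le(3) small(1)]
      unfolding good_def col_dev_def lin_dev_def row_dev_def by blast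
    with ng show False by blast
  qed
  then have "emeasure (PX I2) {\<omega> \<in> space (PX I2). \<not> good n \<eta> b (scaled b \<omega>) z j} \<le> emeasure (PX I2) ((?A \<union> ?B) \<union> ?C)"
    by (rule emeasure_mono[OF _ sets.Un[OF sets.Un[OF sets sets'] sets'']])
  also have "\<dots> \<le> emeasure (PX I2) (?A \<union> ?B) + emeasure (PX I2) ?C"
    by (rule emeasure_subadditive[OF sets.Un[OF sets sets'] sets''])
  also have "\<dots> \<le> (emeasure (PX I2) ?A + emeasure (PX I2) ?B) + emeasure (PX I2) ?C"
    by (intro add_right_mono emeasure_subadditive sets sets')
  also have "\<dots> \<le> (ennreal ((2 * real n + 1) * tail \<tau>) + ennreal (tail \<tau>)) + ennreal ((2 * real n + 1) * tail \<tau>)"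
    by (intro add_mono col_dev_tail lin_dev_tail row_dev_tail)
  also have "\<dots> = ennreal ((4 * real n + 3) * tail \<tau>)"
    using tail_nonneg[of \<tau>] by (simp add: ennreal_plus[symmetric] algebra_simps del: ennreal_plus)
  finally show ?thesis .
qed

end

section \<open>Transfer from the product space to the given matrix\<close>

lemma distr_PX_scaled:
  assumes "finite I"
  shows "distr (PX I) (PiM I (\<lambda>_. borel)) (\<lambda>\<omega>. \<lambda>p\<in>I. complex_of_real (c p) * \<omega> p)
     = PiM I (\<lambda>p. distr \<xi> borel (\<lambda>z. complex_of_real (c p) * z))" (is "?L = ?R")
proof (rule product_sigma_finite.PiM_eqI)
  let ?f = "\<lambda>p z. complex_of_real (c p) * z"
  have f: "?f p \<in> \<xi> \<rightarrow>\<^sub>M borel" for p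
    by (subst measurable_cong_sets[OF sets_xi refl]) (intro borel_measurable_times borel_measurable_const measurable_ident_sets[OF refl])
  have t: "(\<lambda>\<omega>. \<lambda>p\<in>I. ?f p (\<omega> p)) \<in> PX I \<rightarrow>\<^sub>M PiM I (\<lambda>_. borel)"
    by (intro measurable_restrict borel_measurable_times borel_measurable_const measurable_PX_component)
  interpret D: prob_space "distr \<xi> borel (?f p)" for p using f by (rule prob_space_distr)
  show "product_sigma_finite (\<lambda>p. distr \<xi> borel (?f p))"
    by (simp add: product_sigma_finite_def D.sigma_finite_measure_axioms)
  show "finite I" by fact
  show "sets ?L = sets ?R" by (simp cong: sets_PiM_cong)
  fix A assume A: "\<And>p. p \<in> I \<Longrightarrow> A p \<in> sets (distr \<xi> borel (?f p))"
  interpret P: product_sigma_finite "\<lambda>_::'a. \<xi>"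
    by (simp add: product_sigma_finite_def sigma_finite_measure_axioms)
  have "emeasure ?L (Pi\<^sub>E I A) = emeasure (PX I) ((\<lambda>\<omega>. \<lambda>p\<in>I. ?f p (\<omega> p)) -` (Pi\<^sub>E I A) \<inter> space (PX I))"
    using A assms by (intro emeasure_distr t sets_PiM_I_finite) auto
  also have "(\<lambda>\<omega>. \<lambda>p\<in>I. ?f p (\<omega> p)) -` (Pi\<^sub>E I A) \<inter> space (PX I) = Pi\<^sub>E I (\<lambda>p. ?f p -` A p \<inter> space \<xi>)"
    by (auto simp: space_PiM PiE_iff)
  also have "emeasure (PX I) \<dots> = (\<Prod>p\<in>I. emeasure \<xi> (?f p -` A p \<inter> space \<xi>))"
    using A by (intro P.emeasure_PiM assms measurable_sets[OF f]) auto
  also have "\<dots> = (\<Prod>p\<in>I. emeasure (distr \<xi> borel (?f p)) (A p))"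
    using A by (intro prod.cong refl emeasure_distr[symmetric] f) auto
  finally show "emeasure ?L (Pi\<^sub>E I A) = (\<Prod>p\<in>I. emeasure (distr \<xi> borel (?f p)) (A p))" .
qed

text \<open>Independence and the marginal laws identify the joint law of the entries with that of
  scaled coordinates on the product of copies of \<open>\<xi>\<close>. Hence estimates proved there
  hold on any probability space carrying the matrix.\<close>

lemma emeasure_entries:
  assumes M: "prob_space M" and I: "finite I" "I \<noteq> {}"
    and ind: "prob_space.indep_vars M (\<lambda>_. borel) E I"
    and law: "\<And>p. p \<in> I \<Longrightarrow> distr M borel (E p) = distr \<xi> borel (\<lambda>z. complex_of_real (c p) * z)"
    and Q: "{w \<in> space (PiM I (\<lambda>_. borel)). Q w} \<in> sets (PiM I (\<lambda>_. borel :: complex measure))"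
  shows "emeasure M {\<omega> \<in> space M. Q (\<lambda>p\<in>I. E p \<omega>)}
    = emeasure (PX I) {\<omega> \<in> space (PX I). Q (\<lambda>p\<in>I. complex_of_real (c p) * \<omega> p)}"
proof -
  interpret M: prob_space M by fact
  have rv: "E p \<in> borel_measurable M" if "p \<in> I" for p using ind that by (auto simp: M.indep_vars_def)
  have "distr M (PiM I (\<lambda>_. borel)) (\<lambda>\<omega>. \<lambda>p\<in>I. E p \<omega>) = PiM I (\<lambda>p. distr M borel (E p))"
    using ind M.indep_vars_iff_distr_eq_PiM'[OF I(2) rv] by simp
  also have "\<dots> = PiM I (\<lambda>p. distr \<xi> borel (\<lambda>z. complex_of_real (c p) * z))"
    by (intro PiM_cong refl law)
  also have "\<dots> = distr (PX I) (PiM I (\<lambda>_. borel)) (\<lambda>\<omega>. \<lambda>p\<in>I. complex_of_real (c p) * \<omega> p)"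
    by (rule distr_PX_scaled[OF I(1), symmetric])
  finally have eq: "distr M (PiM I (\<lambda>_. borel)) (\<lambda>\<omega>. \<lambda>p\<in>I. E p \<omega>) = \<dots>" .
  let ?S = "{w \<in> space (PiM I (\<lambda>_. borel)). Q w}"
  have t1: "(\<lambda>\<omega>. \<lambda>p\<in>I. E p \<omega>) \<in> M \<rightarrow>\<^sub>M PiM I (\<lambda>_. borel)" by (intro measurable_restrict rv)
  have t2: "(\<lambda>\<omega>. \<lambda>p\<in>I. complex_of_real (c p) * \<omega> p) \<in> PX I \<rightarrow>\<^sub>M PiM I (\<lambda>_. borel)"
    by (intro measurable_restrict borel_measurable_times borel_measurable_const measurable_PX_component)
  have "emeasure M ((\<lambda>\<omega>. \<lambda>p\<in>I. E p \<omega>) -` ?S \<inter> space M)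
     = emeasure (PX I) ((\<lambda>\<omega>. \<lambda>p\<in>I. complex_of_real (c p) * \<omega> p) -` ?S \<inter> space (PX I))"
    using arg_cong[OF eq, of "\<lambda>N. emeasure N ?S"] by (simp only: emeasure_distr[OF t1 Q] emeasure_distr[OF t2 Q])
  moreover have "(\<lambda>\<omega>. \<lambda>p\<in>I. E p \<omega>) -` ?S \<inter> space M = {\<omega> \<in> space M. Q (\<lambda>p\<in>I. E p \<omega>)}"
    using measurable_space[OF t1] by auto
  moreover have "(\<lambda>\<omega>. \<lambda>p\<in>I. complex_of_real (c p) * \<omega> p) -` ?S \<inter> space (PX I)
      = {\<omega> \<in> space (PX I). Q (\<lambda>p\<in>I. complex_of_real (c p) * \<omega> p)}"
    using measurable_space[OF t2] by auto
  ultimately show ?thesis by simp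
qed

lemma emeasure_entries_not_good:
  fixes E :: "nat \<times> nat \<Rightarrow> 'w \<Rightarrow> complex"
  assumes M: "prob_space M"
    and ind: "prob_space.indep_vars M (\<lambda>_. borel) E ({..<n} \<times> {..<n})"
    and law: "\<And>i k. i < n \<Longrightarrow> k < n \<Longrightarrow> distr M borel (E (i, k)) = distr \<xi> borel (\<lambda>z. complex_of_real (b i k) * z)"
    and hyps: "j < n" "\<eta> > 0" "\<tau> \<ge> 1" "\<beta> > 0" "doubly_stochastic_profile n b"
      "\<And>i k. i < n \<Longrightarrow> k < n \<Longrightarrow> 0 \<le> b i k \<and> b i k \<le> \<beta>"
      "3 * \<tau>\<^sup>2 * (\<beta> * (1 / \<eta>\<^sup>2)) \<le> 1 / 8" "cmod z * (\<tau> * (\<beta> * (1 / \<eta>\<^sup>2))) \<le> 1 / 16"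
  shows "emeasure M {\<omega> \<in> space M. \<not> good n \<eta> b (\<lambda>i k. E (i, k) \<omega>) z j} \<le> ennreal ((4 * real n + 3) * tail \<tau>)"
proof -
  let ?I = "{..<n} \<times> {..<n}"
  let ?Q = "\<lambda>w. \<not> good n \<eta> b (\<lambda>i k. w (i, k)) z j"
  have "emeasure M {\<omega> \<in> space M. ?Q (\<lambda>p\<in>?I. E p \<omega>)}
    = emeasure (PX ?I) {\<omega> \<in> space (PX ?I). ?Q (\<lambda>p\<in>?I. complex_of_real ((\<lambda>(i, k). b i k) p) * \<omega> p)}"
  proof (rule emeasure_entries[OF M _ _ ind])
    show "{w \<in> space (PiM ?I (\<lambda>_. borel)). ?Q w} \<in> sets (PiM ?I (\<lambda>_. borel))"
      using hyps(1) by (intro not_good_sets measurable_component_singleton) auto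
  qed (use law hyps(1) in auto)
  moreover have "good n \<eta> b (\<lambda>i k. (\<lambda>p\<in>?I. E p \<omega>) (i, k)) z j \<longleftrightarrow> good n \<eta> b (\<lambda>i k. E (i, k) \<omega>) z j" for \<omega>
    by (rule good_cong[OF _ hyps(1)]) simp
  moreover have "good n \<eta> b (\<lambda>i k. (\<lambda>p\<in>?I. complex_of_real ((\<lambda>(i, k). b i k) p) * \<omega> p) (i, k)) z j
     \<longleftrightarrow> good n \<eta> b (scaled b \<omega>) z j" for \<omega>
    by (rule good_cong[OF _ hyps(1)]) (simp add: scaled_def)
  ultimately show ?thesis using emeasure_not_good[OF hyps] by simp
qed

end

section \<open>Delocalization on the good event\<close>

lemma closed_projection_compact:
  fixes C :: "('a::topological_space \<times> 'b::topological_space) set"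
  assumes K: "compact K" and C: "closed C"
  shows "closed {y. \<exists>x\<in>K. (x, y) \<in> C}"
proof -
  have "compact_space (top_of_set K)" using K by (simp add: compact_space_subtopology)
  then have "closed_map (prod_topology (top_of_set K) euclidean) euclidean (snd :: 'a \<times> 'b \<Rightarrow> 'b)"
    by (rule Abstract_Topological_Spaces.closed_map_snd)
  moreover have "prod_topology (top_of_set K) (euclidean :: 'b topology) = top_of_set (K \<times> UNIV)"
    using prod_topology_subtopology_eu[of K "UNIV :: 'b set"] by simp
  moreover have "closedin (top_of_set (K \<times> UNIV)) ((K \<times> UNIV) \<inter> C)"
    using C by (rule closedin_closed_Int)
  ultimately have "closed (snd ` ((K \<times> UNIV) \<inter> C))"
    by (simp add: closed_map_def)
  also have "snd ` ((K \<times> UNIV) \<inter> C) = {y. \<exists>x\<in>K. (x, y) \<in> C}" by force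
  finally show ?thesis .
qed

lemma compact_product_UNIV:
  fixes S :: "'i \<Rightarrow> ('a::topological_space) set"
  assumes "\<And>i. compact (S i)"
  shows "compact (Pi\<^sub>E UNIV S)"
proof -
  have "compactin (product_topology (\<lambda>_. euclidean) UNIV) (Pi\<^sub>E UNIV S)"
    using assms by (subst compactin_PiE) simp
  then show ?thesis by (simp add: euclidean_product_topology)
qed

text \<open>The complement of delocalization, phrased for a matrix viewed as a point of a function
  space, so that it can be studied topologically there.\<close>

definition localized :: "nat \<Rightarrow> real \<Rightarrow> (nat \<times> nat \<Rightarrow> complex) \<Rightarrow> bool" where
  "localized n t a \<longleftrightarrow> (\<exists>\<psi> z. (\<forall>i<n. (\<Sum>k<n. a (i, k) * \<psi> k) = z * \<psi> i) \<and>
     (\<Sum>k<n. (cmod (\<psi> k))\<^sup>2) = 1 \<and> (\<exists>j<n. t < cmod (\<psi> j)))"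

lemma continuous_on_proj_fst [continuous_intros]:
  "continuous_on S (\<lambda>p :: ('i \<Rightarrow> 'a::topological_space) \<times> 'b::topological_space. fst p i)"
  by (rule continuous_on_product_then_coordinatewise[OF continuous_on_fst[OF continuous_on_id]])

lemma continuous_on_proj_snd [continuous_intros]:
  "continuous_on S (\<lambda>p :: 'b::topological_space \<times> ('i \<Rightarrow> 'a::topological_space). snd p i)"
  by (rule continuous_on_product_then_coordinatewise[OF continuous_on_snd[OF continuous_on_id]])

text \<open>The eigenvalue of a unit eigenvector is its Rayleigh quotient, which eliminates it from the
  existential statement; the remaining witness ranges over a compact set.\<close>

lemma borel_localized: "{a. localized n t a} \<in> sets borel"
proof -
  \<comment> \<open>Coordinates beyond the dimension are pinned to 0; otherwise the witnesses,
    functions on all naturals, would not range over a compact set.\<close>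
  let ?K = "Pi\<^sub>E UNIV (\<lambda>k. if k < n then cball 0 1 else {0 :: complex})"
  define ray where "ray = (\<lambda>p :: (nat \<Rightarrow> complex) \<times> (nat \<times> nat \<Rightarrow> complex). \<Sum>l<n. \<Sum>k<n. cnj (fst p l) * snd p (l, k) * fst p k)"
  \<comment> \<open>The strict inequality t < |\<psi>_j| is not a closed condition; it is the union
    over m of the closed ones with margin 1 / (m + 1).\<close>
  define C where "C = (\<lambda>j (m :: nat). {p :: (nat \<Rightarrow> complex) \<times> (nat \<times> nat \<Rightarrow> complex).
     (\<forall>i. i < n \<longrightarrow> (\<Sum>k<n. snd p (i, k) * fst p k) = ray p * fst p i) \<and>
     (\<Sum>k<n. (cmod (fst p k))\<^sup>2) = 1 \<and> t + 1 / real (Suc m) \<le> cmod (fst p j)})"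
  have "closed (C j m)" for j m
    unfolding C_def ray_def
    by (intro closed_Collect_conj closed_Collect_all closed_Collect_imp open_Collect_const closed_Collect_eq closed_Collect_le continuous_intros)
  moreover have "compact ?K" by (rule compact_product_UNIV) auto
  ultimately have cl: "closed {a. \<exists>\<psi>\<in>?K. (\<psi>, a) \<in> C j m}" for j m
    by (intro closed_projection_compact)
  have "{a. localized n t a} = (\<Union>j\<in>{..<n}. \<Union>m. {a. \<exists>\<psi>\<in>?K. (\<psi>, a) \<in> C j m})"
  proof (rule equalityI; rule subsetI)
    fix a assume "a \<in> {a. localized n t a}"
    then obtain \<psi> z j where e: "\<And>i. i < n \<Longrightarrow> (\<Sum>k<n. a (i, k) * \<psi> k) = z * \<psi> i"
      and u: "(\<Sum>k<n. (cmod (\<psi> k))\<^sup>2) = 1" and j: "j < n" "t < cmod (\<psi> j)"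
      unfolding localized_def by auto
    define \<phi> where "\<phi> = (\<lambda>k. if k < n then \<psi> k else 0)"
    obtain m where m: "inverse (real (Suc m)) < cmod (\<psi> j) - t"
      using reals_Archimedean[of "cmod (\<psi> j) - t"] j by auto
    have u': "(\<Sum>k<n. (cmod (\<phi> k))\<^sup>2) = 1" using u by (simp add: \<phi>_def)
    have e': "(\<Sum>k<n. a (i, k) * \<phi> k) = z * \<phi> i" if "i < n" for i
      using e[OF that] that by (simp add: \<phi>_def)
    have "ray (\<phi>, a) = (\<Sum>l<n. cnj (\<phi> l) * (\<Sum>k<n. a (l, k) * \<phi> k))"
      by (simp add: ray_def sum_distrib_left mult.assoc)
    also have "\<dots> = (\<Sum>l<n. z * complex_of_real ((cmod (\<phi> l))\<^sup>2))"
    proof (intro sum.cong refl)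
      fix l assume "l \<in> {..<n}"
      then have "(\<Sum>k<n. a (l, k) * \<phi> k) = z * \<phi> l" by (intro e') simp
      then show "cnj (\<phi> l) * (\<Sum>k<n. a (l, k) * \<phi> k) = z * complex_of_real ((cmod (\<phi> l))\<^sup>2)"
        by (simp only: complex_norm_square mult_ac)
    qed
    also have "\<dots> = z" using u' by (simp only: sum_distrib_left[symmetric] of_real_sum[symmetric] of_real_1 mult_1_right)
    finally have ray: "ray (\<phi>, a) = z" .
    have "\<phi> \<in> ?K"
    proof -
      have "cmod (\<psi> k) \<le> 1" if "k < n" for k
      proof -
        have "(cmod (\<psi> k))\<^sup>2 \<le> (\<Sum>k<n. (cmod (\<psi> k))\<^sup>2)" using that by (intro member_le_sum) auto
        then have "(cmod (\<psi> k))\<^sup>2 \<le> 1\<^sup>2" using u by simp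
        then show ?thesis by (rule power2_le_imp_le) simp
      qed
      then show ?thesis by (auto simp: \<phi>_def PiE_iff)
    qed
    moreover have "\<phi> j = \<psi> j" using j by (simp add: \<phi>_def)
    then have "(\<phi>, a) \<in> C j m" using e' u' m by (simp add: C_def ray inverse_eq_divide)
    ultimately show "a \<in> (\<Union>j\<in>{..<n}. \<Union>m. {a. \<exists>\<psi>\<in>?K. (\<psi>, a) \<in> C j m})" using j by blast
  next
    fix a assume "a \<in> (\<Union>j\<in>{..<n}. \<Union>m. {a. \<exists>\<psi>\<in>?K. (\<psi>, a) \<in> C j m})"
    then obtain j m \<psi> where j: "j < n" "(\<psi>, a) \<in> C j m" by auto
    have "t + 1 / real (Suc m) \<le> cmod (\<psi> j)" using j(2) by (simp add: C_def del: of_nat_Suc)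
    moreover have "0 < 1 / real (Suc m)" by simp
    ultimately have "t < cmod (\<psi> j)" by linarith
    then show "a \<in> {a. localized n t a}" using j unfolding localized_def C_def by auto
  qed
  also have "\<dots> \<in> sets borel" using cl by (intro sets.finite_UN sets.countable_UN) (auto intro: borel_closed)
  finally show ?thesis .
qed

section \<open>Passing to the adjoint matrix; tail of one entry\<close>

lemma (in prob_space) indep_vars_reindex:
  assumes ind: "indep_vars M' X J" and h: "inj_on h I" "h ` I \<subseteq> J"
  shows "indep_vars (\<lambda>i. M' (h i)) (\<lambda>i. X (h i)) I"
proof -
  define F where "F = (\<lambda>i. {X i -` A \<inter> space M |A. A \<in> sets (M' i)})"
  have rv: "\<And>i. i \<in> J \<Longrightarrow> random_variable (M' i) (X i)" and F: "indep_sets F J"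
    using ind by (auto simp: indep_vars_def2 F_def)
  have "indep_sets (\<lambda>i. F (h i)) I"
  proof (rule indep_setsI)
    fix i assume "i \<in> I"
    then show "F (h i) \<subseteq> events" using F h by (auto simp: indep_sets_def)
  next
    fix A L assume L: "L \<noteq> {}" "L \<subseteq> I" "finite L" "\<forall>j\<in>L. A j \<in> F (h j)"
    have inj: "inj_on h L" using h L by (auto intro: inj_on_subset)
    define A' where "A' = (\<lambda>i. A (the_inv_into L h i))"
    have A': "A' (h j) = A j" if "j \<in> L" for j using that inj by (simp add: A'_def the_inv_into_f_f)
    have "prob (\<Inter>j\<in>h ` L. A' j) = (\<Prod>j\<in>h ` L. prob (A' j))"
      by (rule indep_setsD[OF F]) (use L h A' in auto)
    moreover have "(\<Inter>j\<in>h ` L. A' j) = (\<Inter>j\<in>L. A j)" using A' by auto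
    moreover have "(\<Prod>j\<in>h ` L. prob (A' j)) = (\<Prod>j\<in>L. prob (A j))"
      using inj A' by (simp add: prod.reindex)
    ultimately show "prob (\<Inter>j\<in>L. A j) = (\<Prod>j\<in>L. prob (A j))" by simp
  qed
  then show ?thesis using rv h by (auto simp: indep_vars_def2 F_def)
qed

text \<open>The entries of the adjoint follow the conjugate law. Since that law is again
  standardized and K-subgaussian, all tail bounds hold for the adjoint with the same
  constants.\<close>

lemma standardized_law_cnj:
  assumes "standardized_law \<xi>"
  shows "standardized_law (distr \<xi> borel cnj)"
proof -
  have s: "sets \<xi> = sets borel" and p: "prob_space \<xi>" and i: "integrable \<xi> (\<lambda>z. z)"
    using assms by (auto simp: standardized_law_def)
  have m: "cnj \<in> \<xi> \<rightarrow>\<^sub>M borel" using borel_measurable_cnj_compose[OF measurable_ident_sets[OF s]] .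
  have "(LINT z|\<xi>. cnj z) = cnj (LINT z|\<xi>. z)" by (rule integral_bounded_linear[OF bounded_linear_cnj i])
  moreover have "integrable \<xi> (\<lambda>z. cnj z)" by (rule integrable_bounded_linear[OF bounded_linear_cnj i])
  moreover have q: "(\<lambda>z :: complex. (cmod z)\<^sup>2) \<in> borel_measurable borel"
    by (intro borel_measurable_continuous_onI continuous_intros)
  ultimately show ?thesis using assms prob_space.prob_space_distr[OF p m]
    unfolding standardized_law_def integrable_distr_eq[OF m measurable_ident_sets[OF refl]]
      integral_distr[OF m measurable_ident_sets[OF refl]] integrable_distr_eq[OF m q] integral_distr[OF m q]
    by (auto simp only: complex_mod_cnj complex_cnj_zero sets_distr)
qed

lemma subgaussian_law_cnj:
  assumes "standardized_law \<xi>" "subgaussian_law K \<xi>"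
  shows "subgaussian_law K (distr \<xi> borel cnj)"
proof -
  have s: "sets \<xi> = sets borel" using assms by (auto simp: standardized_law_def)
  have m: "cnj \<in> \<xi> \<rightarrow>\<^sub>M borel" using borel_measurable_cnj_compose[OF measurable_ident_sets[OF s]] .
  show ?thesis using assms(2) by (simp add: subgaussian_law_def nn_integral_distr[OF m])
qed

text \<open>Markov's inequality for the subgaussian moment. From \<tau> \<ge> 1, a modulus above
  \<tau> has square at least \<tau>; the resulting exponential bound is weaker than the Gaussian one
  but fits under \<open>tail\<close>. For c = 0 the strict inequality in the event fails almost
  surely.\<close>

lemma (in subgaussian_entries) entry_tail:
  assumes E: "E \<in> borel_measurable M" and law: "distr M borel E = distr \<xi> borel (\<lambda>z. complex_of_real c * z)"
    and c: "c \<ge> 0" and tau: "\<tau> \<ge> 1"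
  shows "emeasure M {\<omega> \<in> space M. c * \<tau> < cmod (E \<omega>)} \<le> ennreal (tail \<tau>)"
proof -
  let ?S = "{w :: complex. c * \<tau> < cmod w}"
  have S: "?S \<in> sets borel"
    by (intro borel_open open_Collect_less continuous_intros)
  have f: "(\<lambda>z. complex_of_real c * z) \<in> \<xi> \<rightarrow>\<^sub>M borel"
    by (intro borel_measurable_times borel_measurable_const measurable_ident_sets) simp
  have "emeasure M {\<omega> \<in> space M. c * \<tau> < cmod (E \<omega>)} = emeasure (distr M borel E) ?S"
    using S by (subst emeasure_distr[OF E]) (auto intro!: arg_cong2[where f = emeasure])
  also have "\<dots> = emeasure \<xi> ((\<lambda>z. complex_of_real c * z) -` ?S \<inter> space \<xi>)"
    unfolding law by (rule emeasure_distr[OF f S])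
  also have "\<dots> = (\<integral>\<^sup>+z. indicator ((\<lambda>z. complex_of_real c * z) -` ?S \<inter> space \<xi>) z \<partial>\<xi>)"
    using measurable_sets[OF f S] by simp
  also have "\<dots> \<le> (\<integral>\<^sup>+z. ennreal (exp (- (\<tau> / K\<^sup>2))) * ennreal (exp ((cmod z)\<^sup>2 / K\<^sup>2)) \<partial>\<xi>)"
  proof (intro nn_integral_mono)
    fix z
    show "indicator ((\<lambda>z. complex_of_real c * z) -` ?S \<inter> space \<xi>) z \<le> ennreal (exp (- (\<tau> / K\<^sup>2))) * ennreal (exp ((cmod z)\<^sup>2 / K\<^sup>2))"
    proof (cases "c * \<tau> < c * cmod z")
      case True
      then have "\<tau> < cmod z" using c by (simp add: mult_less_cancel_left)
      then have "\<tau> * 1 \<le> cmod z * cmod z" using tau by (intro mult_mono) auto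
      then have "\<tau> \<le> (cmod z)\<^sup>2" by (simp add: power2_eq_square)
      then have "\<tau> / K\<^sup>2 \<le> (cmod z)\<^sup>2 / K\<^sup>2" by (intro divide_right_mono) auto
      then have "1 \<le> exp (- (\<tau> / K\<^sup>2)) * exp ((cmod z)\<^sup>2 / K\<^sup>2)" by (simp add: exp_add[symmetric])
      then have "ennreal 1 \<le> ennreal (exp (- (\<tau> / K\<^sup>2)) * exp ((cmod z)\<^sup>2 / K\<^sup>2))" by (rule ennreal_leI)
      then show ?thesis by (simp add: ennreal_mult indicator_def)
    qed (use c in \<open>simp add: norm_mult\<close>)
  qed
  also have "\<dots> = ennreal (exp (- (\<tau> / K\<^sup>2))) * (\<integral>\<^sup>+z. ennreal (exp ((cmod z)\<^sup>2 / K\<^sup>2)) \<partial>\<xi>)"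
    by (intro nn_integral_cmult measurable_compose[OF borel_measurable_integrable[OF integrable_exp_square] measurable_ennreal])
  also have "\<dots> \<le> ennreal (exp (- (\<tau> / K\<^sup>2))) * ennreal 2"
    using sub by (intro mult_left_mono) (auto simp: subgaussian_law_def)
  also have "\<dots> = ennreal (exp (- (\<tau> / K\<^sup>2)) * 2)" by (simp add: ennreal_mult)
  also have "\<dots> \<le> ennreal (tail \<tau>)"
  proof (rule ennreal_leI)
    have "\<tau> / (4 * K\<^sup>2) \<le> \<tau> / K\<^sup>2" using K tau by (intro divide_left_mono) auto
    then have "exp (- (\<tau> / K\<^sup>2)) \<le> 1 * exp (- (\<tau> / (4 * K\<^sup>2)))" by simp
    also have "\<dots> \<le> exp (mgf_const K * (1 / (2 * K\<^sup>2))\<^sup>2) * exp (- (\<tau> / (4 * K\<^sup>2)))"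
      by (intro mult_right_mono) (auto simp: mgf_const_def)
    finally show "exp (- (\<tau> / K\<^sup>2)) * 2 \<le> tail \<tau>" unfolding tail_def by (smt (verit) exp_gt_zero)
  qed
  finally show ?thesis .
qed

section \<open>A polynomially large net of spectral parameters\<close>

definition net :: "nat \<Rightarrow> complex set" where
  "net n = (\<lambda>(p, q). Complex (real_of_int p / real n) (real_of_int q / real n)) `
     ({- 2 * (int n)\<^sup>2..2 * (int n)\<^sup>2} \<times> {- 2 * (int n)\<^sup>2..2 * (int n)\<^sup>2})"

lemma finite_net [simp]: "finite (net n)"
  by (simp add: net_def)

lemma card_net:
  assumes "n \<ge> 1"
  shows "real (card (net n)) \<le> 25 * real n ^ 4"
proof -
  let ?S = "{- 2 * (int n)\<^sup>2..2 * (int n)\<^sup>2}"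
  have n1: "1 \<le> (real n)\<^sup>2" using assms by simp
  have "card (net n) \<le> card (?S \<times> ?S)" unfolding net_def by (rule card_image_le) simp
  also have "\<dots> = card ?S * card ?S" by (rule card_cartesian_product)
  finally have "real (card (net n)) \<le> real (card ?S) * real (card ?S)" by (metis of_nat_le_iff of_nat_mult)
  also have "real (card ?S) = 4 * (real n)\<^sup>2 + 1" by simp
  also have "(4 * (real n)\<^sup>2 + 1) * (4 * (real n)\<^sup>2 + 1) \<le> (5 * (real n)\<^sup>2) * (5 * (real n)\<^sup>2)"
    using n1 by (intro mult_mono) auto
  also have "\<dots> = 25 * real n ^ 4" by (simp add: power2_eq_square power4_eq_xxxx)
  finally show ?thesis .
qed

text \<open>Both coordinates are rounded down to multiples of 1 / n. Indices are of size about n^2,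
  and the range 2 n^2 of the net leaves slack for the rounding.\<close>

lemma net_approx:
  assumes n: "n \<ge> 1" and w: "cmod w \<le> real n"
  obtains z where "z \<in> net n" "cmod (w - z) \<le> 2 / real n"
proof -
  define p q where "p = \<lfloor>real n * Re w\<rfloor>" and "q = \<lfloor>real n * Im w\<rfloor>"
  have aux: "\<lfloor>real n * x\<rfloor> \<in> {- 2 * (int n)\<^sup>2..2 * (int n)\<^sup>2}" "\<bar>x - real_of_int \<lfloor>real n * x\<rfloor> / real n\<bar> \<le> 1 / real n"
    if x: "\<bar>x\<bar> \<le> real n" for x
  proof -
    have "\<bar>real n * x\<bar> \<le> real n * real n" using x by (simp add: abs_mult mult_left_mono)
    moreover have "1 \<le> real n * real n" using mult_mono[of 1 "real n" 1 "real n"] n by simp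
    ultimately have "- (2 * (real n)\<^sup>2) \<le> real_of_int \<lfloor>real n * x\<rfloor>" "real_of_int \<lfloor>real n * x\<rfloor> \<le> 2 * (real n)\<^sup>2"
      unfolding power2_eq_square by linarith+
    then have "real_of_int (- 2 * (int n)\<^sup>2) \<le> real_of_int \<lfloor>real n * x\<rfloor>" "real_of_int \<lfloor>real n * x\<rfloor> \<le> real_of_int (2 * (int n)\<^sup>2)"
      by simp_all
    then show "\<lfloor>real n * x\<rfloor> \<in> {- 2 * (int n)\<^sup>2..2 * (int n)\<^sup>2}" unfolding of_int_le_iff by simp
    have "\<bar>real n * x - real_of_int \<lfloor>real n * x\<rfloor>\<bar> \<le> 1" by linarith
    then have "\<bar>real n * x - real_of_int \<lfloor>real n * x\<rfloor>\<bar> / real n \<le> 1 / real n" by (intro divide_right_mono) auto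
    also have "\<bar>real n * x - real_of_int \<lfloor>real n * x\<rfloor>\<bar> / real n = \<bar>(real n * x - real_of_int \<lfloor>real n * x\<rfloor>) / real n\<bar>" by simp
    also have "(real n * x - real_of_int \<lfloor>real n * x\<rfloor>) / real n = x - real_of_int \<lfloor>real n * x\<rfloor> / real n"
      using n by (simp add: diff_divide_distrib)
    finally show "\<bar>x - real_of_int \<lfloor>real n * x\<rfloor> / real n\<bar> \<le> 1 / real n" .
  qed
  have R: "\<bar>Re w\<bar> \<le> real n" "\<bar>Im w\<bar> \<le> real n"
    using w abs_Re_le_cmod[of w] abs_Im_le_cmod[of w] by linarith+
  define z where "z = Complex (real_of_int p / real n) (real_of_int q / real n)"
  have "z \<in> net n" unfolding net_def z_def p_def q_def using aux(1)[OF R(1)] aux(1)[OF R(2)]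
    by (intro image_eqI[where x = "(\<lfloor>real n * Re w\<rfloor>, \<lfloor>real n * Im w\<rfloor>)"]) auto
  moreover have "cmod (w - z) \<le> 2 / real n"
    using cmod_le[of "w - z"] aux(2)[OF R(1)] aux(2)[OF R(2)] by (simp add: z_def p_def q_def)
  ultimately show ?thesis by (rule that)
qed

section \<open>Deterministic bounds on eigenvector coordinates\<close>

lemma eigenvector_coord_resolvent:
  assumes eta: "\<eta> > 0" and j: "j < n"
    and eig: "\<And>i. i < n \<Longrightarrow> (\<Sum>k<n. X i k * \<psi> k) = w * \<psi> i" and unit: "(\<Sum>k<n. (cmod (\<psi> k))\<^sup>2) = 1"
    and near: "cmod (w - z) \<le> \<eta>" and U: "resd n \<eta> (adj (sub_scalar z X)) j \<le> 3 / (2 * \<eta>)"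
  shows "(cmod (\<psi> j))\<^sup>2 \<le> 3 * \<eta>"
proof -
  have "(\<Sum>k<n. sub_scalar z X i k * \<psi> k) = (w - z) * \<psi> i" if "i < n" for i
  proof -
    have "(\<Sum>k<n. sub_scalar z X i k * \<psi> k) = (\<Sum>k<n. X i k * \<psi> k) - (\<Sum>k<n. if i = k then z * \<psi> k else 0)"
      unfolding sum_subtractf[symmetric] by (intro sum.cong refl) (auto simp: sub_scalar_def algebra_simps)
    then show ?thesis using eig[OF that] that by (simp add: algebra_simps)
  qed
  then have "(\<Sum>l<n. (cmod (\<Sum>k<n. sub_scalar z X l k * \<psi> k))\<^sup>2) = (\<Sum>l<n. (cmod (w - z))\<^sup>2 * (cmod (\<psi> l))\<^sup>2)"
    by (intro sum.cong refl) (simp add: norm_mult power_mult_distrib)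
  also have "\<dots> = (cmod (w - z))\<^sup>2" using unit by (simp add: sum_distrib_left[symmetric])
  also have "\<dots> \<le> \<eta>\<^sup>2" using near by (intro power_mono) auto
  finally have Q: "(\<Sum>l<n. (cmod (\<Sum>k<n. sub_scalar z X l k * \<psi> k))\<^sup>2) + \<eta>\<^sup>2 * (\<Sum>i<n. (cmod (\<psi> i))\<^sup>2) \<le> 2 * \<eta>\<^sup>2"
    using unit by simp
  have "(cmod (\<psi> j))\<^sup>2 \<le> resd n \<eta> (adj (sub_scalar z X)) j *
    ((\<Sum>l<n. (cmod (\<Sum>k<n. sub_scalar z X l k * \<psi> k))\<^sup>2) + \<eta>\<^sup>2 * (\<Sum>i<n. (cmod (\<psi> i))\<^sup>2))"
    by (rule coord_le_resd[OF eta j])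
  also have "\<dots> \<le> 3 / (2 * \<eta>) * (2 * \<eta>\<^sup>2)"
  proof (rule mult_mono[OF U Q])
    show "0 \<le> 3 / (2 * \<eta>)" using eta by simp
    show "0 \<le> (\<Sum>l<n. (cmod (\<Sum>k<n. sub_scalar z X l k * \<psi> k))\<^sup>2) + \<eta>\<^sup>2 * (\<Sum>i<n. (cmod (\<psi> i))\<^sup>2)"
      by (intro add_nonneg_nonneg mult_nonneg_nonneg sum_nonneg) auto
  qed
  also have "\<dots> = 3 * \<eta>" using eta by (simp add: power2_eq_square)
  finally show ?thesis .
qed

text \<open>The number w \<psi>_j is the product of row \<open>j\<close> with \<psi>. By
  Cauchy-Schwarz it is at most the norm of that row, hence at most T because the squared weights in
  the row sum to 1.\<close>

lemma eigenvector_coord_large: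
  assumes j: "j < n" and eig: "(\<Sum>k<n. X j k * \<psi> k) = w * \<psi> j" and unit: "(\<Sum>k<n. (cmod (\<psi> k))\<^sup>2) = 1"
    and X: "\<And>k. k < n \<Longrightarrow> cmod (X j k) \<le> b k * T" and b: "(\<Sum>k<n. (b k)\<^sup>2) = 1" and T: "T \<ge> 0"
  shows "cmod w * cmod (\<psi> j) \<le> T"
proof -
  have "cmod w * cmod (\<psi> j) = cmod (\<Sum>k<n. X j k * \<psi> k)" by (simp add: eig norm_mult)
  also have "\<dots> \<le> (\<Sum>k<n. \<bar>b k\<bar> * T * cmod (\<psi> k))"
  proof (rule order_trans[OF norm_sum sum_mono])
    fix k assume "k \<in> {..<n}"
    then have "cmod (X j k) \<le> b k * T" using X by auto
    also have "\<dots> \<le> \<bar>b k\<bar> * T" using T by (intro mult_right_mono) auto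
    finally show "cmod (X j k * \<psi> k) \<le> \<bar>b k\<bar> * T * cmod (\<psi> k)"
      by (simp add: norm_mult mult_right_mono)
  qed
  also have "\<dots> = T * (\<Sum>k<n. \<bar>b k\<bar> * \<bar>cmod (\<psi> k)\<bar>)" by (simp add: sum_distrib_left mult_ac)
  also have "\<dots> \<le> T * (L2_set b {..<n} * L2_set (\<lambda>k. cmod (\<psi> k)) {..<n})"
    using T by (intro mult_left_mono L2_set_mult_ineq)
  also have "\<dots> = T" using unit b by (simp add: L2_set_def)
  finally show ?thesis .
qed

lemma delocalized_of_good:
  fixes X :: "nat \<Rightarrow> nat \<Rightarrow> complex" and B C T :: real
  assumes n: "n \<ge> 1" and ds: "doubly_stochastic_profile n b"
    and B: "1 \<le> B" "B \<le> real n" and C: "48 \<le> C" "C = T\<^sup>2" "1 \<le> T"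
    and b: "\<And>i k. i < n \<Longrightarrow> k < n \<Longrightarrow> 0 \<le> b i k \<and> b i k \<le> 1 / B ^ 5" and Bn: "B ^ 10 \<le> real n"
    and entries: "\<And>i k. i < n \<Longrightarrow> k < n \<Longrightarrow> cmod (X i k) \<le> b i k * T"
    and good1: "\<And>z j. z \<in> net n \<Longrightarrow> cmod z \<le> 3 * B \<Longrightarrow> j < n \<Longrightarrow> good n (C / B\<^sup>2) b X z j"
    and good2: "\<And>z j. z \<in> net n \<Longrightarrow> cmod z \<le> 3 * B \<Longrightarrow> j < n \<Longrightarrow> good n (C / B\<^sup>2) (\<lambda>i k. b k i) (adj X) (cnj z) j"
    and j: "j < n" and eig: "\<And>i. i < n \<Longrightarrow> (\<Sum>k<n. X i k * \<psi> k) = w * \<psi> i" and unit: "(\<Sum>k<n. (cmod (\<psi> k))\<^sup>2) = 1"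
  shows "cmod (\<psi> j) \<le> C / B"
proof (cases "B \<le> cmod w")
  case True
  have "B * cmod (\<psi> j) \<le> cmod w * cmod (\<psi> j)" using True by (intro mult_right_mono) auto
  also have "\<dots> \<le> T"
    using ds j entries C by (intro eigenvector_coord_large[where X = X and b = "b j", OF j eig[OF j] unit])
      (auto simp: doubly_stochastic_profile_def)
  also have "T \<le> C" using C by (simp add: power2_eq_square)
  finally show ?thesis using B by (simp add: field_simps)
next
  case False
  define \<eta> where "\<eta> = C / B\<^sup>2"
  have eta: "\<eta> > 0" using B C by (simp add: \<eta>_def)
  obtain z where z: "z \<in> net n" "cmod (w - z) \<le> 2 / real n"
    using net_approx[OF n, of w] False B by auto
  have "cmod z \<le> cmod w + cmod (w - z)"
    using norm_triangle_ineq4[of w "w - z"] by simp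
  also have "2 / real n \<le> 2" using n by (simp add: field_simps)
  then have "cmod w + cmod (w - z) \<le> B + 2" using z False by linarith
  also have "\<dots> \<le> 3 * B" using B by simp
  finally have zB: "cmod z \<le> 3 * B" .
  \<comment> \<open>The net is finer than \<eta> because B^2 \<le> n.\<close>
  have "B\<^sup>2 \<le> B ^ 10" using B by (intro power_increasing) auto
  then have "B\<^sup>2 \<le> real n" using Bn by linarith
  then have "2 * B\<^sup>2 \<le> C * real n" using C by (intro mult_mono) auto
  then have "2 / real n \<le> \<eta>" using n B by (simp add: \<eta>_def field_simps)
  then have near: "cmod (w - z) \<le> \<eta>" using z by linarith
  have "resd n \<eta> (adj (sub_scalar z X)) j \<le> 3 / (2 * \<eta>)"
  proof (rule resd_bound[OF eta j ds])
    fix i k assume "i < n" "k < n"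
    then show "(b i k)\<^sup>2 \<le> (1 / B ^ 5)\<^sup>2" using b by (intro power_mono) auto
  next
    have "(1 / B ^ 5)\<^sup>2 / \<eta>\<^sup>2 = 1 / (B ^ 6 * C\<^sup>2)"
    proof -
      have "(1 / B ^ 5)\<^sup>2 / \<eta>\<^sup>2 = B ^ 4 / (B ^ 10 * C\<^sup>2)"
        by (simp add: \<eta>_def power_divide flip: power_mult)
      also have "B ^ 10 = B ^ 4 * B ^ 6" by (simp flip: power_add)
      finally show ?thesis using B
        by (simp only: mult.assoc, subst nonzero_divide_mult_cancel_left) auto
    qed
    also have "\<dots> \<le> 1 / (1 * 8)"
    proof (intro divide_left_mono mult_mono)
      have "48\<^sup>2 \<le> C\<^sup>2" using C by (intro power_mono) auto
      then show "8 \<le> C\<^sup>2" by simp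
    qed (use B C in auto)
    finally show "(1 / B ^ 5)\<^sup>2 / \<eta>\<^sup>2 \<le> 1 / 8" by simp
  qed (use good1 good2 z zB in \<open>auto simp: \<eta>_def\<close>)
  from eigenvector_coord_resolvent[OF eta j eig unit near this]
  have "(cmod (\<psi> j))\<^sup>2 \<le> 3 * \<eta>" .
  also have "3 * \<eta> \<le> (C / B)\<^sup>2"
  proof -
    have "3 * C \<le> C * C" using C by (intro mult_right_mono) auto
    then have "3 * C / B\<^sup>2 \<le> (C * C) / B\<^sup>2" by (rule divide_right_mono) simp
    then show ?thesis unfolding \<eta>_def power_divide power2_eq_square[of C] by (simp only: times_divide_eq_right)
  qed
  finally show ?thesis by (rule power2_le_imp_le) (use B(1) C(1) in simp)
qed

text \<open>A row of n squares with sum 1 contains one of size at least 1 / n. The resulting b_n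
  \<le> n keeps B polynomially bounded, so that the net reaches all the eigenvalues in
  question.\<close>

lemma bandwidth_bounds:
  assumes n: "n \<ge> 1" and ds: "doubly_stochastic_profile n b" and b: "\<forall>i<n. \<forall>k<n. 0 \<le> b i k"
  shows "bandwidth n b \<le> real n"
    "\<And>i k. i < n \<Longrightarrow> k < n \<Longrightarrow> (b i k)\<^sup>2 \<le> 1 / bandwidth n b"
proof -
  let ?I = "{..<n} \<times> {..<n}"
  define s where "s = (SUP (i, k)\<in>?I. (b i k)\<^sup>2)"
  have ub: "(b i k)\<^sup>2 \<le> s" if "i < n" "k < n" for i k
    unfolding s_def using that by (intro cSUP_upper2[where x = "(i, k)"] bdd_above_finite) auto
  have "1 = (\<Sum>k<n. (b 0 k)\<^sup>2)" using ds n by (simp add: doubly_stochastic_profile_def)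
  also have "\<dots> \<le> (\<Sum>k<n. s)" using ub n by (intro sum_mono) auto
  finally have s: "1 \<le> real n * s" by simp
  then have s0: "s > 0" using n by (smt (verit) mult_nonneg_nonpos of_nat_0_le_iff)
  have bw: "bandwidth n b = inverse s" by (simp add: bandwidth_def s_def)
  show "bandwidth n b \<le> real n" using s s0 by (simp add: bw field_simps)
  show "(b i k)\<^sup>2 \<le> 1 / bandwidth n b" if "i < n" "k < n" for i k
    using ub[OF that] by (simp add: bw divide_inverse)
qed

section \<open>Union bound\<close>

text \<open>A stretched exponential beats every power of n. The threshold on n depends on
  \<open>c\<close>, \<open>a\<close> and \<open>D\<close> alone, which makes the final one uniform
  in the profile, the law and the probability space.\<close>

lemma eventually_union_bound:
  fixes c a D :: real
  assumes "c > 0" "a > 0"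
  shows "\<forall>\<^sub>F n :: nat in sequentially. 1 \<le> n \<and> 48 \<le> real n powr c \<and>
     351 * real n ^ 6 * (4 * (D * exp (- (real n powr (c / 2) / a)))) \<le> real n powr (-10)"
proof -
  have "\<forall>\<^sub>F n :: nat in sequentially. 48 \<le> real n powr c"
    using assms(1) by real_asymp
  moreover have "\<forall>\<^sub>F n :: nat in sequentially. 351 * real n ^ 6 * (4 * (D * exp (- (real n powr (c / 2) / a)))) \<le> real n powr (-10)"
  proof -
    have "((\<lambda>n :: nat. (real n ^ 16) * exp (- (real n powr (c / 2) / a))) \<longlongrightarrow> 0) sequentially"
      using assms by real_asymp
    then have "((\<lambda>n :: nat. (1404 * D) * ((real n ^ 16) * exp (- (real n powr (c / 2) / a)))) \<longlongrightarrow> (1404 * D) * 0) sequentially"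
      by (intro tendsto_mult tendsto_const)
    then have "\<forall>\<^sub>F n :: nat in sequentially. (1404 * D) * ((real n ^ 16) * exp (- (real n powr (c / 2) / a))) < 1"
      by (rule order_tendstoD) simp
    then show ?thesis using eventually_ge_at_top[of 1]
    proof eventually_elim
      case (elim n)
      have n10: "real n ^ 10 > 0" using elim by simp
      have "(351 * real n ^ 6 * (4 * (D * exp (- (real n powr (c / 2) / a))))) * real n ^ 10
        = (1404 * D) * ((real n ^ 16) * exp (- (real n powr (c / 2) / a)))"
      proof -
        have "real n ^ 16 = real n ^ 6 * real n ^ 10" by (simp flip: power_add)
        then show ?thesis by (simp only: mult_ac)
      qed
      also have "\<dots> \<le> 1" using elim by linarith
      finally have "351 * real n ^ 6 * (4 * (D * exp (- (real n powr (c / 2) / a)))) \<le> 1 / real n ^ 10"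
        using n10 by (simp add: pos_le_divide_eq)
      also have "\<dots> = inverse (real n powr 10)"
      proof -
        have "real n powr 10 = real n ^ 10" using powr_realpow[of "real n" 10] elim(2) by simp
        then show ?thesis by (simp only: divide_inverse mult_1_left)
      qed
      also have "\<dots> = real n powr (-10)" by (rule powr_minus[symmetric])
      finally show ?case .
    qed
  qed
  ultimately show ?thesis using eventually_ge_at_top[of "1 :: nat"] by eventually_elim auto
qed

lemma (in prob_space) indep_vars_rv:
  assumes "indep_vars M' X I" "i \<in> I"
  shows "X i \<in> M \<rightarrow>\<^sub>M M' i"
  using assms unfolding indep_vars_def2 by blast

text \<open>Extension by 0 outside the index square turns the matrix into a point of the function
  space on which \<open>localized\<close> is known to be Borel.\<close>

lemma eigenvector_iff_localized:
  assumes A: "A \<in> carrier_mat n n" and n: "n \<ge> 1"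
  shows "(\<forall>\<psi> z. eigenvector A \<psi> z \<and> l2_norm_vec \<psi> = 1 \<longrightarrow> max_norm_vec \<psi> \<le> t)
     \<longleftrightarrow> \<not> localized n t (\<lambda>p. if p \<in> {..<n} \<times> {..<n} then A $$ p else 0)"
proof -
  let ?a = "\<lambda>p. if p \<in> {..<n} \<times> {..<n} then A $$ p else 0"
  have mv: "(A *\<^sub>v v) $ i = (\<Sum>k<n. ?a (i, k) * v $ k)" if "v \<in> carrier_vec n" "i < n" for v i
    using A that by (simp add: scalar_prod_def lessThan_atLeast0)
  have unit: "l2_norm_vec v = 1 \<longleftrightarrow> (\<Sum>k<n. (cmod (v $ k))\<^sup>2) = 1" if "v \<in> carrier_vec n" for v
    using that by (simp add: l2_norm_vec_def)
  have mx: "max_norm_vec v \<le> t \<longleftrightarrow> (\<forall>j<n. cmod (v $ j) \<le> t)" if "v \<in> carrier_vec n" for v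
  proof -
    have eq: "max_norm_vec v = Max ((\<lambda>j. cmod (v $ j)) ` {..<n})" using that by (simp add: max_norm_vec_def)
    show ?thesis unfolding eq using n by (subst Max_le_iff) (auto simp: lessThan_empty_iff)
  qed
  show ?thesis
  proof
    assume L: "\<forall>\<psi> z. eigenvector A \<psi> z \<and> l2_norm_vec \<psi> = 1 \<longrightarrow> max_norm_vec \<psi> \<le> t"
    show "\<not> localized n t ?a"
    proof
      assume "localized n t ?a"
      then obtain \<psi> z j where e: "\<And>i. i < n \<Longrightarrow> (\<Sum>k<n. ?a (i, k) * \<psi> k) = z * \<psi> i"
        and u: "(\<Sum>k<n. (cmod (\<psi> k))\<^sup>2) = 1" and j: "j < n" "t < cmod (\<psi> j)"
        unfolding localized_def by auto
      define v where "v = vec n \<psi>"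
      have v: "v \<in> carrier_vec n" by (simp add: v_def)
      have vk: "v $ k = \<psi> k" if "k < n" for k using that by (simp add: v_def)
      have u': "l2_norm_vec v = 1" unfolding unit[OF v] using u by (simp add: vk)
      have "v \<noteq> 0\<^sub>v n"
      proof
        assume "v = 0\<^sub>v n"
        then have "\<And>k. k < n \<Longrightarrow> \<psi> k = 0" using vk by (metis index_zero_vec(1))
        then show False using u by simp
      qed
      moreover have "A *\<^sub>v v = z \<cdot>\<^sub>v v"
      proof (rule eq_vecI)
        fix i assume "i < dim_vec (z \<cdot>\<^sub>v v)"
        then have i: "i < n" using v by simp
        have "(A *\<^sub>v v) $ i = (\<Sum>k<n. ?a (i, k) * \<psi> k)" unfolding mv[OF v i] by (simp add: vk)
        also have "\<dots> = z * \<psi> i" by (rule e[OF i])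
        finally show "(A *\<^sub>v v) $ i = (z \<cdot>\<^sub>v v) $ i" using i v by (simp add: vk)
      qed (use A v in simp)
      ultimately have "eigenvector A v z" using A v by (simp add: eigenvector_def)
      then have "max_norm_vec v \<le> t" using L u' by blast
      then show False using j unfolding mx[OF v] by (force simp: vk)
    qed
  next
    assume L: "\<not> localized n t ?a"
    show "\<forall>\<psi> z. eigenvector A \<psi> z \<and> l2_norm_vec \<psi> = 1 \<longrightarrow> max_norm_vec \<psi> \<le> t"
    proof (intro allI impI, rule ccontr)
      fix v z assume h: "eigenvector A v z \<and> l2_norm_vec v = 1" and nm: "\<not> max_norm_vec v \<le> t"
      have v: "v \<in> carrier_vec n" and e: "A *\<^sub>v v = z \<cdot>\<^sub>v v" using h A by (auto simp: eigenvector_def)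
      obtain j where j: "j < n" "t < cmod (v $ j)" using nm unfolding mx[OF v] by (auto simp: not_le)
      have "(\<Sum>k<n. ?a (i, k) * v $ k) = z * v $ i" if "i < n" for i
        using mv[OF v that] e v that by simp
      then have "localized n t ?a" unfolding localized_def
        using h unit[OF v] j by (intro exI[of _ "\<lambda>k. v $ k"] exI[of _ z]) auto
      with L show False ..
    qed
  qed
qed

lemma emeasure_UN_le:
  assumes "finite A" "\<And>x. x \<in> A \<Longrightarrow> S x \<in> sets M" "\<And>x. x \<in> A \<Longrightarrow> emeasure M (S x) \<le> ennreal c" "c \<ge> 0"
  shows "emeasure M (\<Union>x\<in>A. S x) \<le> ennreal (real (card A) * c)"
proof -
  have "emeasure M (\<Union>x\<in>A. S x) \<le> (\<Sum>x\<in>A. emeasure M (S x))"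
    using assms by (intro emeasure_subadditive_finite) auto
  also have "\<dots> \<le> (\<Sum>x\<in>A. ennreal c)" using assms by (intro sum_mono)
  also have "\<dots> = ennreal (real (card A) * c)"
    using assms(4) by (simp add: ennreal_mult ennreal_of_nat_eq_real_of_nat)
  finally show ?thesis .
qed

lemma emeasure_Un_le:
  assumes "A \<in> sets M" "B \<in> sets M" "emeasure M A \<le> ennreal a" "emeasure M B \<le> ennreal b" "0 \<le> a" "0 \<le> b"
  shows "emeasure M (A \<union> B) \<le> ennreal (a + b)"
proof -
  have "emeasure M (A \<union> B) \<le> emeasure M A + emeasure M B" using assms by (intro emeasure_subadditive)
  also have "\<dots> \<le> ennreal a + ennreal b" using assms by (intro add_mono)
  finally show ?thesis using assms by simp
qed

text \<open>The union bound over entries that are too large and over failures of \<open>good\<close>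
  at net points, for the matrix and for its adjoint. Outside these events
  \<open>delocalized_of_good\<close> applies to every eigenvector at once.\<close>

lemma emeasure_localized:
  fixes X :: "'w \<Rightarrow> complex mat" and B C T :: real
  assumes model: "inhomogeneous_model K n b \<xi> M X" and K: "K > 0" and n: "n \<ge> 1"
    and B: "1 \<le> B" "B ^ 10 = bandwidth n b" and C: "48 \<le> C" "C = T\<^sup>2" "1 \<le> T"
  shows "emeasure M {\<omega> \<in> space M. localized n (C / B) (\<lambda>p. if p \<in> {..<n} \<times> {..<n} then X \<omega> $$ p else 0)}
    \<le> ennreal (351 * real n ^ 6 * subgaussian_entries.tail K T)"
proof -
  let ?I = "{..<n} \<times> {..<n}"
  have std: "standardized_law \<xi>" and sub: "subgaussian_law K \<xi>" and b0: "\<forall>i<n. \<forall>j<n. 0 \<le> b i j"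
    and ds: "doubly_stochastic_profile n b" and M: "prob_space M"
    and ind: "prob_space.indep_vars M (\<lambda>_. borel) (\<lambda>p \<omega>. X \<omega> $$ p) ?I"
    and law: "\<And>i j. i < n \<Longrightarrow> j < n \<Longrightarrow> distr M borel (\<lambda>\<omega>. X \<omega> $$ (i, j)) = distr \<xi> borel (\<lambda>z. complex_of_real (b i j) * z)"
    using model unfolding inhomogeneous_model_def by blast+
  interpret M: prob_space M by fact
  interpret S: subgaussian_entries \<xi> K using std sub K by unfold_locales
  define \<xi>' where "\<xi>' = distr \<xi> borel cnj"
  interpret S': subgaussian_entries \<xi>' K
    unfolding \<xi>'_def using standardized_law_cnj[OF std] subgaussian_law_cnj[OF std sub] K by unfold_locales
  define \<beta> where "\<beta> = 1 / B ^ 5"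
  define \<eta> where "\<eta> = C / B\<^sup>2"
  define t where "t = subgaussian_entries.tail K T"
  have t0: "t \<ge> 0" unfolding t_def by (rule S.tail_nonneg)
  have B0: "B > 0" and C0: "C > 0" using B C by auto
  have eta: "\<eta> > 0" using B0 C0 by (simp add: \<eta>_def)
  have beta: "\<beta> > 0" using B0 by (simp add: \<beta>_def)
  note bw = bandwidth_bounds[OF n ds b0]
  have bn: "0 \<le> b i k \<and> b i k \<le> \<beta>" if "i < n" "k < n" for i k
  proof -
    have "(b i k)\<^sup>2 \<le> \<beta>\<^sup>2" using bw(2)[OF that] B0
      by (simp add: B(2)[symmetric] \<beta>_def power_divide flip: power_mult)
    then show ?thesis using b0 that beta by (auto intro: power2_le_imp_le)
  qed
  \<comment> \<open>The power counting behind the choice of \<eta>: after multiplication by |z|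
    \<le> 3 B and T \<le> C there remains 3 / C, so that C \<ge> 48 gives precisely the 1/16 in
    \<open>good\<close>.\<close>
  have be: "\<beta> * (1 / \<eta>\<^sup>2) = 1 / (B * C\<^sup>2)"
  proof -
    have "\<beta> * (1 / \<eta>\<^sup>2) = B ^ 4 / (B ^ 5 * C\<^sup>2)"
      by (simp add: \<beta>_def \<eta>_def power_divide flip: power_mult)
    also have "B ^ 5 = B ^ 4 * B ^ 1" by (simp only: power_add[symmetric]) simp
    finally show ?thesis using B0
      by (simp only: mult.assoc power_one_right, subst nonzero_divide_mult_cancel_left) auto
  qed
  have small1: "3 * T\<^sup>2 * (\<beta> * (1 / \<eta>\<^sup>2)) \<le> 1 / 8"
  proof -
    have "3 * T\<^sup>2 * (\<beta> * (1 / \<eta>\<^sup>2)) = 3 / (B * C)"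
      unfolding be C(2)[symmetric] using B0 C0 by (simp add: power2_eq_square)
    also have "\<dots> \<le> 3 / (1 * 48)" using B C B0 C0 by (intro divide_left_mono mult_mono) auto
    finally show ?thesis by simp
  qed
  have TC: "T \<le> C" using C by (simp add: power2_eq_square)
  have small2: "cmod z * (T * (\<beta> * (1 / \<eta>\<^sup>2))) \<le> 1 / 16" if "cmod z \<le> 3 * B" for z
  proof -
    have "cmod z * (T * (\<beta> * (1 / \<eta>\<^sup>2))) \<le> (3 * B) * (C * (\<beta> * (1 / \<eta>\<^sup>2)))"
      using that TC B0 C0 C beta by (intro mult_mono) auto
    also have "\<dots> = 3 / C" unfolding be using B0 C0 by (simp add: power2_eq_square)
    also have "\<dots> \<le> 3 / 48" using C by (intro divide_left_mono) auto
    finally show ?thesis by simp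
  qed
  have rv: "(\<lambda>\<omega>. X \<omega> $$ (i, k)) \<in> borel_measurable M" if "i < n" "k < n" for i k
    by (rule M.indep_vars_rv[OF ind]) (use that in simp)

  define N where "N = {z \<in> net n. cmod z \<le> 3 * B}"
  define A where "A = (\<lambda>p. {\<omega> \<in> space M. b (fst p) (snd p) * T < cmod (X \<omega> $$ p)})"
  define G1 where "G1 = (\<lambda>p. {\<omega> \<in> space M. \<not> good n \<eta> b (\<lambda>i k. X \<omega> $$ (i, k)) (fst p) (snd p)})"
  define G2 where "G2 = (\<lambda>p. {\<omega> \<in> space M. \<not> good n \<eta> (\<lambda>i k. b k i) (adj (\<lambda>i k. X \<omega> $$ (i, k))) (cnj (fst p)) (snd p)})"
  have A: "A p \<in> sets M" "emeasure M (A p) \<le> ennreal t" if "p \<in> ?I" for p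
  proof -
    have p: "fst p < n" "snd p < n" "p = (fst p, snd p)" using that by auto
    then have E: "(\<lambda>\<omega>. X \<omega> $$ p) \<in> borel_measurable M" using rv by metis
    have l: "distr M borel (\<lambda>\<omega>. X \<omega> $$ p) = distr \<xi> borel (\<lambda>z. complex_of_real (b (fst p) (snd p)) * z)"
      using law[OF p(1,2)] p(3) by simp
    show "A p \<in> sets M" unfolding A_def
      by (intro borel_measurable_less borel_measurable_const measurable_compose[OF E borel_measurable_norm])
    show "emeasure M (A p) \<le> ennreal t" unfolding A_def t_def
      using S.entry_tail[OF E l _ C(3)] b0 p by auto
  qed
  have G1: "G1 p \<in> sets M" "emeasure M (G1 p) \<le> ennreal ((4 * real n + 3) * t)" if "p \<in> N \<times> {..<n}" for p
  proof -
    have z: "cmod (fst p) \<le> 3 * B" and j: "snd p < n" using that by (auto simp: N_def)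
    show "G1 p \<in> sets M" unfolding G1_def by (rule not_good_sets[OF rv j])
    show "emeasure M (G1 p) \<le> ennreal ((4 * real n + 3) * t)" unfolding G1_def t_def
      by (rule S.emeasure_entries_not_good[OF M ind law j eta C(3) beta ds bn small1 small2[OF z]])
  qed
  have G2: "G2 p \<in> sets M" "emeasure M (G2 p) \<le> ennreal ((4 * real n + 3) * t)" if "p \<in> N \<times> {..<n}" for p
  proof -
    have z: "cmod (cnj (fst p)) \<le> 3 * B" and j: "snd p < n" using that by (auto simp: N_def)
    have m: "(\<lambda>\<omega>. adj (\<lambda>i k. X \<omega> $$ (i, k)) i k) \<in> borel_measurable M" if "i < n" "k < n" for i k
      unfolding adj_def using that by (intro borel_measurable_cnj_compose rv)
    show "G2 p \<in> sets M" unfolding G2_def by (rule not_good_sets[OF m j])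
    have ind': "M.indep_vars (\<lambda>_. borel) (\<lambda>p \<omega>. cnj (X \<omega> $$ prod.swap p)) ?I"
    proof (rule M.indep_vars_compose2[where M' = "\<lambda>_. borel" and Y = "\<lambda>_. cnj"])
      show "M.indep_vars (\<lambda>_. borel) (\<lambda>p \<omega>. X \<omega> $$ prod.swap p) ?I"
        by (rule M.indep_vars_reindex[OF ind]) (auto intro: inj_onI)
      show "cnj \<in> borel \<rightarrow>\<^sub>M borel" by (rule borel_measurable_cnj_compose[OF measurable_ident_sets[OF refl]])
    qed
    have law': "distr M borel (\<lambda>\<omega>. cnj (X \<omega> $$ prod.swap (i, k))) = distr \<xi>' borel (\<lambda>z. complex_of_real (b k i) * z)"
      if ik: "i < n" "k < n" for i k
    proof -
      have c: "cnj \<in> borel \<rightarrow>\<^sub>M borel" by (rule borel_measurable_cnj_compose[OF measurable_ident_sets[OF refl]])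
      have c': "cnj \<in> \<xi> \<rightarrow>\<^sub>M borel" by (rule borel_measurable_cnj_compose[OF measurable_ident_sets[OF S.sets_xi]])
      have f: "(\<lambda>z. complex_of_real (b k i) * z) \<in> borel \<rightarrow>\<^sub>M borel"
        by (intro borel_measurable_times borel_measurable_const measurable_ident_sets[OF refl])
      have f': "(\<lambda>z. complex_of_real (b k i) * z) \<in> \<xi> \<rightarrow>\<^sub>M borel"
        by (intro borel_measurable_times borel_measurable_const measurable_ident_sets[OF S.sets_xi])
      have "distr M borel (\<lambda>\<omega>. cnj (X \<omega> $$ (k, i))) = distr (distr M borel (\<lambda>\<omega>. X \<omega> $$ (k, i))) borel cnj"
        using distr_distr[OF c rv[OF ik(2,1)]] by (simp add: comp_def)
      also have "\<dots> = distr \<xi> borel (\<lambda>z. cnj (complex_of_real (b k i) * z))"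
        unfolding law[OF ik(2,1)] using distr_distr[OF c f'] by (simp add: comp_def)
      also have "\<dots> = distr \<xi>' borel (\<lambda>z. complex_of_real (b k i) * z)"
        unfolding \<xi>'_def using distr_distr[OF f c'] by (simp add: comp_def)
      finally show ?thesis by simp
    qed
    have ds': "doubly_stochastic_profile n (\<lambda>i k. b k i)" using ds by (auto simp: doubly_stochastic_profile_def)
    have bn': "0 \<le> b k i \<and> b k i \<le> \<beta>" if "i < n" "k < n" for i k using bn[OF that(2,1)] .
    show "emeasure M (G2 p) \<le> ennreal ((4 * real n + 3) * t)" unfolding t_def
      using S'.emeasure_entries_not_good[OF M ind' law' j eta C(3) beta ds' bn' small1 small2[OF z]]
      by (simp add: G2_def adj_def)
  qed
  let ?U = "(\<Union>p\<in>?I. A p) \<union> ((\<Union>p\<in>N \<times> {..<n}. G1 p) \<union> (\<Union>p\<in>N \<times> {..<n}. G2 p))"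
  have finN: "finite N" by (simp add: N_def)
  have setsU: "(\<Union>p\<in>?I. A p) \<in> sets M" "(\<Union>p\<in>N \<times> {..<n}. G1 p) \<in> sets M" "(\<Union>p\<in>N \<times> {..<n}. G2 p) \<in> sets M"
    using finN A(1) G1(1) G2(1) by (auto intro!: sets.finite_UN)
  have "{\<omega> \<in> space M. localized n (C / B) (\<lambda>p. if p \<in> ?I then X \<omega> $$ p else 0)} \<subseteq> ?U"
  proof (rule subsetI, rule ccontr)
    fix \<omega> assume "\<omega> \<in> {\<omega> \<in> space M. localized n (C / B) (\<lambda>p. if p \<in> ?I then X \<omega> $$ p else 0)}" and nU: "\<omega> \<notin> ?U"
    then have sp: "\<omega> \<in> space M" and "localized n (C / B) (\<lambda>p. if p \<in> ?I then X \<omega> $$ p else 0)" by auto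
    then obtain \<psi> w j where e: "\<And>i. i < n \<Longrightarrow> (\<Sum>k<n. (if (i, k) \<in> ?I then X \<omega> $$ (i, k) else 0) * \<psi> k) = w * \<psi> i"
      and u: "(\<Sum>k<n. (cmod (\<psi> k))\<^sup>2) = 1" and j: "j < n" "C / B < cmod (\<psi> j)"
      unfolding localized_def by auto
    have "cmod (\<psi> j) \<le> C / B"
    proof (rule delocalized_of_good[OF n ds B(1) _ C, where X = "\<lambda>i k. X \<omega> $$ (i, k)" and w = w])
      have "B ^ 1 \<le> B ^ 10" using B by (intro power_increasing) auto
      then show "B \<le> real n" using bw(1) B(2) by simp
      show "B ^ 10 \<le> real n" using bw(1) B(2) by simp
      show "(\<Sum>k<n. X \<omega> $$ (i, k) * \<psi> k) = w * \<psi> i" if "i < n" for i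
        using e[OF that] that by simp
      show "cmod (X \<omega> $$ (i, k)) \<le> b i k * T" if "i < n" "k < n" for i k
      proof -
        have "\<omega> \<notin> A (i, k)" using nU that by auto
        then show ?thesis using sp by (simp add: A_def not_less)
      qed
      show "good n (C / B\<^sup>2) b (\<lambda>i k. X \<omega> $$ (i, k)) z j" if "z \<in> net n" "cmod z \<le> 3 * B" "j < n" for z j
      proof -
        have "\<omega> \<notin> G1 (z, j)" using nU that by (auto simp: N_def)
        then show ?thesis using sp by (simp add: G1_def \<eta>_def)
      qed
      show "good n (C / B\<^sup>2) (\<lambda>i k. b k i) (adj (\<lambda>i k. X \<omega> $$ (i, k))) (cnj z) j" if "z \<in> net n" "cmod z \<le> 3 * B" "j < n" for z j
      proof -
        have "\<omega> \<notin> G2 (z, j)" using nU that by (auto simp: N_def)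
        then show ?thesis using sp by (simp add: G2_def \<eta>_def)
      qed
    qed (use bn j u in \<open>auto simp: \<beta>_def\<close>)
    with j show False by simp
  qed
  then have "emeasure M {\<omega> \<in> space M. localized n (C / B) (\<lambda>p. if p \<in> ?I then X \<omega> $$ p else 0)} \<le> emeasure M ?U"
    by (rule emeasure_mono) (intro sets.Un setsU)
  also have "\<dots> \<le> ennreal (real (card ?I) * t + (real (card (N \<times> {..<n})) * ((4 * real n + 3) * t) + real (card (N \<times> {..<n})) * ((4 * real n + 3) * t)))"
    using t0 finN by (intro emeasure_Un_le emeasure_UN_le setsU sets.Un A G1 G2 add_nonneg_nonneg mult_nonneg_nonneg) auto
  \<comment> \<open>The net has at most 25 n^4 points and 4 n + 3 \<le> 7 n, so each of the two
    families contributes 175 n^6; the n^2 entries are counted as n^6, and 351 = 1 + 2 times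
    175.\<close>
  also have "\<dots> \<le> ennreal (351 * real n ^ 6 * t)"
  proof (rule ennreal_leI)
    have n1: "1 \<le> real n" using n by simp
    have "card N \<le> card (net n)" unfolding N_def by (intro card_mono) auto
    then have cN: "real (card N) \<le> 25 * real n ^ 4" using card_net[OF n] by (simp add: of_nat_le_iff order_trans)
    have "real (card (N \<times> {..<n})) * ((4 * real n + 3) * t) = real (card N) * (real n * (4 * real n + 3)) * t"
      by (simp add: card_cartesian_product)
    also have "\<dots> \<le> (25 * real n ^ 4) * (real n * (7 * real n)) * t"
      using n1 t0 cN by (intro mult_right_mono mult_mono) auto
    also have "\<dots> = 175 * real n ^ 6 * t" by (simp add: eval_nat_numeral)
    finally have 1: "real (card (N \<times> {..<n})) * ((4 * real n + 3) * t) \<le> 175 * real n ^ 6 * t" .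
    have "real (card ?I) * t = real n ^ 2 * t" by (simp add: card_cartesian_product power2_eq_square)
    also have "\<dots> \<le> real n ^ 6 * t" using n1 t0 by (intro mult_right_mono power_increasing) auto
    finally show "real (card ?I) * t + (real (card (N \<times> {..<n})) * ((4 * real n + 3) * t) + real (card (N \<times> {..<n})) * ((4 * real n + 3) * t))
        \<le> 351 * real n ^ 6 * t" using 1 by linarith
  qed
  finally show ?thesis by (simp only: t_def)
qed

theorem theorem1p9:
  fixes \<epsilon> c K :: real
  assumes "0 < \<epsilon>" and "0 < c" and "0 < K"
  shows "\<exists>n0::nat. \<forall>n\<ge>n0. \<forall>(b :: nat \<Rightarrow> nat \<Rightarrow> real) (\<xi> :: complex measure)
           (M :: 'w measure) (X :: 'w \<Rightarrow> complex mat).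
           inhomogeneous_model K n b \<xi> M X \<longrightarrow> gaussian_law \<xi> \<longrightarrow>
           real n powr \<epsilon> \<le> bandwidth n b \<longrightarrow>
           1 - real n powr (-10) \<le>
             measure M {\<omega> \<in> space M. \<forall>\<psi> z. eigenvector (X \<omega>) \<psi> z \<and> l2_norm_vec \<psi> = 1 \<longrightarrow>
                          max_norm_vec \<psi> \<le> bandwidth n b powr (- 1 / 10) * real n powr c}"
proof -
  define D where "D = exp (mgf_const K * (1 / (2 * K\<^sup>2))\<^sup>2)"
  have "4 * K\<^sup>2 > 0" using assms by simp
  from eventually_union_bound[OF assms(2) this, of D] obtain n0 where n0: "\<And>n. n \<ge> n0 \<Longrightarrow> 1 \<le> n \<and> 48 \<le> real n powr c \<and>
     351 * real n ^ 6 * (4 * (D * exp (- (real n powr (c / 2) / (4 * K\<^sup>2))))) \<le> real n powr (-10)"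
    unfolding eventually_sequentially by blast
  show ?thesis
  proof (intro exI[of _ n0] allI impI)
    fix n b and \<xi> :: "complex measure" and M :: "'w measure" and X :: "'w \<Rightarrow> complex mat"
    assume nn: "n \<ge> n0" and model: "inhomogeneous_model K n b \<xi> M X"
      and bwn: "real n powr \<epsilon> \<le> bandwidth n b"
    let ?I = "{..<n} \<times> {..<n}"
    have n: "1 \<le> n" and C48: "48 \<le> real n powr c"
      and ub: "351 * real n ^ 6 * (4 * (D * exp (- (real n powr (c / 2) / (4 * K\<^sup>2))))) \<le> real n powr (-10)"
      using n0[OF nn] by auto
    interpret M: prob_space M using model by (simp add: inhomogeneous_model_def)
    have rv: "(\<lambda>\<omega>. X \<omega> $$ p) \<in> borel_measurable M" if "p \<in> ?I" for p
    proof (rule M.indep_vars_rv[OF _ that])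
      show "M.indep_vars (\<lambda>_. borel) (\<lambda>p \<omega>. X \<omega> $$ p) ?I"
        using model unfolding inhomogeneous_model_def by blast
    qed
    interpret S: subgaussian_entries \<xi> K using model assms(3)
      by unfold_locales (auto simp: inhomogeneous_model_def)
    \<comment> \<open>The assumption on the bandwidth enters through b_n \<ge> 1, which makes B at
      least 1; T is the square root of n^c.\<close>
    define B where "B = bandwidth n b powr (1 / 10)"
    define T where "T = real n powr (c / 2)"
    have bw1: "1 \<le> bandwidth n b"
      using bwn ge_one_powr_ge_zero[of "real n" \<epsilon>] n assms(1) by simp
    have B1: "1 \<le> B" unfolding B_def using bw1 by (intro ge_one_powr_ge_zero) auto
    have B10: "B ^ 10 = bandwidth n b"
      unfolding B_def using bw1 by (simp add: powr_powr flip: powr_realpow)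
    have T1: "1 \<le> T" unfolding T_def using n assms(2) by (intro ge_one_powr_ge_zero) auto
    have T2: "real n powr c = T\<^sup>2" unfolding T_def using n by (simp add: powr_powr flip: powr_realpow)
    have thr: "bandwidth n b powr (- 1 / 10) * real n powr c = real n powr c / B"
      using bw1 by (simp add: B_def powr_minus_divide)
    let ?a = "\<lambda>\<omega> p. if p \<in> ?I then X \<omega> $$ p else 0"
    let ?L = "{\<omega> \<in> space M. localized n (real n powr c / B) (?a \<omega>)}"
    \<comment> \<open>The index type is countable, so the Borel sets of the function space are those
      of the product sigma-algebra and measurability of the coordinates suffices.\<close>
    have "?a \<in> M \<rightarrow>\<^sub>M (borel :: (nat \<times> nat \<Rightarrow> complex) measure)"
    proof -
      have "?a \<in> M \<rightarrow>\<^sub>M PiM UNIV (\<lambda>_. borel)"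
      proof (rule measurable_PiM_single')
        fix p show "(\<lambda>\<omega>. ?a \<omega> p) \<in> borel_measurable M" by (cases "p \<in> ?I") (use rv in simp_all)
      qed auto
      then show ?thesis by (subst measurable_cong_sets[OF refl sets_PiM_equal_borel[symmetric]])
    qed
    from measurable_sets[OF this borel_localized] have L: "?L \<in> M.events"
      by (simp add: vimage_def Int_def conj_commute)
    have "ennreal (measure M ?L) = emeasure M ?L" by (simp add: M.emeasure_eq_measure)
    also have "\<dots> \<le> ennreal (351 * real n ^ 6 * S.tail T)"
      by (rule emeasure_localized[OF model assms(3) n B1 B10 C48 T2 T1])
    also have "\<dots> \<le> ennreal (real n powr (-10))"
      using ub by (intro ennreal_leI) (simp add: S.tail_def D_def T_def)
    finally have "measure M ?L \<le> real n powr (-10)" by (simp add: ennreal_le_iff)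
    moreover have "{\<omega> \<in> space M. \<forall>\<psi> z. eigenvector (X \<omega>) \<psi> z \<and> l2_norm_vec \<psi> = 1 \<longrightarrow>
                          max_norm_vec \<psi> \<le> bandwidth n b powr (- 1 / 10) * real n powr c} = space M - ?L"
    proof -
      have "X \<omega> \<in> carrier_mat n n" if "\<omega> \<in> space M" for \<omega> using model that by (simp add: inhomogeneous_model_def)
      then show ?thesis unfolding thr using eigenvector_iff_localized[OF _ n] by blast
    qed
    ultimately show "1 - real n powr (-10) \<le>
             measure M {\<omega> \<in> space M. \<forall>\<psi> z. eigenvector (X \<omega>) \<psi> z \<and> l2_norm_vec \<psi> = 1 \<longrightarrow>
                          max_norm_vec \<psi> \<le> bandwidth n b powr (- 1 / 10) * real n powr c}"
      using M.prob_compl[OF L] by simp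
  qed
qed

end
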